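(* Let $\mathbb K$ be a field, $s,d\in\mathbb N$, $\underline Y=(Y_1,\ldots,Y_d)\in(\mathbb K^{s\times s})^d$, and let $f$ be a generalized nc power series around $\underline Y$, $$f(\underline X)=\sum_{\omega\in\mathcal G_d}(\underline X-I_m\otimes\underline Y)^{\odot_s\omega}f_\omega .$$ Suppose that $f$ admits a nc Fornasini--Marchesini realization $\mathcal R$ centred at $\underline Y$ and described by $(L;D,C,\underline{\mathbf A},\underline{\mathbf B})$, and that $\mathcal R$ is controllable and observable. Then the series $f$ is a nc function on $Nilp(\underline Y)$ if and only if the following equations hold for every $S,Z_1,Z_2\in\mathbb K^{s\times s}$ and $1\le i_1,i_2\le d$ (where $[S,Y]=SY-YS$): $$SD-DS=C\sum_{k=1}^d\mathbf B_k([S,Y_k]),$$ $$SC\mathbf B_{i_1}(Z_1)-C\mathbf B_{i_1}(SZ_1)=C\Big(\sum_{k=1}^d\mathbf A_k([S,Y_k])\Big)\mathbf B_{i_1}(Z_1),$$ $$SC\mathbf A_{i_1}(Z_1)-C\mathbf A_{i_1}(SZ_1)=C\Big(\sum_{k=1}^d\mathbf A_k([S,Y_k])\Big)\mathbf A_{i_1}(Z_1),$$ $$\mathbf B_{i_1}(Z_1S)-\mathbf B_{i_1}(Z_1)S=\mathbf A_{i_1}(Z_1)\sum_{k=1}^d\mathbf B_k([S,Y_k]),$$ $$\mathbf A_{i_1}(Z_1S)\mathbf B_{i_2}(Z_2)-\mathbf A_{i_1}(Z_1)\mathbf B_{i_2}(SZ_2)=\mathbf A_{i_1}(Z_1)\Big(\sum_{k=1}^d\mathbf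 A_k([S,Y_k])\Big)\mathbf B_{i_2}(Z_2),$$ $$\mathbf A_{i_1}(Z_1S)\mathbf A_{i_2}(Z_2)-\mathbf A_{i_1}(Z_1)\mathbf A_{i_2}(SZ_2)=\mathbf A_{i_1}(Z_1)\Big(\sum_{k=1}^d\mathbf A_k([S,Y_k])\Big)\mathbf A_{i_2}(Z_2).$$
   Context: $\mathcal G_d$ is the free monoid on $g_1,\ldots,g_d$; $|\omega|$ is word length. Power series. A generalized nc power series around $\underline Y$ is given by $|\omega|$-linear maps $f_\omega:(\mathbb K^{s\times s})^{|\omega|}\to\mathbb K^{s\times s}$, $\omega\in\mathcal G_d$ (with $f_\emptyset\in\mathbb K^{s\times s}$). For $P=[P_{ij}],Q=[Q_{ij}]$ $m\times m$ block matrices with $s\times s$ blocks (or blocks in tensor powers of $\mathbb K^{s\times s}$), $P\odot_sQ=[\sum_kP_{ik}\otimes Q_{kj}]_{i,j}$, viewed as an $m\times m$ matrix over the tensor algebra of $\mathbb K^{s\times s}$; $\underline X^{\odot_s\omega}=X_{i_1}\odot_s\cdots\odot_sX_{i_\ell}$ for $\omega=g_{i_1}\cdots g_{i_\ell}$. The map $f_\omega$, regarded as linear on $(\mathbb K^{s\times s})^{\otimes|\omega|}$, is applied to each entry of the $m\times m$ matrix $(\underline X-I_m\otimes\underline Y)^{\odot_s\omega}$, giving an element of $\mathbb K^{sm\times sm}$ (for $\omega=\emptyset$ the term is $I_m\otimes f_\emptyset$). $Nilp(\underline Y)=\coprod_mNilp_{sm}(\underline Y)$, where $Nilp_{sm}(\underline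 Y)$ is the set of $\underline X\in(\mathbb K^{sm\times sm})^d$ for which there is $\kappa\in\mathbb N$ with $(\underline X-I_m\otimes\underline Y)^{\odot_s\omega}=0$ for all $|\omega|\ge\kappa$; the series is a finite sum there. Nc functions. $(\mathbb K^d)_{nc}=\coprod_n(\mathbb K^{n\times n})^d$, $\mathbb K_{nc}=\coprod_n\mathbb K^{n\times n}$. A nc set is a subset closed under direct sums. A map $f$ from a nc set $\Omega\subseteq(\mathbb K^d)_{nc}$ to $\mathbb K_{nc}$ is a nc function if it is graded ($n\times n$ tuples go to $n\times n$ matrices), $f(\underline X\oplus\underline{X}')=f(\underline X)\oplus f(\underline X')$, and $f(T\underline XT^{-1})=Tf(\underline X)T^{-1}$ whenever $\underline X,T\underline XT^{-1}\in\Omega_n$ with $T\in\mathbb K^{n\times n}$ invertible. Realizations. A nc Fornasini--Marchesini realization centred at $\underline Y$, described by $(L;D,C,\underline{\mathbf A},\underline{\mathbf B})$, consists of $L\in\mathbb N$, linear maps $\mathbf A_k:\mathbb K^{s\times s}\to\mathbb K^{L\times L}$, $\mathbf B_k:\mathbb K^{s\times s}\to\mathbb K^{L\times s}$ ($1\le k\le d$), $C\in\mathbb K^{s\times L}$, $D\in\mathbb K^{s\times s}$. The series $f$ admits $\mathcal R$ if $f_\emptyset=D$ and $f_\omega(Z_1,\ldots,Z_\ell)=C\mathbf A_{i_1}(Z_1)\cdots\mathbf A_{i_{\ell-1}}(Z_{\ell-1})\mathbf B_{i_\ell}(Z_\ell)$ for all $\omega=g_{i_1}\cdots g_{i_\ell}\ne\emptyset$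 and $Z_1,\ldots,Z_\ell\in\mathbb K^{s\times s}$. Controllable: the sum of the column spaces of all matrices $\mathbf A_{i_1}(X_1)\cdots\mathbf A_{i_\ell}(X_\ell)\mathbf B_k(X_{\ell+1})$ ($\ell\ge0$, $1\le i_1,\ldots,i_\ell,k\le d$, $X_j\in\mathbb K^{s\times s}$) is $\mathbb K^L$. Observable: the intersection of the kernels of all $C\mathbf A_{i_1}(X_1)\cdots\mathbf A_{i_\ell}(X_\ell)$ ($\ell\ge0$) is $\{0\}$. *)

theory Defs
  imports "Jordan_Normal_Form.VS_Connect" "Jordan_Normal_Form.Matrix_Kernel"
begin

text \<open>
  The letters \<open>g\<^sub>1, \<dots>, g\<^sub>d\<close> are numbered \<open>0, \<dots>, d - 1\<close>; elements of the free monoid on them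
  are lists over \<open>{..<d}\<close>.  A \<open>d\<close>-tuple of matrices is a list of length \<open>d\<close>.
\<close>

definition words :: "nat \<Rightarrow> nat list set" where
  "words d = {\<omega>. set \<omega> \<subseteq> {..<d}}"

definition mat_tuples :: "nat \<Rightarrow> nat \<Rightarrow> 'a mat list set" where
  "mat_tuples d n = {X. length X = d \<and> set X \<subseteq> carrier_mat n n}"

definition mat_linear :: "nat \<Rightarrow> nat \<Rightarrow> nat \<Rightarrow> ('a::field mat \<Rightarrow> 'a mat) \<Rightarrow> bool" where
  "mat_linear s nr nc F \<longleftrightarrow>
     (\<forall>Z \<in> carrier_mat s s. F Z \<in> carrier_mat nr nc) \<and>
     (\<forall>Z \<in> carrier_mat s s. \<forall>Z' \<in> carrier_mat s s. F (Z + Z') = F Z + F Z') \<and>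
     (\<forall>c. \<forall>Z \<in> carrier_mat s s. F (c \<cdot>\<^sub>m Z) = c \<cdot>\<^sub>m F Z)"

definition mat_multilinear :: "nat \<Rightarrow> nat \<Rightarrow> ('a::field mat list \<Rightarrow> 'a mat) \<Rightarrow> bool" where
  "mat_multilinear s l F \<longleftrightarrow>
     (\<forall>Zs \<in> mat_tuples l s. F Zs \<in> carrier_mat s s \<and>
        (\<forall>j<l. mat_linear s s s (\<lambda>Z. F (Zs[j := Z]))))"

text \<open>The constant \<open>f\<^sub>\<emptyset>\<close> is the value \<open>f [] []\<close> of the \<open>0\<close>-linear map at the empty tuple.\<close>

definition generalized_nc_series ::
    "nat \<Rightarrow> nat \<Rightarrow> (nat list \<Rightarrow> 'a::field mat list \<Rightarrow> 'a mat) \<Rightarrow> bool" where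
  "generalized_nc_series s d f \<longleftrightarrow> (\<forall>\<omega> \<in> words d. mat_multilinear s (length \<omega>) (f \<omega>))"

text \<open>
  The tensor algebra of \<open>K\<^bsup>s\<times>s\<^esup>\<close> in coordinates.  The elementary matrices \<open>E\<^bsub>ab\<^esub>\<close>, \<open>a, b < s\<close>,
  form a basis of \<open>K\<^bsup>s\<times>s\<^esup>\<close>, hence the tensors \<open>E\<^bsub>a1 b1\<^esub> \<otimes> \<dots> \<otimes> E\<^bsub>al bl\<^esub>\<close> form a basis of its
  \<open>l\<close>-th tensor power.  A tensor is represented by its coefficient function on the lists
  \<open>[(a1, b1), \<dots>, (al, bl)]\<close>, and the tensor product is concatenation of basis elements,
  extended bilinearly.
\<close>

type_synonym 'a tensor = "(nat \<times> nat) list \<Rightarrow> 'a"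

definition tensor_one :: "'a::field tensor" where
  "tensor_one w = (if w = [] then 1 else 0)"

definition tensor_mult :: "'a::field tensor \<Rightarrow> 'a tensor \<Rightarrow> 'a tensor" where
  "tensor_mult u v w = (\<Sum>n\<le>length w. u (take n w) * v (drop n w))"

definition tensor_of_mat :: "nat \<Rightarrow> 'a::field mat \<Rightarrow> 'a tensor" where
  "tensor_of_mat s Z w = (case w of [(a, b)] \<Rightarrow> if a < s \<and> b < s then Z $$ (a, b) else 0 | _ \<Rightarrow> 0)"

definition elem_mat :: "nat \<Rightarrow> nat \<times> nat \<Rightarrow> 'a::field mat" where
  "elem_mat s ab = mat s s (\<lambda>ij. if ij = ab then 1 else 0)"

text \<open>
  The linear map on the \<open>l\<close>-th tensor power induced by an \<open>l\<close>-linear map \<open>F\<close>: it takes the basis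
  element \<open>E\<^bsub>a1 b1\<^esub> \<otimes> \<dots> \<otimes> E\<^bsub>al bl\<^esub>\<close> to \<open>F [E\<^bsub>a1 b1\<^esub>, \<dots>, E\<^bsub>al bl\<^esub>]\<close>.
\<close>

definition tensor_lift :: "nat \<Rightarrow> nat \<Rightarrow> ('a::field mat list \<Rightarrow> 'a mat) \<Rightarrow> 'a tensor \<Rightarrow> 'a mat" where
  "tensor_lift s l F t = mat s s (\<lambda>ij.
     \<Sum>w \<in> {w. length w = l \<and> set w \<subseteq> {..<s} \<times> {..<s}}. t w * F (map (elem_mat s) w) $$ ij)"

text \<open>
  Matrices over the tensor algebra.  An \<open>sm \<times> sm\<close> matrix is viewed as the \<open>m \<times> m\<close> matrix of its
  \<open>s \<times> s\<close> blocks, regarded as tensors of degree one.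
\<close>

definition tensor_zero_mat :: "nat \<Rightarrow> 'a::field tensor mat" where
  "tensor_zero_mat m = mat m m (\<lambda>(i, j). \<lambda>w. 0)"

definition tensor_one_mat :: "nat \<Rightarrow> 'a::field tensor mat" where
  "tensor_one_mat m = mat m m (\<lambda>(i, j). if i = j then tensor_one else (\<lambda>w. 0))"

definition odot :: "'a::field tensor mat \<Rightarrow> 'a tensor mat \<Rightarrow> 'a tensor mat" where
  "odot P Q = mat (dim_row P) (dim_col Q)
     (\<lambda>(i, j). \<lambda>w. \<Sum>k<dim_col P. tensor_mult (P $$ (i, k)) (Q $$ (k, j)) w)"

definition block :: "nat \<Rightarrow> 'a mat \<Rightarrow> nat \<times> nat \<Rightarrow> 'a mat" where
  "block s P = (\<lambda>(i, j). mat s s (\<lambda>(a, b). P $$ (i * s + a, j * s + b)))"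

definition tensor_blocks :: "nat \<Rightarrow> nat \<Rightarrow> 'a::field mat \<Rightarrow> 'a tensor mat" where
  "tensor_blocks s m P = mat m m (\<lambda>ij. tensor_of_mat s (block s P ij))"

definition odot_power :: "nat \<Rightarrow> nat \<Rightarrow> 'a::field mat list \<Rightarrow> nat list \<Rightarrow> 'a tensor mat" where
  "odot_power s m X \<omega> = foldr (\<lambda>i Q. odot (tensor_blocks s m (X ! i)) Q) \<omega> (tensor_one_mat m)"

text \<open>
  \<open>X - I\<^sub>m \<otimes> Y\<close>; the Kronecker product \<open>I\<^sub>m \<otimes> Y\<^sub>k\<close> is the block diagonal matrix with \<open>m\<close> copies
  of \<open>Y\<^sub>k\<close>.
\<close>

definition centred :: "nat \<Rightarrow> 'a::field mat list \<Rightarrow> 'a mat list \<Rightarrow> 'a mat list" where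
  "centred m Y X = map2 (\<lambda>Xk Yk. Xk - diag_block_mat (replicate m Yk)) X Y"

text \<open>
  Subsets of \<open>\<Coprod>\<^bsub>n \<ge> 1\<^esub> (K\<^bsup>n\<times>n\<^esup>)\<^bsup>d\<^esup>\<close> are given as families of sets indexed by \<open>n\<close>, and graded maps
  on them as families of maps indexed by \<open>n\<close>.
\<close>

definition nilp :: "nat \<Rightarrow> nat \<Rightarrow> 'a::field mat list \<Rightarrow> nat \<Rightarrow> 'a mat list set" where
  "nilp s d Y n = {X \<in> mat_tuples d n. \<exists>m>0. n = s * m \<and>
     (\<exists>\<kappa>. \<forall>\<omega> \<in> words d. \<kappa> \<le> length \<omega> \<longrightarrow> odot_power s m (centred m Y X) \<omega> = tensor_zero_mat m)}"

definition nc_term ::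
    "nat \<Rightarrow> nat \<Rightarrow> 'a::field mat list \<Rightarrow> (nat list \<Rightarrow> 'a mat list \<Rightarrow> 'a mat) \<Rightarrow> 'a mat list
      \<Rightarrow> nat list \<Rightarrow> 'a mat" where
  "nc_term s m Y f X \<omega> = mat (s * m) (s * m) (\<lambda>(r, c).
     tensor_lift s (length \<omega>) (f \<omega>)
       (odot_power s m (centred m Y X) \<omega> $$ (r div s, c div s)) $$ (r mod s, c mod s))"

text \<open>
  The sum runs over the words with nonvanishing power of \<open>X - I\<^sub>m \<otimes> Y\<close>; all other terms are zero,
  and on \<^const>\<open>nilp\<close> there are only finitely many such words.
\<close>

definition nc_series_eval ::
    "nat \<Rightarrow> nat \<Rightarrow> 'a::field mat list \<Rightarrow> (nat list \<Rightarrow> 'a mat list \<Rightarrow> 'a mat)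
      \<Rightarrow> nat \<Rightarrow> 'a mat list \<Rightarrow> 'a mat" where
  "nc_series_eval s d Y f n X = (let m = n div s in
     mat n n (\<lambda>rc.
       \<Sum>\<omega> \<in> {\<omega> \<in> words d. odot_power s m (centred m Y X) \<omega> \<noteq> tensor_zero_mat m}.
         nc_term s m Y f X \<omega> $$ rc))"

definition mat_dsum :: "'a::field mat \<Rightarrow> 'a mat \<Rightarrow> 'a mat" where
  "mat_dsum M N = four_block_mat M (0\<^sub>m (dim_row M) (dim_col N)) (0\<^sub>m (dim_row N) (dim_col M)) N"

definition nc_set :: "nat \<Rightarrow> (nat \<Rightarrow> 'a::field mat list set) \<Rightarrow> bool" where
  "nc_set d \<Omega> \<longleftrightarrow> \<Omega> 0 = {} \<and> (\<forall>n. \<Omega> n \<subseteq> mat_tuples d n) \<and>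
     (\<forall>n n'. \<forall>X \<in> \<Omega> n. \<forall>X' \<in> \<Omega> n'. map2 mat_dsum X X' \<in> \<Omega> (n + n'))"

definition nc_function ::
    "nat \<Rightarrow> (nat \<Rightarrow> 'a::field mat list set) \<Rightarrow> (nat \<Rightarrow> 'a mat list \<Rightarrow> 'a mat) \<Rightarrow> bool" where
  "nc_function d \<Omega> F \<longleftrightarrow> nc_set d \<Omega> \<and>
     (\<forall>n. \<forall>X \<in> \<Omega> n. F n X \<in> carrier_mat n n) \<and>
     (\<forall>n n'. \<forall>X \<in> \<Omega> n. \<forall>X' \<in> \<Omega> n'.
        F (n + n') (map2 mat_dsum X X') = mat_dsum (F n X) (F n' X')) \<and>
     (\<forall>n. \<forall>T \<in> carrier_mat n n. \<forall>T' \<in> carrier_mat n n. inverts_mat T T' \<longrightarrow> inverts_mat T' T \<longrightarrow>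
        (\<forall>X \<in> \<Omega> n. map (\<lambda>M. T * M * T') X \<in> \<Omega> n \<longrightarrow>
           F n (map (\<lambda>M. T * M * T') X) = T * F n X * T'))"

definition fm_realization ::
    "nat \<Rightarrow> nat \<Rightarrow> nat \<Rightarrow> 'a::field mat \<Rightarrow> 'a mat
      \<Rightarrow> (nat \<Rightarrow> 'a mat \<Rightarrow> 'a mat) \<Rightarrow> (nat \<Rightarrow> 'a mat \<Rightarrow> 'a mat) \<Rightarrow> bool" where
  "fm_realization s d L D C A B \<longleftrightarrow> D \<in> carrier_mat s s \<and> C \<in> carrier_mat s L \<and>
     (\<forall>k<d. mat_linear s L L (A k)) \<and> (\<forall>k<d. mat_linear s L s (B k))"

text \<open>\<open>A\<^bsub>i1\<^esub>(Z\<^sub>1) \<cdots> A\<^bsub>il\<^esub>(Z\<^sub>l)\<close>, the identity matrix for the empty word.\<close>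

definition word_prod ::
    "nat \<Rightarrow> (nat \<Rightarrow> 'a::field mat \<Rightarrow> 'a mat) \<Rightarrow> nat list \<Rightarrow> 'a mat list \<Rightarrow> 'a mat" where
  "word_prod L A \<omega> Zs = foldr (*) (map2 A \<omega> Zs) (1\<^sub>m L)"

definition admits ::
    "nat \<Rightarrow> nat \<Rightarrow> (nat list \<Rightarrow> 'a::field mat list \<Rightarrow> 'a mat) \<Rightarrow> nat \<Rightarrow> 'a mat \<Rightarrow> 'a mat
      \<Rightarrow> (nat \<Rightarrow> 'a mat \<Rightarrow> 'a mat) \<Rightarrow> (nat \<Rightarrow> 'a mat \<Rightarrow> 'a mat) \<Rightarrow> bool" where
  "admits s d f L D C A B \<longleftrightarrow> f [] [] = D \<and>
     (\<forall>\<omega> \<in> words d. \<omega> \<noteq> [] \<longrightarrow> (\<forall>Zs \<in> mat_tuples (length \<omega>) s.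
        f \<omega> Zs = C * word_prod L A (butlast \<omega>) (butlast Zs) * B (last \<omega>) (last Zs)))"

text \<open>The sum of a family of subspaces of \<open>K\<^bsup>L\<^esup>\<close> is the span of their union.\<close>

definition controllable ::
    "nat \<Rightarrow> nat \<Rightarrow> nat \<Rightarrow> (nat \<Rightarrow> 'a::field mat \<Rightarrow> 'a mat) \<Rightarrow> (nat \<Rightarrow> 'a mat \<Rightarrow> 'a mat) \<Rightarrow> bool" where
  "controllable s d L A B \<longleftrightarrow>
     LinearCombinations.module.span class_ring (module_vec TYPE('a) L)
       (\<Union> {vec_space.col_space L (word_prod L A \<omega> Xs * B k Z) | \<omega> Xs k Z.
             \<omega> \<in> words d \<and> Xs \<in> mat_tuples (length \<omega>) s \<and> k < d \<and> Z \<in> carrier_mat s s})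
     = carrier_vec L"

definition observable ::
    "nat \<Rightarrow> nat \<Rightarrow> nat \<Rightarrow> 'a::field mat \<Rightarrow> (nat \<Rightarrow> 'a mat \<Rightarrow> 'a mat) \<Rightarrow> bool" where
  "observable s d L C A \<longleftrightarrow>
     \<Inter> {mat_kernel (C * word_prod L A \<omega> Xs) | \<omega> Xs.
          \<omega> \<in> words d \<and> Xs \<in> mat_tuples (length \<omega>) s}
     = {0\<^sub>v L}"

definition commutator :: "'a::field mat \<Rightarrow> 'a mat \<Rightarrow> 'a mat" where
  "commutator S Y = S * Y - Y * S"

definition matrix_sum :: "nat \<Rightarrow> nat \<Rightarrow> nat \<Rightarrow> (nat \<Rightarrow> 'a::field mat) \<Rightarrow> 'a mat" where
  "matrix_sum nr nc d F = mat nr nc (\<lambda>ij. \<Sum>k<d. F k $$ ij)"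

end

theory Submission
  imports Defs "HOL-Library.Function_Algebras"
begin

text \<open>
  Let \<open>a\<close> and \<open>b\<close> be the block matrices with entries \<open>\<Sum>\<^sub>k A\<^sub>k(N\<^sub>k)\<^sub>i\<^sub>j\<close> and \<open>\<Sum>\<^sub>k B\<^sub>k(N\<^sub>k)\<^sub>i\<^sub>j\<close>, where
  \<open>N = X - I \<otimes> Y\<close>.  On nilpotent arguments \<open>a\<close> is nilpotent and \<open>f(X) = D + C v\<close> for the unique
  solution \<open>v\<close> of \<open>v = b + a v\<close>.

  If \<open>X' = T X T\<^sup>-\<^sup>1\<close>, then \<open>N' T = T N + [T, I \<otimes> Y]\<close>.  The six equations, applied blockwise with
  \<open>T\<close> in place of \<open>S\<close>, imply that both \<open>v' T\<close> and the vector built from \<open>N' T\<close> and \<open>v\<close> solve the same linear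
  equation; uniqueness gives \<open>T f(X) = f(X') T\<close>.  Direct sums are respected for every series.

  Conversely, put two words of matrix arguments on the superdiagonal of \<open>N\<close>, leave the link between them
  open, and conjugate by \<open>1 + S E\<close>, where \<open>E\<close> is the matrix unit at the open link.  The corner entry of
  \<open>T f(X) = f(X') T\<close> is one of the equations, multiplied by a word in the \<open>A\<^sub>k\<close> after \<open>C\<close> on the left
  and by a word ending in some \<open>B\<^sub>k\<close> on the right; observability and controllability cancel these words.
\<close>

text \<open>The equations are linear in S and hold for every S, so each block of T may take the
  place of S, invertible or not. In the converse S must be arbitrary as well; placing it off the
  diagonal makes T = 1 + S E invertible, with inverse 1 - S E. Conjugating X = I \<otimes> Y + N
  then changes N by [S, Y_k] at the open link, by S times the link after it, and by minus the link
  before it times S. These three changes are the three kinds of terms in the equations. They keep N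
  strictly upper triangular, so that both arguments lie in Nilp. Nilp is a condition in the tensor
  algebra, whereas a is an ordinary block matrix. The bridge is that the product of blocks along a
  word is the image of the power for that word under the induced linear map. Hence some power of a
  vanishes, and v is a finite Neumann sum of terms a^l b. Right words consisting of a single B give
  the equations ending in B; longer right words give the equations ending in A with a reachable
  matrix still attached.\<close>

section \<open>Matrices as functions\<close>

text \<open>
  Only the inner dimension of a product is recorded, so that associativity and bilinearity hold
  without side conditions.
\<close>

type_synonym 'a fmat = "nat \<Rightarrow> nat \<Rightarrow> 'a"

text \<open>Makes the pointwise \<open>0\<close> the normal form, so that the rules for zero
  matrices apply after unfolding.\<close>

lemma fmat_zero_fold [simp]: "(\<lambda>a b. 0) = (0 :: 'a::zero fmat)"
  by (simp add: fun_eq_iff)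

definition fmul :: "nat \<Rightarrow> 'a::field fmat \<Rightarrow> 'a fmat \<Rightarrow> 'a fmat" where
  "fmul n P Q = (\<lambda>i j. \<Sum>k<n. P i k * Q k j)"

lemma sum_apply: "sum f I x = (\<Sum>a\<in>I. f a x)"
  by (induction I rule: infinite_finite_induct) auto

lemma fmul_assoc: "fmul n (fmul k P Q) R = fmul k P (fmul n Q R)"
proof (intro ext)
  fix i j
  have "fmul n (fmul k P Q) R i j = (\<Sum>a<n. \<Sum>b<k. P i b * Q b a * R a j)"
    by (simp add: fmul_def sum_distrib_right)
  also have "\<dots> = (\<Sum>b<k. \<Sum>a<n. P i b * Q b a * R a j)"
    by (rule sum.swap)
  also have "\<dots> = fmul k P (fmul n Q R) i j"
    by (simp add: fmul_def sum_distrib_left mult.assoc)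
  finally show "fmul n (fmul k P Q) R i j = fmul k P (fmul n Q R) i j" .
qed

lemma fmul_add_left: "fmul n (P + Q) R = fmul n P R + fmul n Q R"
  by (intro ext) (simp add: fmul_def algebra_simps sum.distrib)

lemma fmul_add_right: "fmul n P (Q + R) = fmul n P Q + fmul n P R"
  by (intro ext) (simp add: fmul_def algebra_simps sum.distrib)

lemma fmul_diff_left: "fmul n (P - Q) R = fmul n P R - fmul n Q R"
  by (intro ext) (simp add: fmul_def algebra_simps sum_subtractf)

lemma fmul_diff_right: "fmul n P (Q - R) = fmul n P Q - fmul n P R"
  by (intro ext) (simp add: fmul_def algebra_simps sum_subtractf)

lemma fmul_zero_left [simp]: "fmul n 0 R = 0"
  by (intro ext) (simp add: fmul_def)

lemma fmul_zero_right [simp]: "fmul n R 0 = 0"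
  by (intro ext) (simp add: fmul_def)

lemma fmul_sum_left: "fmul n (sum f I) R = (\<Sum>a\<in>I. fmul n (f a) R)"
  using sum_comp_morphism[of "\<lambda>P. fmul n P R" f I] by (simp add: fmul_add_left o_def)

lemma fmul_sum_right: "fmul n P (sum f I) = (\<Sum>a\<in>I. fmul n P (f a))"
  using sum_comp_morphism[of "fmul n P" f I] by (simp add: fmul_add_right o_def)

definition fsmult :: "'a::field \<Rightarrow> 'a fmat \<Rightarrow> 'a fmat" where
  "fsmult c P = (\<lambda>i j. c * P i j)"

lemma fsmult_zero [simp]: "fsmult 0 P = 0" "fsmult c 0 = 0"
  by (auto simp: fsmult_def fun_eq_iff)

lemma fsmult_sum_left: "fsmult (sum f I) P = (\<Sum>a\<in>I. fsmult (f a) P)"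
  by (auto simp: fsmult_def fun_eq_iff sum_apply sum_distrib_right)

lemma fsmult_sum_right: "fsmult c (sum f I) = (\<Sum>a\<in>I. fsmult c (f a))"
  by (auto simp: fsmult_def fun_eq_iff sum_apply sum_distrib_left)

lemma fsmult_fsmult: "fsmult a (fsmult b P) = fsmult (a * b) P"
  by (auto simp: fsmult_def fun_eq_iff)

lemma fmul_fsmult_left: "fmul n (fsmult c P) R = fsmult c (fmul n P R)"
  by (intro ext) (simp add: fmul_def fsmult_def sum_distrib_left mult.assoc)

lemma fmul_fsmult_right: "fmul n P (fsmult c R) = fsmult c (fmul n P R)"
  by (intro ext) (simp add: fmul_def fsmult_def sum_distrib_left mult.left_commute)

text \<open>The outer dimensions are kept here, apart from the operations. They matter for returning
  to actual matrices, for the unit laws and for quantifying over s x s arguments.\<close>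

definition fsupp :: "nat \<Rightarrow> nat \<Rightarrow> 'a::field fmat \<Rightarrow> bool" where
  "fsupp r c P \<longleftrightarrow> (\<forall>i j. r \<le> i \<or> c \<le> j \<longrightarrow> P i j = 0)"

lemma fsupp_fmul: "fsupp r n P \<Longrightarrow> fsupp n c Q \<Longrightarrow> fsupp r c (fmul n P Q)"
  by (auto simp: fsupp_def fmul_def)

lemma fsupp_zero [simp]: "fsupp r c 0"
  by (auto simp: fsupp_def)

lemma fsupp_add: "fsupp r c P \<Longrightarrow> fsupp r c Q \<Longrightarrow> fsupp r c (P + Q)"
  by (auto simp: fsupp_def)

lemma fsupp_diff: "fsupp r c P \<Longrightarrow> fsupp r c Q \<Longrightarrow> fsupp r c (P - Q)"
  by (auto simp: fsupp_def)

lemma fsupp_sum: "(\<And>a. a \<in> I \<Longrightarrow> fsupp r c (f a)) \<Longrightarrow> fsupp r c (sum f I)"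
  by (auto simp: fsupp_def sum_apply)

section \<open>Translation between matrices and functions\<close>

definition fun_of_mat :: "'a::field mat \<Rightarrow> 'a fmat" where
  "fun_of_mat M = (\<lambda>i j. if i < dim_row M \<and> j < dim_col M then M $$ (i, j) else 0)"

definition mat_of_fun :: "nat \<Rightarrow> nat \<Rightarrow> 'a::field fmat \<Rightarrow> 'a mat" where
  "mat_of_fun r c P = mat r c (\<lambda>(i, j). P i j)"

lemma mat_of_fun_carrier [simp]: "mat_of_fun r c P \<in> carrier_mat r c"
  by (simp add: mat_of_fun_def)

lemma fun_of_mat_of_fun: "fsupp r c P \<Longrightarrow> fun_of_mat (mat_of_fun r c P) = P"
  by (auto simp: fun_of_mat_def mat_of_fun_def fsupp_def fun_eq_iff not_less)

lemma mat_of_fun_of_mat: "M \<in> carrier_mat r c \<Longrightarrow> mat_of_fun r c (fun_of_mat M) = M"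
  by (auto simp: fun_of_mat_def mat_of_fun_def intro!: eq_matI)

lemma fun_of_mat_inject:
  "M \<in> carrier_mat r c \<Longrightarrow> N \<in> carrier_mat r c \<Longrightarrow> fun_of_mat M = fun_of_mat N \<longleftrightarrow> M = N"
  by (metis mat_of_fun_of_mat)

lemma fsupp_fun_of_mat: "M \<in> carrier_mat r c \<Longrightarrow> fsupp r c (fun_of_mat M)"
  by (auto simp: fun_of_mat_def fsupp_def)

lemma fun_of_mat_mult:
  "M \<in> carrier_mat r n \<Longrightarrow> N \<in> carrier_mat n c \<Longrightarrow>
    fun_of_mat (M * N) = fmul n (fun_of_mat M) (fun_of_mat N)"
  by (intro ext) (auto simp: fun_of_mat_def fmul_def scalar_prod_def atLeast0LessThan)

lemma fun_of_mat_add: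
  "M \<in> carrier_mat r c \<Longrightarrow> N \<in> carrier_mat r c \<Longrightarrow>
    fun_of_mat (M + N) = fun_of_mat M + fun_of_mat N"
  by (intro ext) (auto simp: fun_of_mat_def)

lemma fun_of_mat_minus:
  "M \<in> carrier_mat r c \<Longrightarrow> N \<in> carrier_mat r c \<Longrightarrow>
    fun_of_mat (M - N) = fun_of_mat M - fun_of_mat N"
  by (intro ext) (auto simp: fun_of_mat_def)

lemma fun_of_mat_zero: "fun_of_mat (0\<^sub>m r c) = 0"
  by (auto simp: fun_of_mat_def fun_eq_iff)

lemma fun_of_mat_smult: "fun_of_mat (c \<cdot>\<^sub>m M) = fsmult c (fun_of_mat M)"
  by (intro ext) (auto simp: fun_of_mat_def fsmult_def)

lemma fun_of_mat_matrix_sum: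
  assumes "\<And>k. k < d \<Longrightarrow> F k \<in> carrier_mat r c"
  shows "fun_of_mat (matrix_sum r c d F) = (\<Sum>k<d. fun_of_mat (F k))"
proof (intro ext)
  fix i j
  have *: "k < d \<Longrightarrow> dim_row (F k) = r \<and> dim_col (F k) = c" for k
    using assms by blast
  show "fun_of_mat (matrix_sum r c d F) i j = (\<Sum>k<d. fun_of_mat (F k)) i j"
    by (auto simp: fun_of_mat_def matrix_sum_def sum_apply * intro!: sum.cong)
qed

lemma mat_of_fun_add: "mat_of_fun r c (P + Q) = mat_of_fun r c P + mat_of_fun r c Q"
  by (auto simp: mat_of_fun_def intro!: eq_matI)

lemma mat_of_fun_fsmult: "mat_of_fun r c (fsmult a P) = a \<cdot>\<^sub>m mat_of_fun r c P"
  by (auto simp: mat_of_fun_def fsmult_def intro!: eq_matI)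

section \<open>Linear maps in the functional setting\<close>

definition fmap :: "nat \<Rightarrow> ('a::field mat \<Rightarrow> 'a mat) \<Rightarrow> 'a fmat \<Rightarrow> 'a fmat" where
  "fmap s F P = fun_of_mat (F (mat_of_fun s s P))"

lemma fmap_fun_of_mat: "M \<in> carrier_mat s s \<Longrightarrow> fmap s F (fun_of_mat M) = fun_of_mat (F M)"
  by (simp add: fmap_def mat_of_fun_of_mat)

text \<open>The last clause says that only the s x s corner of the argument is read. It holds for
  \<open>fmap\<close> because \<open>mat_of_fun\<close> cuts this corner out.\<close>

definition flinear :: "nat \<Rightarrow> nat \<Rightarrow> nat \<Rightarrow> ('a::field fmat \<Rightarrow> 'a fmat) \<Rightarrow> bool" where
  "flinear s r c F \<longleftrightarrow> (\<forall>P. fsupp r c (F P)) \<and> (\<forall>P Q. F (P + Q) = F P + F Q) \<and>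
     (\<forall>a P. F (fsmult a P) = fsmult a (F P)) \<and>
     (\<forall>P Q. (\<forall>i<s. \<forall>j<s. P i j = Q i j) \<longrightarrow> F P = F Q)"

lemma flinear_fmap: "mat_linear s r c F \<Longrightarrow> flinear s r c (fmap s F)"
proof -
  assume F: "mat_linear s r c F"
  have "fmap s F P = fmap s F Q" if "\<forall>i<s. \<forall>j<s. P i j = Q i j" for P Q
  proof -
    have "mat_of_fun s s P = mat_of_fun s s Q"
      using that by (auto simp: mat_of_fun_def intro!: eq_matI)
    then show ?thesis by (simp add: fmap_def)
  qed
  moreover have "fsupp r c (fmap s F P)" for P
    using F by (simp add: fmap_def mat_linear_def fsupp_fun_of_mat)
  moreover have "fmap s F (P + Q) = fmap s F P + fmap s F Q" for P Q
    using F by (simp add: fmap_def mat_linear_def mat_of_fun_add fun_of_mat_add[of _ r c])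
  moreover have "fmap s F (fsmult a P) = fsmult a (fmap s F P)" for a P
    using F by (simp add: fmap_def mat_linear_def mat_of_fun_fsmult fun_of_mat_smult)
  ultimately show ?thesis unfolding flinear_def by blast
qed

lemma flinear_supp: "flinear s r c F \<Longrightarrow> fsupp r c (F P)"
  by (simp add: flinear_def)

lemma flinear_add: "flinear s r c F \<Longrightarrow> F (P + Q) = F P + F Q"
  by (simp add: flinear_def)

lemma flinear_fsmult: "flinear s r c F \<Longrightarrow> F (fsmult a P) = fsmult a (F P)"
  by (simp add: flinear_def)

lemma flinear_cong:
  "flinear s r c F \<Longrightarrow> (\<And>i j. i < s \<Longrightarrow> j < s \<Longrightarrow> P i j = Q i j) \<Longrightarrow> F P = F Q"
  by (simp add: flinear_def)

lemma flinear_zero: "flinear s r c F \<Longrightarrow> F 0 = 0"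
  using flinear_add[of s r c F 0 0] by simp

lemma flinear_diff: "flinear s r c F \<Longrightarrow> F (P - Q) = F P - F Q"
  using flinear_add[of s r c F "P - Q" Q] by simp

lemma flinear_sum: "flinear s r c F \<Longrightarrow> F (sum f I) = (\<Sum>a\<in>I. F (f a))"
proof -
  assume F: "flinear s r c F"
  have "sum (F \<circ> f) I = F (sum f I)"
    by (rule sum_comp_morphism) (rule flinear_zero[OF F], rule flinear_add[OF F])
  then show ?thesis by (simp only: o_def)
qed

text \<open>The sum of elementary matrices agrees with \<open>P\<close> only on the s x s corner,
  and this is all that \<open>F\<close> sees.\<close>

lemma flinear_expand:
  assumes "flinear s r c F"
  shows "F P = (\<Sum>e\<in>{..<s} \<times> {..<s}. fsmult (P (fst e) (snd e)) (F (fun_of_mat (elem_mat s e))))"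
proof -
  let ?Q = "\<Sum>e\<in>{..<s} \<times> {..<s}. fsmult (P (fst e) (snd e)) (fun_of_mat (elem_mat s e))"
  have "P i j = ?Q i j" if "i < s" "j < s" for i j
  proof -
    have "?Q i j = (\<Sum>e\<in>{..<s} \<times> {..<s}. if e = (i, j) then P (fst e) (snd e) else 0)"
      unfolding sum_apply using that
      by (intro sum.cong) (auto simp: fsmult_def fun_of_mat_def elem_mat_def)
    also have "\<dots> = P i j" using that by (subst sum.delta) auto
    finally show ?thesis by simp
  qed
  then have "F P = F ?Q" using assms by (rule flinear_cong[rotated])
  then show ?thesis by (simp only: flinear_sum[OF assms] flinear_fsmult[OF assms])
qed

section \<open>Block matrices\<close>

type_synonym 'a bmat = "nat \<Rightarrow> nat \<Rightarrow> 'a fmat"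

text \<open>\<open>m\<close> is the number of blocks summed over, \<open>n\<close> the inner
  dimension of a single block product. Block shapes stay open, so blocks of size s x s, L x L and L
  x s share one product.\<close>

definition bmul :: "nat \<Rightarrow> nat \<Rightarrow> 'a::field bmat \<Rightarrow> 'a bmat \<Rightarrow> 'a bmat" where
  "bmul m n P Q = (\<lambda>i j. \<Sum>k<m. fmul n (P i k) (Q k j))"

lemma bmul_assoc: "bmul m n (bmul m k P Q) R = bmul m k P (bmul m n Q R)"
proof (intro ext)
  fix i j x y
  have "bmul m n (bmul m k P Q) R i j = (\<Sum>a<m. \<Sum>b<m. fmul n (fmul k (P i b) (Q b a)) (R a j))"
    by (simp add: bmul_def fmul_sum_left)
  also have "\<dots> = (\<Sum>b<m. \<Sum>a<m. fmul n (fmul k (P i b) (Q b a)) (R a j))"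
    by (rule sum.swap)
  also have "\<dots> = bmul m k P (bmul m n Q R) i j"
    by (simp add: bmul_def fmul_sum_right fmul_assoc)
  finally show "bmul m n (bmul m k P Q) R i j x y = bmul m k P (bmul m n Q R) i j x y" by simp
qed

lemma bmul_add_left: "bmul m n (P + Q) R = bmul m n P R + bmul m n Q R"
  by (rule ext, rule ext) (simp add: bmul_def fmul_add_left sum.distrib)

lemma bmul_add_right: "bmul m n P (Q + R) = bmul m n P Q + bmul m n P R"
  by (rule ext, rule ext) (simp add: bmul_def fmul_add_right sum.distrib)

lemma bmul_diff_left: "bmul m n (P - Q) R = bmul m n P R - bmul m n Q R"
  by (rule ext, rule ext) (simp add: bmul_def fmul_diff_left sum_subtractf)

lemma bmul_diff_right: "bmul m n P (Q - R) = bmul m n P Q - bmul m n P R"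
  by (rule ext, rule ext) (simp add: bmul_def fmul_diff_right sum_subtractf)

lemma bmul_zero_left [simp]: "bmul m n 0 R = 0"
  by (rule ext, rule ext) (simp add: bmul_def)

lemma bmul_zero_right [simp]: "bmul m n P 0 = 0"
  by (rule ext, rule ext) (simp add: bmul_def)

lemma bmul_sum_left: "bmul m n (sum f I) R = (\<Sum>a\<in>I. bmul m n (f a) R)"
  using sum_comp_morphism[of "\<lambda>P. bmul m n P R" f I] by (simp add: bmul_add_left o_def)

lemma bmul_sum_right: "bmul m n P (sum f I) = (\<Sum>a\<in>I. bmul m n P (f a))"
  using sum_comp_morphism[of "bmul m n P" f I] by (simp add: bmul_add_right o_def)

text \<open>Multiplication by the block diagonal I \<otimes> P: \<open>lmul\<close> from the left,
  \<open>rmul\<close> from the right.\<close>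

definition lmul :: "nat \<Rightarrow> 'a::field fmat \<Rightarrow> 'a bmat \<Rightarrow> 'a bmat" where
  "lmul n P Q = (\<lambda>i j. fmul n P (Q i j))"

definition rmul :: "nat \<Rightarrow> 'a::field bmat \<Rightarrow> 'a fmat \<Rightarrow> 'a bmat" where
  "rmul n Q P = (\<lambda>i j. fmul n (Q i j) P)"

lemma lmul_bmul: "lmul k P (bmul m n Q R) = bmul m n (lmul k P Q) R"
  by (rule ext, rule ext) (simp add: bmul_def lmul_def fmul_sum_right fmul_assoc)

lemma bmul_rmul: "bmul m n (rmul k Q P) R = bmul m k Q (lmul n P R)"
  by (rule ext, rule ext) (simp add: bmul_def lmul_def rmul_def fmul_assoc)

lemma lmul_add: "lmul k P (Q + R) = lmul k P Q + lmul k P R"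
  by (rule ext, rule ext) (simp add: lmul_def fmul_add_right)

lemma lmul_zero [simp]: "lmul k P 0 = 0"
  by (rule ext, rule ext) (simp add: lmul_def)

lemma lmul_diff: "lmul k P (Q - R) = lmul k P Q - lmul k P R"
  by (rule ext, rule ext) (simp add: lmul_def fmul_diff_right)

section \<open>Conjugation of the state equation\<close>

text \<open>For N = X - I \<otimes> Y these are the matrices a (with F = A) and b (with F = B) of
  the state equation v = b + a v.\<close>

definition blift :: "nat \<Rightarrow> (nat \<Rightarrow> 'a::field fmat \<Rightarrow> 'a fmat) \<Rightarrow> (nat \<Rightarrow> 'a bmat) \<Rightarrow> 'a bmat" where
  "blift d F N = (\<lambda>i j. \<Sum>k<d. F k (N k i j))"

definition bsupp :: "nat \<Rightarrow> 'a::field bmat \<Rightarrow> bool" where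
  "bsupp s P \<longleftrightarrow> (\<forall>i j. fsupp s s (P i j))"

lemma blift_add:
  assumes "\<forall>k<d. flinear s r c (F k)"
  shows "blift d F (\<lambda>k. M k + N k) = blift d F M + blift d F N"
proof (rule ext, rule ext)
  fix i j
  have "(\<Sum>k<d. F k (M k i j + N k i j)) = (\<Sum>k<d. F k (M k i j) + F k (N k i j))"
    using assms by (intro sum.cong refl flinear_add) auto
  then show "blift d F (\<lambda>k. M k + N k) i j = (blift d F M + blift d F N) i j"
    by (simp add: blift_def sum.distrib)
qed

definition fcomm :: "nat \<Rightarrow> 'a::field fmat \<Rightarrow> 'a fmat \<Rightarrow> 'a fmat" where
  "fcomm s S Z = fmul s S Z - fmul s Z S"

text \<open>The block form of [T, I \<otimes> Y_k], since I \<otimes> Y_k carries the same block at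
  every diagonal place.\<close>

definition bcomm :: "nat \<Rightarrow> (nat \<Rightarrow> 'a::field fmat) \<Rightarrow> 'a bmat \<Rightarrow> nat \<Rightarrow> 'a bmat" where
  "bcomm s Y T k = (\<lambda>i j. fcomm s (T i j) (Y k))"

definition comm_sum ::
    "nat \<Rightarrow> nat \<Rightarrow> (nat \<Rightarrow> 'a::field fmat) \<Rightarrow> (nat \<Rightarrow> 'a fmat \<Rightarrow> 'a fmat) \<Rightarrow> 'a fmat \<Rightarrow> 'a fmat" where
  "comm_sum s d Y F S = (\<Sum>k<d. F k (fcomm s S (Y k)))"

lemma blift_bcomm: "blift d F (bcomm s Y T) = (\<lambda>i j. comm_sum s d Y F (T i j))"
  by (simp add: blift_def bcomm_def comm_sum_def)

locale fm_system =
  fixes s L d :: nat and A B :: "nat \<Rightarrow> 'a::field fmat \<Rightarrow> 'a fmat" and C D :: "'a fmat"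
    and Y :: "nat \<Rightarrow> 'a fmat"
  assumes linA: "\<forall>k<d. flinear s L L (A k)"
    and linB: "\<forall>k<d. flinear s L s (B k)"
    and suppC: "fsupp s L C" and suppD: "fsupp s s D"
begin

text \<open>\<open>G\<close> stands for A or B: the equations come in pairs that differ only in the
  rightmost map.\<close>

definition output_eqs :: "(nat \<Rightarrow> 'a fmat \<Rightarrow> 'a fmat) \<Rightarrow> bool" where
  "output_eqs G \<longleftrightarrow> (\<forall>S Z. \<forall>i<d. fsupp s s S \<longrightarrow> fsupp s s Z \<longrightarrow>
     fmul L (fmul s S C) (G i Z) - fmul L C (G i (fmul s S Z))
       = fmul L C (fmul L (comm_sum s d Y A S) (G i Z)))"

definition inner_eqs :: "(nat \<Rightarrow> 'a fmat \<Rightarrow> 'a fmat) \<Rightarrow> bool" where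
  "inner_eqs G \<longleftrightarrow> (\<forall>S Z1 Z2. \<forall>i<d. \<forall>j<d. fsupp s s S \<longrightarrow> fsupp s s Z1 \<longrightarrow> fsupp s s Z2 \<longrightarrow>
     fmul L (A i (fmul s Z1 S)) (G j Z2) - fmul L (A i Z1) (G j (fmul s S Z2))
       = fmul L (A i Z1) (fmul L (comm_sum s d Y A S) (G j Z2)))"

definition input_eqs :: bool where
  "input_eqs \<longleftrightarrow> (\<forall>S Z. \<forall>i<d. fsupp s s S \<longrightarrow> fsupp s s Z \<longrightarrow>
     B i (fmul s Z S) - fmul s (B i Z) S = fmul L (A i Z) (comm_sum s d Y B S))"

definition constant_eqs :: bool where
  "constant_eqs \<longleftrightarrow> (\<forall>S. fsupp s s S \<longrightarrow>
     fmul s S D - fmul s D S = fmul L C (comm_sum s d Y B S))"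

text \<open>Entry (i, j) is the sum over p < m and k < d of the equation for S = T_ip and Z =
  (N_k)_pj; linearity of \<open>G k\<close> takes the block sum out of its argument.\<close>

lemma block_output_eqs:
  assumes G: "\<forall>k<d. flinear s L c (G k)" and eqs: "output_eqs G"
    and T: "bsupp s T" and N: "\<forall>k<d. bsupp s (N k)"
  shows "bmul m L (rmul s T C) (blift d G N) - lmul L C (blift d G (\<lambda>k. bmul m s T (N k)))
    = lmul L C (bmul m L (blift d A (bcomm s Y T)) (blift d G N))"
proof (rule ext, rule ext)
  fix i j
  have "bmul m L (rmul s T C) (blift d G N) i j
      = (\<Sum>p<m. \<Sum>k<d. fmul L (fmul s (T i p) C) (G k (N k p j)))"
    by (simp add: bmul_def rmul_def blift_def fmul_sum_right)
  moreover have "lmul L C (blift d G (\<lambda>k. bmul m s T (N k))) i j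
      = (\<Sum>p<m. \<Sum>k<d. fmul L C (G k (fmul s (T i p) (N k p j))))"
    by (simp add: bmul_def lmul_def blift_def fmul_sum_right flinear_sum[OF G[rule_format]]
        sum.swap[of _ "{..<d}" "{..<m}"])
  moreover have "lmul L C (bmul m L (blift d A (bcomm s Y T)) (blift d G N)) i j
      = (\<Sum>p<m. \<Sum>k<d. fmul L C (fmul L (comm_sum s d Y A (T i p)) (G k (N k p j))))"
    unfolding blift_bcomm by (simp add: bmul_def lmul_def blift_def fmul_sum_right)
  moreover have "fmul L (fmul s (T i p) C) (G k (N k p j)) - fmul L C (G k (fmul s (T i p) (N k p j)))
      = fmul L C (fmul L (comm_sum s d Y A (T i p)) (G k (N k p j)))" if "k < d" for k p
    using eqs that T N unfolding output_eqs_def bsupp_def by simp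
  ultimately show "(bmul m L (rmul s T C) (blift d G N)
      - lmul L C (blift d G (\<lambda>k. bmul m s T (N k)))) i j
    = lmul L C (bmul m L (blift d A (bcomm s Y T)) (blift d G N)) i j"
    by (simp add: sum_subtractf[symmetric])
qed

lemma block_input_eqs:
  assumes eqs: input_eqs
    and T: "bsupp s T" and N: "\<forall>k<d. bsupp s (N k)"
  shows "blift d B (\<lambda>k. bmul m s (N k) T) - bmul m s (blift d B N) T
    = bmul m L (blift d A N) (blift d B (bcomm s Y T))"
proof (rule ext, rule ext)
  fix i j
  have "blift d B (\<lambda>k. bmul m s (N k) T) i j = (\<Sum>p<m. \<Sum>k<d. B k (fmul s (N k i p) (T p j)))"
    by (simp add: bmul_def blift_def flinear_sum[OF linB[rule_format]] sum.swap[of _ "{..<d}" "{..<m}"])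
  moreover have "bmul m s (blift d B N) T i j = (\<Sum>p<m. \<Sum>k<d. fmul s (B k (N k i p)) (T p j))"
    by (simp add: bmul_def blift_def fmul_sum_left)
  moreover have "bmul m L (blift d A N) (blift d B (bcomm s Y T)) i j
      = (\<Sum>p<m. \<Sum>k<d. fmul L (A k (N k i p)) (comm_sum s d Y B (T p j)))"
    unfolding blift_bcomm by (simp add: bmul_def blift_def fmul_sum_left)
  moreover have "B k (fmul s (N k i p) (T p j)) - fmul s (B k (N k i p)) (T p j)
      = fmul L (A k (N k i p)) (comm_sum s d Y B (T p j))" if "k < d" for k p
    using eqs that T N unfolding input_eqs_def bsupp_def by simp
  ultimately show "(blift d B (\<lambda>k. bmul m s (N k) T) - bmul m s (blift d B N) T) i j
      = bmul m L (blift d A N) (blift d B (bcomm s Y T)) i j"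
    by (simp add: sum_subtractf[symmetric])
qed

text \<open>The equation for S = T_pq, Z1 = (M_k)_ip and Z2 = (N_l)_qj is summed over p, q, k and l.
  The three products expand with these sums in different orders, hence the interchanges before the
  termwise comparison.\<close>

lemma block_inner_eqs:
  assumes G: "\<forall>k<d. flinear s L c (G k)" and eqs: "inner_eqs G"
    and T: "bsupp s T" and M: "\<forall>k<d. bsupp s (M k)"
    and N: "\<forall>k<d. bsupp s (N k)"
  shows "bmul m L (blift d A (\<lambda>k. bmul m s (M k) T)) (blift d G N)
      - bmul m L (blift d A M) (blift d G (\<lambda>k. bmul m s T (N k)))
    = bmul m L (blift d A M) (bmul m L (blift d A (bcomm s Y T)) (blift d G N))"
proof (rule ext, rule ext)
  fix i j
  have "bmul m L (blift d A (\<lambda>k. bmul m s (M k) T)) (blift d G N) i j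
      = (\<Sum>q<m. fmul L (\<Sum>k<d. \<Sum>p<m. A k (fmul s (M k i p) (T p q))) (\<Sum>l<d. G l (N l q j)))"
    by (simp add: bmul_def blift_def flinear_sum[OF linA[rule_format]])
  also have "\<dots> = (\<Sum>q<m. fmul L (\<Sum>p<m. \<Sum>k<d. A k (fmul s (M k i p) (T p q))) (\<Sum>l<d. G l (N l q j)))"
    by (simp only: sum.swap[of _ "{..<d}" "{..<m}"])
  also have "\<dots> = (\<Sum>q<m. \<Sum>p<m. \<Sum>k<d. \<Sum>l<d. fmul L (A k (fmul s (M k i p) (T p q))) (G l (N l q j)))"
    by (simp only: fmul_sum_left, simp only: fmul_sum_right)
  also have "\<dots> = (\<Sum>p<m. \<Sum>q<m. \<Sum>k<d. \<Sum>l<d. fmul L (A k (fmul s (M k i p) (T p q))) (G l (N l q j)))"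
    by (rule sum.swap)
  finally have 1: "bmul m L (blift d A (\<lambda>k. bmul m s (M k) T)) (blift d G N) i j = \<dots>" .
  have "bmul m L (blift d A M) (blift d G (\<lambda>k. bmul m s T (N k))) i j
      = (\<Sum>p<m. fmul L (\<Sum>k<d. A k (M k i p)) (\<Sum>l<d. \<Sum>q<m. G l (fmul s (T p q) (N l q j))))"
    by (simp add: bmul_def blift_def flinear_sum[OF G[rule_format]])
  also have "\<dots> = (\<Sum>p<m. fmul L (\<Sum>k<d. A k (M k i p)) (\<Sum>q<m. \<Sum>l<d. G l (fmul s (T p q) (N l q j))))"
    by (simp only: sum.swap[of _ "{..<d}" "{..<m}"])
  also have "\<dots> = (\<Sum>p<m. \<Sum>q<m. \<Sum>l<d. \<Sum>k<d. fmul L (A k (M k i p)) (G l (fmul s (T p q) (N l q j))))"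
    by (simp only: fmul_sum_right, simp only: fmul_sum_left)
  also have "\<dots> = (\<Sum>p<m. \<Sum>q<m. \<Sum>k<d. \<Sum>l<d. fmul L (A k (M k i p)) (G l (fmul s (T p q) (N l q j))))"
    by (intro sum.cong refl sum.swap)
  finally have 2: "bmul m L (blift d A M) (blift d G (\<lambda>k. bmul m s T (N k))) i j = \<dots>" .
  have "bmul m L (blift d A M) (bmul m L (blift d A (bcomm s Y T)) (blift d G N)) i j
      = (\<Sum>p<m. fmul L (\<Sum>k<d. A k (M k i p))
          (\<Sum>q<m. \<Sum>l<d. fmul L (comm_sum s d Y A (T p q)) (G l (N l q j))))"
    unfolding blift_bcomm by (simp add: bmul_def blift_def fmul_sum_right)
  also have "\<dots> = (\<Sum>p<m. \<Sum>q<m. \<Sum>l<d. \<Sum>k<d. fmul L (A k (M k i p))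
      (fmul L (comm_sum s d Y A (T p q)) (G l (N l q j))))"
    by (simp only: fmul_sum_right, simp only: fmul_sum_left)
  also have "\<dots> = (\<Sum>p<m. \<Sum>q<m. \<Sum>k<d. \<Sum>l<d. fmul L (A k (M k i p))
      (fmul L (comm_sum s d Y A (T p q)) (G l (N l q j))))"
    by (intro sum.cong refl sum.swap)
  finally have 3: "bmul m L (blift d A M) (bmul m L (blift d A (bcomm s Y T)) (blift d G N)) i j = \<dots>" .
  have "fmul L (A k (fmul s (M k i p) (T p q))) (G l (N l q j))
      - fmul L (A k (M k i p)) (G l (fmul s (T p q) (N l q j)))
      = fmul L (A k (M k i p)) (fmul L (comm_sum s d Y A (T p q)) (G l (N l q j)))"
    if "k < d" "l < d" for p q k l
    using eqs that T M N unfolding inner_eqs_def bsupp_def by simp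
  then show "(bmul m L (blift d A (\<lambda>k. bmul m s (M k) T)) (blift d G N)
      - bmul m L (blift d A M) (blift d G (\<lambda>k. bmul m s T (N k)))) i j
    = bmul m L (blift d A M) (bmul m L (blift d A (bcomm s Y T)) (blift d G N)) i j"
    by (simp add: 1 2 3 sum_subtractf[symmetric])
qed

text \<open>\<open>conj\<close> is N' T = T N + [T, I \<otimes> Y], and the conclusion is T f(X) =
  f(X') T in block form. \<open>uniq\<close> is the form in which nilpotence of a' enters.\<close>

lemma conjugation:
  assumes eqs: constant_eqs input_eqs "output_eqs A" "output_eqs B" "inner_eqs A" "inner_eqs B"
    and T: "bsupp s T" and N: "\<forall>k<d. bsupp s (N k)"
    and N': "\<forall>k<d. bsupp s (N' k)"
    and conj: "\<And>k. k < d \<Longrightarrow> bmul m s (N' k) T = bmul m s T (N k) + bcomm s Y T k"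
    and v: "v = blift d B N + bmul m L (blift d A N) v"
    and v': "v' = blift d B N' + bmul m L (blift d A N') v'"
    and uniq: "\<And>x. x = bmul m L (blift d A N') x \<Longrightarrow> x = 0"
  shows "rmul s T D + bmul m s T (lmul L C v) = lmul s D T + lmul L C (bmul m s v' T)"
proof -
  define a b a' b' where ab: "a = blift d A N" "b = blift d B N" "a' = blift d A N'" "b' = blift d B N'"
  define \<alpha> \<beta> where ab': "\<alpha> = blift d A (bcomm s Y T)" "\<beta> = blift d B (bcomm s Y T)"
  define ta tb where abt: "ta = blift d A (\<lambda>k. bmul m s (N' k) T)" "tb = blift d B (\<lambda>k. bmul m s (N' k) T)"
  \<comment> \<open>\<open>conj\<close> trades T N for N' T; besides a, b, a' and b', the six
    equations then involve only the liftings \<open>ta\<close>, \<open>tb\<close>, \<alpha> and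
    \<beta>.\<close>
  have lift_TN: "blift d G (\<lambda>k. bmul m s T (N k))
      = blift d G (\<lambda>k. bmul m s (N' k) T) - blift d G (bcomm s Y T)"
    if "\<forall>k<d. flinear s r c (G k)" for G and r c :: nat
  proof -
    have "blift d G (\<lambda>k. bmul m s (N' k) T) = blift d G (\<lambda>k. bmul m s T (N k) + bcomm s Y T k)"
      using conj by (simp add: blift_def)
    then show ?thesis using blift_add[OF that] by simp
  qed
  have E1: "rmul s T D - lmul s D T = lmul L C \<beta>"
    using eqs(1) T unfolding ab' blift_bcomm constant_eqs_def bsupp_def
    by (intro ext) (simp add: rmul_def lmul_def fun_eq_iff)
  have E2: "bmul m L (rmul s T C) b - lmul L C (tb - \<beta>) = lmul L C (bmul m L \<alpha> b)"
    using block_output_eqs[OF linB eqs(4) T N, where m=m] lift_TN[of _ _ B, OF linB]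
    unfolding ab ab' abt by simp
  have E3: "bmul m L (rmul s T C) a - lmul L C (ta - \<alpha>) = lmul L C (bmul m L \<alpha> a)"
    using block_output_eqs[OF linA eqs(3) T N, where m=m] lift_TN[of _ _ A, OF linA]
    unfolding ab ab' abt by simp
  have E4: "tb - bmul m s b' T = bmul m L a' \<beta>"
    using block_input_eqs[OF eqs(2) T N', where m=m] unfolding ab ab' abt by simp
  have E5: "bmul m L ta b - bmul m L a' (tb - \<beta>) = bmul m L a' (bmul m L \<alpha> b)"
    using block_inner_eqs[OF linB eqs(6) T N' N, where m=m] lift_TN[of _ _ B, OF linB]
    unfolding ab ab' abt by simp
  have E6: "bmul m L ta a - bmul m L a' (ta - \<alpha>) = bmul m L a' (bmul m L \<alpha> a)"
    using block_inner_eqs[OF linA eqs(5) T N' N, where m=m] lift_TN[of _ _ A, OF linA]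
    unfolding ab ab' abt by simp
  note bil = bmul_add_left bmul_add_right bmul_diff_left bmul_diff_right lmul_add lmul_diff
  have v: "v = b + bmul m L a v" and v': "v' = b' + bmul m L a' v'"
    unfolding ab by (rule v, rule v')
  \<comment> \<open>\<open>w\<close> is going to satisfy the equation of \<open>v' T\<close>\<close>
  define w where "w = tb + bmul m L ta v"
  \<comment> \<open>The equations supply \<alpha> b and \<alpha> a separately; one unfolding of
    \<open>v\<close> joins them to \<alpha> v, which cancels in both computations below.\<close>
  have \<alpha>v: "bmul m L \<alpha> v = bmul m L \<alpha> b + bmul m L (bmul m L \<alpha> a) v"
    using arg_cong[OF v, of "bmul m L \<alpha>"] by (simp add: bil bmul_assoc)
  have TCv: "bmul m s T (lmul L C v) = lmul L C w - lmul L C \<beta>"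
  proof -
    have "bmul m s T (lmul L C v) = bmul m L (rmul s T C) v" by (simp add: bmul_rmul)
    also have "\<dots> = bmul m L (rmul s T C) b + bmul m L (bmul m L (rmul s T C) a) v"
      using arg_cong[OF v, of "bmul m L (rmul s T C)"] by (simp add: bil bmul_assoc)
    also have "\<dots> = lmul L C (tb - \<beta>) + lmul L C (bmul m L \<alpha> b)
        + bmul m L (lmul L C (ta - \<alpha>) + lmul L C (bmul m L \<alpha> a)) v"
      using E2 E3 by (simp add: algebra_simps)
    also have "\<dots> = lmul L C (tb - \<beta> + bmul m L ta v)
        + lmul L C (bmul m L \<alpha> b + bmul m L (bmul m L \<alpha> a) v - bmul m L \<alpha> v)"
      by (simp add: bil lmul_bmul[symmetric])
    also have "\<dots> = lmul L C w - lmul L C \<beta>"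
      by (simp add: \<alpha>v w_def bil)
    finally show ?thesis .
  qed
  have w: "w = bmul m s b' T + bmul m L a' w"
  proof -
    have "bmul m L ta v = bmul m L ta b + bmul m L (bmul m L ta a) v"
      using arg_cong[OF v, of "bmul m L ta"] by (simp add: bil bmul_assoc)
    also have "\<dots> = bmul m L a' (tb - \<beta>) + bmul m L a' (bmul m L \<alpha> b)
        + bmul m L (bmul m L a' (ta - \<alpha>) + bmul m L a' (bmul m L \<alpha> a)) v"
      using E5 E6 by (simp add: algebra_simps)
    also have "\<dots> = bmul m L a' w - bmul m L a' \<beta>
        + bmul m L a' (bmul m L \<alpha> b + bmul m L (bmul m L \<alpha> a) v - bmul m L \<alpha> v)"
      by (simp add: bil bmul_assoc w_def)
    finally have "bmul m L ta v = bmul m L a' w - bmul m L a' \<beta>" by (simp add: \<alpha>v)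
    then show ?thesis using E4 by (simp add: w_def algebra_simps)
  qed
  have "bmul m s v' T = bmul m s (b' + bmul m L a' v') T"
    by (rule arg_cong[OF v'])
  then have "bmul m s v' T = bmul m s b' T + bmul m L a' (bmul m s v' T)"
    unfolding bmul_add_left bmul_assoc .
  \<comment> \<open>Both \<open>w\<close> and v' T solve x = b' T + a' x, so their difference is a
    fixed point of a'.\<close>
  with w have "w - bmul m s v' T
      = (bmul m s b' T + bmul m L a' w) - (bmul m s b' T + bmul m L a' (bmul m s v' T))"
    by (rule arg_cong2[of _ _ _ _ "(-)"])
  then have "w - bmul m s v' T = bmul m L a' (w - bmul m s v' T)"
    unfolding bmul_diff_right by (simp only: add_diff_cancel_left)
  then have "w - bmul m s v' T = 0" unfolding ab by (rule uniq)
  then have "w = bmul m s v' T" by (rule iffD2[OF eq_iff_diff_eq_0])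
  then show ?thesis using TCv E1 by (simp add: algebra_simps)
qed

end

section \<open>Evaluation of realized series\<close>

text \<open>Indexes the elementary tensors of degree l; it is the summation set of
  \<open>tensor_lift\<close>.\<close>

definition basis_words :: "nat \<Rightarrow> nat \<Rightarrow> (nat \<times> nat) list set" where
  "basis_words s l = {w. length w = l \<and> set w \<subseteq> {..<s} \<times> {..<s}}"

lemma basis_words_0: "basis_words s 0 = {[]}"
  by (auto simp: basis_words_def)

lemma sum_basis_words_Suc:
  "(\<Sum>w\<in>basis_words s (Suc l). g w) = (\<Sum>w\<in>basis_words s l. \<Sum>e\<in>{..<s} \<times> {..<s}. g (e # w))"
proof -
  have "(\<Sum>w\<in>basis_words s l. \<Sum>e\<in>{..<s} \<times> {..<s}. g (e # w))
      = (\<Sum>(w, e)\<in>basis_words s l \<times> ({..<s} \<times> {..<s}). g (e # w))"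
    by (rule sum.cartesian_product)
  also have "\<dots> = (\<Sum>w\<in>basis_words s (Suc l). g w)"
    by (rule sum.reindex_bij_witness[of _ "\<lambda>w. (tl w, hd w)" "\<lambda>(w, e). e # w"])
      (force simp: basis_words_def length_Suc_conv)+
  finally show ?thesis by simp
qed

definition words_of_length :: "nat \<Rightarrow> nat \<Rightarrow> nat list set" where
  "words_of_length d l = {\<omega> \<in> words d. length \<omega> = l}"

lemma words_of_length_0: "words_of_length d 0 = {[]}"
  by (auto simp: words_of_length_def words_def)

lemma finite_words_of_length: "finite (words_of_length d l)"
  using finite_lists_length_eq[of "{..<d}" l]
  by (rule finite_subset[rotated]) (auto simp: words_of_length_def words_def)

lemma sum_words_Cons:
  "(\<Sum>\<omega>\<in>words_of_length d (Suc l). g \<omega>) = (\<Sum>k<d. \<Sum>\<omega>\<in>words_of_length d l. g (k # \<omega>))"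
proof -
  have "(\<Sum>k<d. \<Sum>\<omega>\<in>words_of_length d l. g (k # \<omega>))
      = (\<Sum>(k, \<omega>)\<in>{..<d} \<times> words_of_length d l. g (k # \<omega>))"
    by (rule sum.cartesian_product)
  also have "\<dots> = (\<Sum>\<omega>\<in>words_of_length d (Suc l). g \<omega>)"
    by (rule sum.reindex_bij_witness[of _ "\<lambda>w. (hd w, tl w)" "\<lambda>(e, w). e # w"])
      (force simp: words_of_length_def words_def length_Suc_conv)+
  finally show ?thesis by simp
qed

text \<open>Splitting off the last letter isolates the one that carries B; splitting off the first,
  as above, matches the recursion of the powers of a.\<close>

lemma sum_words_snoc:
  "(\<Sum>\<omega>\<in>words_of_length d (Suc l). g \<omega>) = (\<Sum>\<omega>\<in>words_of_length d l. \<Sum>k<d. g (\<omega> @ [k]))"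
proof -
  have "(\<Sum>\<omega>\<in>words_of_length d l. \<Sum>k<d. g (\<omega> @ [k]))
      = (\<Sum>(\<omega>, k)\<in>words_of_length d l \<times> {..<d}. g (\<omega> @ [k]))"
    by (rule sum.cartesian_product)
  also have "\<dots> = (\<Sum>\<omega>\<in>words_of_length d (Suc l). g \<omega>)"
  proof (rule sum.reindex_bij_witness[of _ "\<lambda>w. (butlast w, last w)" "\<lambda>(w, e). w @ [e]"])
    fix w assume "w \<in> words_of_length d (Suc l)"
    then have w: "w \<noteq> []" "length w = Suc l" "set w \<subseteq> {..<d}"
      by (auto simp: words_of_length_def words_def)
    then have "set (butlast w) \<subseteq> {..<d}" "last w \<in> {..<d}"
      using in_set_butlastD[of _ w] last_in_set[of w] by blast+
    then show "(butlast w, last w) \<in> words_of_length d l \<times> {..<d}"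
      using w by (auto simp: words_of_length_def words_def)
    show "(case (butlast w, last w) of (w, e) \<Rightarrow> w @ [e]) = w" using w by simp
  qed (auto simp: words_of_length_def words_def)
  finally show ?thesis by simp
qed

lemma block_index_less:
  fixes a s :: nat
  assumes "a < s"
  shows "i * s + a < s * m \<longleftrightarrow> i < m"
proof
  assume "i < m"
  then have "Suc i * s \<le> m * s" by (intro mult_le_mono1) simp
  then show "i * s + a < s * m" using assms by (simp add: mult.commute)
next
  assume "i * s + a < s * m"
  then have "i * s + a < m * s" by (simp add: mult.commute)
  then have "i * s < m * s" by (rule le_less_trans[OF le_add1])
  then show "i < m" by simp
qed

text \<open>Zero outside the m x m range, so that identities such as \<open>cblock_mult\<close> hold
  at all indices.\<close>

definition cblock :: "nat \<Rightarrow> nat \<Rightarrow> 'a::field mat \<Rightarrow> 'a bmat" where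
  "cblock s m M = (\<lambda>i j. if i < m \<and> j < m then fun_of_mat (block s M (i, j)) else 0)"

lemma bsupp_cblock: "bsupp s (cblock s m M)"
  by (auto simp: bsupp_def cblock_def block_def intro!: fsupp_fun_of_mat)

lemma odot_power_carrier: "odot_power s m X \<omega> \<in> carrier_mat m m"
  by (cases \<omega>) (auto simp: odot_power_def tensor_one_mat_def odot_def tensor_blocks_def
      intro!: carrier_matI, (induct_tac list; simp add: tensor_one_mat_def odot_def)+)

text \<open>The left factor lives in degree one, so of all cuts of the index word only the one after
  its first letter survives.\<close>

lemma tensor_mult_of_mat_Cons:
  assumes "fst e < s" "snd e < s"
  shows "tensor_mult (tensor_of_mat s Z) v (e # w) = Z $$ e * v w"
proof -
  have "tensor_mult (tensor_of_mat s Z) v (e # w)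
      = (\<Sum>n\<le>Suc (length w). if n = 1 then Z $$ e * v w else 0)"
    unfolding tensor_mult_def
  proof (rule sum.cong)
    fix n assume "n \<in> {..Suc (length w)}"
    then show "tensor_of_mat s Z (take n (e # w)) * v (drop n (e # w))
        = (if n = 1 then Z $$ e * v w else 0)"
      using assms by (cases n; cases "n - 1"; cases w; cases e) (auto simp: tensor_of_mat_def)
  qed simp
  also have "\<dots> = Z $$ e * v w" by (subst sum.delta) auto
  finally show ?thesis .
qed

lemma odot_power_Cons:
  assumes "i < m" "p < m" "e \<in> {..<s} \<times> {..<s}"
  shows "(odot_power s m X (k # \<omega>) $$ (i, p)) (e # w)
    = (\<Sum>q<m. cblock s m (X ! k) i q (fst e) (snd e) * (odot_power s m X \<omega> $$ (q, p)) w)"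
proof -
  let ?Q = "odot_power s m X \<omega>" and ?P = "tensor_blocks s m (X ! k)"
  have Q: "dim_row ?Q = m" "dim_col ?Q = m" using odot_power_carrier[of s m X \<omega>] by auto
  have P: "dim_row ?P = m" "dim_col ?P = m" by (auto simp: tensor_blocks_def)
  have "(odot_power s m X (k # \<omega>) $$ (i, p)) (e # w)
      = (\<Sum>q<m. tensor_mult (?P $$ (i, q)) (?Q $$ (q, p)) (e # w))"
    using assms Q P by (simp add: odot_power_def odot_def)
  also have "\<dots> = (\<Sum>q<m. cblock s m (X ! k) i q (fst e) (snd e) * (?Q $$ (q, p)) w)"
  proof (rule sum.cong)
    fix q assume "q \<in> {..<m}"
    then have "?P $$ (i, q) = tensor_of_mat s (block s (X ! k) (i, q))"
      using assms by (simp add: tensor_blocks_def)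
    then show "tensor_mult (?P $$ (i, q)) (?Q $$ (q, p)) (e # w)
        = cblock s m (X ! k) i q (fst e) (snd e) * (?Q $$ (q, p)) w"
      using assms \<open>q \<in> _\<close> by (auto simp: tensor_mult_of_mat_Cons cblock_def fun_of_mat_def block_def)
  qed simp
  finally show ?thesis .
qed

section \<open>Words acting on states\<close>

fun wchain ::
    "nat \<Rightarrow> (nat \<Rightarrow> 'a::field fmat \<Rightarrow> 'a fmat) \<Rightarrow> nat list \<Rightarrow> 'a fmat list \<Rightarrow> 'a fmat \<Rightarrow> 'a fmat" where
  "wchain L A (k # \<omega>) (P # Ps) y = fmul L (A k P) (wchain L A \<omega> Ps y)"
| "wchain L A _ _ y = y"

text \<open>The contribution of one word of length l to a^l x, where a is
  \<open>blift d A N\<close>; \<open>sum_bchain_Suc\<close> recovers the power from all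
  words.\<close>

primrec bchain ::
    "nat \<Rightarrow> nat \<Rightarrow> (nat \<Rightarrow> 'a::field fmat \<Rightarrow> 'a fmat) \<Rightarrow> (nat \<Rightarrow> 'a bmat) \<Rightarrow> nat list
      \<Rightarrow> 'a bmat \<Rightarrow> 'a bmat" where
  "bchain m L A N [] x = x"
| "bchain m L A N (k # \<omega>) x = bmul m L (\<lambda>i j. A k (N k i j)) (bchain m L A N \<omega> x)"

lemma bchain_zero [simp]: "bchain m L A N \<omega> 0 = 0"
  by (induction \<omega>) (simp_all only: bchain.simps bmul_zero_right)

lemma bchain_add: "bchain m L A N \<omega> (x + y) = bchain m L A N \<omega> x + bchain m L A N \<omega> y"
  by (induction \<omega>) (simp_all only: bchain.simps bmul_add_right)

lemma bchain_sum: "bchain m L A N \<omega> (sum f I) = (\<Sum>a\<in>I. bchain m L A N \<omega> (f a))"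
proof -
  have "sum (bchain m L A N \<omega> \<circ> f) I = bchain m L A N \<omega> (sum f I)"
    by (rule sum_comp_morphism) (rule bchain_zero, rule bchain_add)
  then show ?thesis by (simp only: o_def)
qed

lemma sum_bchain_Suc:
  "(\<Sum>\<omega>\<in>words_of_length d (Suc l). bchain m L A N \<omega> x)
    = bmul m L (blift d A N) (\<Sum>\<omega>\<in>words_of_length d l. bchain m L A N \<omega> x)"
proof -
  have *: "blift d A N = (\<Sum>k<d. (\<lambda>i j. A k (N k i j)))"
    by (rule ext, rule ext) (simp add: blift_def sum_apply)
  show ?thesis
    unfolding sum_words_Cons bchain.simps * by (simp only: bmul_sum_left, simp only: bmul_sum_right)
qed

text \<open>Shared induction step of the two expansions below. Expanding the blocks of
  \<open>X ! k\<close> in elementary matrices turns the block product into the recursion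
  \<open>odot_power_Cons\<close> of tensor coefficients; \<open>h\<close> stands for whatever the
  rest of the word yields.\<close>

lemma odot_chain_step:
  assumes A: "flinear s L c (A k)" and i: "i < m" and p: "p < m"
    and u: "\<And>q. q < m \<Longrightarrow> u q = (\<Sum>w\<in>basis_words s l. fsmult ((odot_power s m X \<omega> $$ (q, p)) w) (h w))"
  shows "(\<Sum>q<m. fmul n (A k (cblock s m (X ! k) i q)) (u q))
    = (\<Sum>w\<in>basis_words s (Suc l). fsmult ((odot_power s m X (k # \<omega>) $$ (i, p)) w)
        (fmul n (A k (fun_of_mat (elem_mat s (hd w)))) (h (tl w))))"
proof -
  let ?I = "{..<s} \<times> {..<s}" and ?N = "cblock s m (X ! k)" and ?o = "odot_power s m X \<omega>"
  let ?E = "\<lambda>e w. fmul n (A k (fun_of_mat (elem_mat s e))) (h w)"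
  have "(\<Sum>q<m. fmul n (A k (?N i q)) (u q))
      = (\<Sum>q<m. \<Sum>w\<in>basis_words s l. \<Sum>e\<in>?I. fsmult (?N i q (fst e) (snd e) * (?o $$ (q, p)) w) (?E e w))"
  proof (rule sum.cong)
    fix q assume "q \<in> {..<m}"
    have "fmul n (A k (?N i q)) (u q)
        = fmul n (\<Sum>e\<in>?I. fsmult (?N i q (fst e) (snd e)) (A k (fun_of_mat (elem_mat s e))))
            (\<Sum>w\<in>basis_words s l. fsmult ((?o $$ (q, p)) w) (h w))"
      using flinear_expand[OF A, of "?N i q"] u \<open>q \<in> _\<close> by simp
    also have "\<dots> = (\<Sum>w\<in>basis_words s l. \<Sum>e\<in>?I.
        fsmult (?N i q (fst e) (snd e) * (?o $$ (q, p)) w) (?E e w))"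
      by (simp only: fmul_sum_right, simp only: fmul_sum_left fmul_fsmult_left fmul_fsmult_right
          fsmult_sum_right fsmult_fsmult mult.commute)
    finally show "fmul n (A k (?N i q)) (u q) = \<dots>" .
  qed simp
  also have "\<dots> = (\<Sum>w\<in>basis_words s l. \<Sum>e\<in>?I. \<Sum>q<m.
      fsmult (?N i q (fst e) (snd e) * (?o $$ (q, p)) w) (?E e w))"
    by (subst sum.swap, rule sum.cong[OF refl], rule sum.swap)
  also have "\<dots> = (\<Sum>w\<in>basis_words s l. \<Sum>e\<in>?I.
      fsmult ((odot_power s m X (k # \<omega>) $$ (i, p)) (e # w)) (?E e w))"
    using i p by (simp add: odot_power_Cons fsmult_sum_left)
  finally show ?thesis by (simp add: sum_basis_words_Suc)
qed

context fm_system
begin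

text \<open>The chain sees the argument only through the coefficients of its odot power. For i < m
  it therefore vanishes as soon as that power does, which carries nilpotence over from the tensor
  algebra to a.\<close>

lemma bchain_expand:
  assumes "i < m" "\<omega> \<in> words d"
  shows "bchain m L A (\<lambda>k. cblock s m (X ! k)) \<omega> x i j
    = (\<Sum>p<m. \<Sum>w\<in>basis_words s (length \<omega>). fsmult ((odot_power s m X \<omega> $$ (i, p)) w)
        (wchain L A \<omega> (map (\<lambda>e. fun_of_mat (elem_mat s e)) w) (x p j)))"
  using assms
proof (induction \<omega> arbitrary: i)
  case Nil
  have "(\<Sum>p<m. fsmult ((odot_power s m X [] $$ (i, p)) []) (x p j))
      = (\<Sum>p<m. if p = i then x i j else 0)"
    using Nil by (intro sum.cong)
      (auto simp: odot_power_def tensor_one_mat_def tensor_one_def fsmult_def fun_eq_iff)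
  then show ?case using Nil by (simp add: basis_words_0)
next
  case (Cons k \<omega>)
  let ?N = "\<lambda>k. cblock s m (X ! k)" and ?E = "\<lambda>e. fun_of_mat (elem_mat s e)"
  have k: "k < d" and \<omega>: "\<omega> \<in> words d" using Cons.prems by (auto simp: words_def)
  define h where "h p w = wchain L A \<omega> (map ?E w) (x p j)" for p w
  define u where "u p q = (\<Sum>w\<in>basis_words s (length \<omega>). fsmult ((odot_power s m X \<omega> $$ (q, p)) w) (h p w))"
    for p q
  have "bchain m L A ?N (k # \<omega>) x i j
      = (\<Sum>q<m. fmul L (A k (?N k i q)) (\<Sum>p<m. u p q))"
    using Cons.IH \<omega> unfolding bchain.simps bmul_def u_def h_def
    by (intro sum.cong refl arg_cong[of _ _ "fmul _ _"]) auto
  also have "\<dots> = (\<Sum>p<m. \<Sum>q<m. fmul L (A k (?N k i q)) (u p q))"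
    unfolding fmul_sum_right by (rule sum.swap)
  also have "\<dots> = (\<Sum>p<m. \<Sum>w\<in>basis_words s (Suc (length \<omega>)).
      fsmult ((odot_power s m X (k # \<omega>) $$ (i, p)) w) (fmul L (A k (?E (hd w))) (h p (tl w))))"
    using linA[rule_format, OF k] Cons.prems
    by (intro sum.cong refl odot_chain_step) (auto simp: u_def)
  also have "\<dots> = (\<Sum>p<m. \<Sum>w\<in>basis_words s (length (k # \<omega>)).
      fsmult ((odot_power s m X (k # \<omega>) $$ (i, p)) w) (wchain L A (k # \<omega>) (map ?E w) (x p j)))"
    by (intro sum.cong refl arg_cong[of _ _ "fsmult _"])
      (auto simp: h_def basis_words_def length_Suc_conv)
  finally show ?case .
qed

text \<open>Here the chain ends in the blocks of B, which use up the last tensor factor. Hence the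
  (i, j) entry of the power for the full word appears, and no sum over intermediate blocks
  remains.\<close>

lemma bchain_last_expand:
  assumes "i < m" "j < m" "\<omega> @ [k] \<in> words d"
  shows "bchain m L A (\<lambda>k. cblock s m (X ! k)) \<omega> (\<lambda>i j. B k (cblock s m (X ! k) i j)) i j
    = (\<Sum>w\<in>basis_words s (Suc (length \<omega>)). fsmult ((odot_power s m X (\<omega> @ [k]) $$ (i, j)) w)
        (wchain L A \<omega> (map (\<lambda>e. fun_of_mat (elem_mat s e)) (butlast w))
          (B k (fun_of_mat (elem_mat s (last w))))))"
  using assms
proof (induction \<omega> arbitrary: i)
  case Nil
  let ?E = "\<lambda>e. fun_of_mat (elem_mat s e)"
  have k: "k < d" using Nil by (auto simp: words_def)
  have *: "(odot_power s m X [k] $$ (i, j)) [e] = cblock s m (X ! k) i j (fst e) (snd e)"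
    if "e \<in> {..<s} \<times> {..<s}" for e
  proof -
    have "(odot_power s m X [k] $$ (i, j)) [e]
        = (\<Sum>q<m. cblock s m (X ! k) i q (fst e) (snd e) * (odot_power s m X [] $$ (q, j)) [])"
      using odot_power_Cons[of i m j e s X k "[]" "[]"] Nil that by simp
    also have "\<dots> = (\<Sum>q<m. if q = j then cblock s m (X ! k) i j (fst e) (snd e) else 0)"
      using Nil by (intro sum.cong) (auto simp: odot_power_def tensor_one_mat_def tensor_one_def)
    finally show ?thesis using Nil by simp
  qed
  have "B k (cblock s m (X ! k) i j)
      = (\<Sum>e\<in>{..<s} \<times> {..<s}. fsmult (cblock s m (X ! k) i j (fst e) (snd e)) (B k (?E e)))"
    by (rule flinear_expand[OF linB[rule_format, OF k]])
  then show ?case by (simp add: sum_basis_words_Suc basis_words_0 * cong: sum.cong)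
next
  case (Cons l \<omega>)
  let ?N = "\<lambda>k. cblock s m (X ! k)" and ?E = "\<lambda>e. fun_of_mat (elem_mat s e)"
  have l: "l < d" and \<omega>: "\<omega> @ [k] \<in> words d" using Cons.prems by (auto simp: words_def)
  have "bchain m L A ?N (l # \<omega>) (\<lambda>i j. B k (?N k i j)) i j
      = (\<Sum>q<m. fmul L (A l (?N l i q)) (bchain m L A ?N \<omega> (\<lambda>i j. B k (?N k i j)) q j))"
    by (simp add: bmul_def)
  also have "\<dots> = (\<Sum>w\<in>basis_words s (Suc (Suc (length \<omega>))).
      fsmult ((odot_power s m X (l # \<omega> @ [k]) $$ (i, j)) w) (fmul L (A l (?E (hd w)))
        (wchain L A \<omega> (map ?E (butlast (tl w))) (B k (?E (last (tl w)))))))"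
    using linA[rule_format, OF l] Cons.prems Cons.IH \<omega> by (intro odot_chain_step) auto
  also have "\<dots> = (\<Sum>w\<in>basis_words s (Suc (length (l # \<omega>))).
      fsmult ((odot_power s m X ((l # \<omega>) @ [k]) $$ (i, j)) w)
        (wchain L A (l # \<omega>) (map ?E (butlast w)) (B k (?E (last w)))))"
    by (rule sum.cong) (auto simp: basis_words_def length_Suc_conv)
  finally show ?case .
qed

lemma sum_bchain_nilpotent:
  assumes "\<And>\<omega>. \<omega> \<in> words d \<Longrightarrow> length \<omega> = K \<Longrightarrow> odot_power s m X \<omega> = tensor_zero_mat m" "0 < K"
  shows "(\<Sum>\<omega>\<in>words_of_length d K. bchain m L A (\<lambda>k. cblock s m (X ! k)) \<omega> x) = 0"
proof (rule sum.neutral, rule ballI)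
  fix \<omega> assume \<omega>: "\<omega> \<in> words_of_length d K"
  let ?N = "\<lambda>k. cblock s m (X ! k)"
  have \<omega>d: "\<omega> \<in> words d" "length \<omega> = K" using \<omega> by (auto simp: words_of_length_def)
  show "bchain m L A ?N \<omega> x = 0"
  proof (rule ext, rule ext)
    fix i j
    show "bchain m L A ?N \<omega> x i j = 0 i j"
    proof (cases "i < m")
      case True
      then show ?thesis using bchain_expand[OF True \<omega>d(1)] assms(1)[OF \<omega>d]
        by (simp add: tensor_zero_mat_def)
    next
      case False
      \<comment> \<open>Rows beyond m vanish because \<open>cblock\<close> does. The assumption 0 <
        K provides a link to which this applies; the empty chain would return \<open>x\<close>
        itself.\<close>
      obtain k \<omega>' where k: "\<omega> = k # \<omega>'" "k < d"
        using \<omega>d assms(2) by (cases \<omega>) (auto simp: words_def)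
      then show ?thesis
        using False flinear_zero[OF linA[rule_format, OF k(2)]]
        by (simp add: bmul_def cblock_def)
    qed
  qed
qed

end

section \<open>Series with a realization\<close>

locale realized_series =
  fixes s d L :: nat and Y :: "'a::field mat list" and f :: "nat list \<Rightarrow> 'a mat list \<Rightarrow> 'a mat"
    and D C :: "'a mat" and A B :: "nat \<Rightarrow> 'a mat \<Rightarrow> 'a mat"
  assumes s_pos: "0 < s" and Y: "Y \<in> mat_tuples d s"
    and realization: "fm_realization s d L D C A B" and admits: "admits s d f L D C A B"
begin

abbreviation "fA \<equiv> \<lambda>k. fmap s (A k)"
abbreviation "fB \<equiv> \<lambda>k. fmap s (B k)"
abbreviation "fC \<equiv> fun_of_mat C"
abbreviation "fD \<equiv> fun_of_mat D"
abbreviation "fY \<equiv> \<lambda>k. fun_of_mat (Y ! k)"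
abbreviation "elem_fun \<equiv> \<lambda>e. fun_of_mat (elem_mat s e) :: 'a fmat"

lemma carrier_D: "D \<in> carrier_mat s s" and carrier_C: "C \<in> carrier_mat s L"
  and linear_A: "k < d \<Longrightarrow> mat_linear s L L (A k)" and linear_B: "k < d \<Longrightarrow> mat_linear s L s (B k)"
  using realization by (auto simp: fm_realization_def)

lemma carrier_A: "k < d \<Longrightarrow> Z \<in> carrier_mat s s \<Longrightarrow> A k Z \<in> carrier_mat L L"
  and carrier_B: "k < d \<Longrightarrow> Z \<in> carrier_mat s s \<Longrightarrow> B k Z \<in> carrier_mat L s"
  using linear_A linear_B by (auto simp: mat_linear_def)

lemma carrier_Y: "k < d \<Longrightarrow> Y ! k \<in> carrier_mat s s"
  using Y by (auto simp: mat_tuples_def)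

sublocale fm_system s L d fA fB fC fD fY
  by unfold_locales
    (auto intro!: flinear_fmap fsupp_fun_of_mat carrier_C carrier_D linear_A linear_B)

lemma word_prod_Cons: "word_prod L A (k # \<omega>) (Z # Zs) = A k Z * word_prod L A \<omega> Zs"
  by (simp add: word_prod_def)

lemma word_prod_Nil [simp]: "word_prod L A [] Zs = 1\<^sub>m L"
  by (simp add: word_prod_def)

lemma word_prod_carrier:
  "\<omega> \<in> words d \<Longrightarrow> Zs \<in> mat_tuples (length \<omega>) s \<Longrightarrow> word_prod L A \<omega> Zs \<in> carrier_mat L L"
proof (induction \<omega> arbitrary: Zs)
  case (Cons k \<omega>)
  then obtain Z Zs' where "Zs = Z # Zs'" by (cases Zs) (auto simp: mat_tuples_def)
  with Cons show ?case
    by (auto simp: word_prod_Cons words_def mat_tuples_def intro!: mult_carrier_mat carrier_A)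
qed simp

lemma fun_of_mat_word_prod:
  "\<omega> \<in> words d \<Longrightarrow> Zs \<in> mat_tuples (length \<omega>) s \<Longrightarrow> M \<in> carrier_mat L c \<Longrightarrow>
    fun_of_mat (word_prod L A \<omega> Zs * M) = wchain L fA \<omega> (map fun_of_mat Zs) (fun_of_mat M)"
proof (induction \<omega> arbitrary: Zs)
  case (Cons k \<omega>)
  then obtain Z Zs' where Zs: "Zs = Z # Zs'" by (cases Zs) (auto simp: mat_tuples_def)
  have k: "k < d" "\<omega> \<in> words d" "Z \<in> carrier_mat s s" "Zs' \<in> mat_tuples (length \<omega>) s"
    using Cons.prems by (auto simp: Zs words_def mat_tuples_def)
  have "word_prod L A (k # \<omega>) Zs * M = A k Z * (word_prod L A \<omega> Zs' * M)"
    unfolding Zs word_prod_Cons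
    by (rule assoc_mult_mat[OF carrier_A[OF k(1,3)] word_prod_carrier[OF k(2,4)] Cons.prems(3)])
  then have "fun_of_mat (word_prod L A (k # \<omega>) Zs * M)
      = fmul L (fun_of_mat (A k Z)) (fun_of_mat (word_prod L A \<omega> Zs' * M))"
    using fun_of_mat_mult[OF carrier_A[OF k(1,3)] mult_carrier_mat[OF word_prod_carrier[OF k(2,4)] Cons.prems(3)]]
    by simp
  then show ?case
    using Cons.IH[OF k(2,4) Cons.prems(3)] k by (simp add: Zs fmap_fun_of_mat)
qed simp

lemma f_Nil: "f [] [] = D"
  using admits by (simp add: admits_def)

lemma f_snoc:
  assumes "\<omega> @ [k] \<in> words d" "Zs \<in> mat_tuples (length \<omega>) s" "Z \<in> carrier_mat s s"
  shows "f (\<omega> @ [k]) (Zs @ [Z]) = C * (word_prod L A \<omega> Zs * B k Z)"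
    and "f (\<omega> @ [k]) (Zs @ [Z]) \<in> carrier_mat s s"
proof -
  have k: "\<omega> \<in> words d" "k < d" using assms by (auto simp: words_def)
  have "Zs @ [Z] \<in> mat_tuples (length (\<omega> @ [k])) s"
    using assms by (auto simp: mat_tuples_def)
  then have "f (\<omega> @ [k]) (Zs @ [Z]) = C * word_prod L A \<omega> Zs * B k Z"
    using admits assms(1) unfolding admits_def
    by (metis append_is_Nil_conv butlast_snoc last_snoc not_Cons_self2)
  also have "\<dots> = C * (word_prod L A \<omega> Zs * B k Z)"
    by (rule assoc_mult_mat[OF carrier_C word_prod_carrier[OF k(1) assms(2)] carrier_B[OF k(2) assms(3)]])
  finally show *: "f (\<omega> @ [k]) (Zs @ [Z]) = C * (word_prod L A \<omega> Zs * B k Z)" .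
  show "f (\<omega> @ [k]) (Zs @ [Z]) \<in> carrier_mat s s" unfolding *
    by (rule mult_carrier_mat[OF carrier_C mult_carrier_mat[OF word_prod_carrier[OF k(1) assms(2)]
            carrier_B[OF k(2) assms(3)]]])
qed

lemma fun_of_mat_f_snoc:
  assumes "\<omega> @ [k] \<in> words d" "Zs \<in> mat_tuples (length \<omega>) s" "Z \<in> carrier_mat s s"
  shows "fun_of_mat (f (\<omega> @ [k]) (Zs @ [Z]))
    = fmul L fC (wchain L fA \<omega> (map fun_of_mat Zs) (fB k (fun_of_mat Z)))"
proof -
  have k: "\<omega> \<in> words d" "k < d" using assms by (auto simp: words_def)
  note B = carrier_B[OF k(2) assms(3)]
  show ?thesis
    unfolding f_snoc(1)[OF assms] fmap_fun_of_mat[OF assms(3)] fun_of_mat_word_prod[OF k(1) assms(2) B, symmetric]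
    by (rule fun_of_mat_mult[OF carrier_C mult_carrier_mat[OF word_prod_carrier[OF k(1) assms(2)] B]])
qed

lemma elem_mat_tuples: "w \<in> basis_words s l \<Longrightarrow> map (elem_mat s) w \<in> mat_tuples l s"
  by (auto simp: basis_words_def mat_tuples_def elem_mat_def)

lemma f_elem_carrier:
  assumes "\<omega> \<in> words d" "w \<in> basis_words s (length \<omega>)"
  shows "f \<omega> (map (elem_mat s) w) \<in> carrier_mat s s"
proof (cases \<omega> rule: rev_cases)
  case Nil
  then show ?thesis using assms carrier_D by (simp add: basis_words_0 f_Nil)
next
  case (snoc \<omega>' k)
  then obtain w' e where w: "w = w' @ [e]" using assms
    by (cases w rule: rev_cases) (auto simp: basis_words_def)
  then have "w' \<in> basis_words s (length \<omega>')" using assms by (auto simp: basis_words_def snoc)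
  then show ?thesis
    using f_snoc(2)[of \<omega>' k "map (elem_mat s) w'" "elem_mat s e"] assms
    by (simp add: snoc w elem_mat_tuples) (simp add: elem_mat_def)
qed

text \<open>Unfolds \<open>tensor_lift\<close> into a combination of values of f on elementary
  matrices, the shape that can be compared with \<open>bchain_last_expand\<close>.\<close>

lemma block_nc_term:
  assumes "i < m" "j < m" "\<omega> \<in> words d"
  shows "fun_of_mat (block s (nc_term s m Y f X \<omega>) (i, j))
    = (\<Sum>w\<in>basis_words s (length \<omega>).
        fsmult ((odot_power s m (centred m Y X) \<omega> $$ (i, j)) w) (fun_of_mat (f \<omega> (map (elem_mat s) w))))"
    (is "?l = ?r")
proof (intro ext)
  fix a b
  have sup: "fsupp s s ?l" "fsupp s s ?r"
  proof -
    show "fsupp s s ?l" by (rule fsupp_fun_of_mat) (simp add: block_def)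
    have "fsupp s s (fun_of_mat (f \<omega> (map (elem_mat s) w)))" if "w \<in> basis_words s (length \<omega>)" for w
      using f_elem_carrier[OF assms(3) that] by (rule fsupp_fun_of_mat)
    then show "fsupp s s ?r" by (intro fsupp_sum) (auto simp: fsupp_def fsmult_def)
  qed
  show "?l a b = ?r a b"
  proof (cases "a < s \<and> b < s")
    case True
    have less: "i * s + a < s * m" "j * s + b < s * m"
      using assms True by (simp_all add: block_index_less)
    have "?l a b = tensor_lift s (length \<omega>) (f \<omega>) (odot_power s m (centred m Y X) \<omega> $$ (i, j)) $$ (a, b)"
      using True less by (simp add: fun_of_mat_def block_def nc_term_def)
    also have "\<dots> = ?r a b"
      using True carrier_matD[OF f_elem_carrier[OF assms(3)]]
      by (auto simp: tensor_lift_def sum_apply fsmult_def fun_of_mat_def basis_words_def intro!: sum.cong)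
    finally show ?thesis .
  next
    case False
    then show ?thesis using sup by (auto simp: fsupp_def not_less)
  qed
qed

abbreviation "cN m X \<equiv> \<lambda>k. cblock s m (centred m Y X ! k)"

lemma block_nc_term_Nil:
  assumes "i < m" "j < m"
  shows "fun_of_mat (block s (nc_term s m Y f X []) (i, j)) = (if i = j then fD else 0)"
  using assms by (subst block_nc_term)
    (auto simp: words_def basis_words_0 f_Nil odot_power_def tensor_one_mat_def tensor_one_def
      fsmult_def fun_eq_iff)

text \<open>Both sides expand over the same elementary tensors, the left by
  \<open>tensor_lift\<close> and the right by \<open>bchain_last_expand\<close>; the realization
  identifies the values.\<close>

lemma block_nc_term_snoc:
  assumes "i < m" "j < m" "\<omega> @ [k] \<in> words d"
  shows "fun_of_mat (block s (nc_term s m Y f X (\<omega> @ [k])) (i, j))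
    = fmul L fC (bchain m L fA (cN m X) \<omega> (\<lambda>i j. fB k (cN m X k i j)) i j)"
proof -
  have "fun_of_mat (f (\<omega> @ [k]) (map (elem_mat s) w))
      = fmul L fC (wchain L fA \<omega> (map elem_fun (butlast w)) (fB k (elem_fun (last w))))"
    if "w \<in> basis_words s (Suc (length \<omega>))" for w
  proof -
    have "w \<noteq> []" using that by (auto simp: basis_words_def)
    then obtain w' e where w: "w = w' @ [e]" by (cases w rule: rev_cases) auto
    then have "w' \<in> basis_words s (length \<omega>)" using that by (auto simp: basis_words_def)
    then have "map (elem_mat s) w' \<in> (mat_tuples (length \<omega>) s :: 'a mat list set)"
      by (rule elem_mat_tuples)
    then show ?thesis
      using fun_of_mat_f_snoc[OF assms(3), of "map (elem_mat s) w'" "elem_mat s e"]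
      by (simp add: w o_def) (simp add: elem_mat_def)
  qed
  then show ?thesis
    unfolding bchain_last_expand[OF assms] block_nc_term[OF assms]
    by (simp add: fmul_sum_right fmul_fsmult_right)
qed

text \<open>The words of length l + 1 together contribute C a^l b.\<close>

lemma sum_block_nc_term_Suc:
  assumes "i < m" "j < m"
  shows "(\<Sum>\<omega>\<in>words_of_length d (Suc l). fun_of_mat (block s (nc_term s m Y f X \<omega>) (i, j)))
    = fmul L fC ((\<Sum>\<omega>\<in>words_of_length d l. bchain m L fA (cN m X) \<omega> (blift d fB (cN m X))) i j)"
proof -
  have lift: "blift d fB (cN m X) = (\<Sum>k<d. (\<lambda>i j. fB k (cN m X k i j)))"
    by (rule ext, rule ext) (simp add: blift_def sum_apply)
  have "(\<Sum>\<omega>\<in>words_of_length d (Suc l). fun_of_mat (block s (nc_term s m Y f X \<omega>) (i, j)))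
      = (\<Sum>\<omega>\<in>words_of_length d l. \<Sum>k<d.
          fmul L fC (bchain m L fA (cN m X) \<omega> (\<lambda>i j. fB k (cN m X k i j)) i j))"
    unfolding sum_words_snoc
    by (intro sum.cong refl block_nc_term_snoc assms) (auto simp: words_of_length_def words_def)
  also have "\<dots> = fmul L fC ((\<Sum>\<omega>\<in>words_of_length d l. bchain m L fA (cN m X) \<omega> (blift d fB (cN m X))) i j)"
    unfolding lift by (simp add: bchain_sum sum_apply fmul_sum_right)
  finally show ?thesis .
qed

lemma nilp_imp_bound:
  assumes "X \<in> nilp s d Y (s * m)"
  obtains K where "0 < K" "0 < m"
    "\<forall>\<omega>\<in>words d. K \<le> length \<omega> \<longrightarrow> odot_power s m (centred m Y X) \<omega> = tensor_zero_mat m"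
proof -
  obtain m' \<kappa> where m': "0 < m'" "s * m = s * m'"
    and *: "\<forall>\<omega> \<in> words d. \<kappa> \<le> length \<omega> \<longrightarrow> odot_power s m' (centred m' Y X) \<omega> = tensor_zero_mat m'"
    using assms unfolding nilp_def by blast
  then have "m' = m" using s_pos by simp
  then show ?thesis using that[of "Suc \<kappa>"] * m' by auto
qed

text \<open>Passing from the words with nonzero power to all words of length at most K adds only
  zero terms. The bound \<open>Suc K\<close> leaves exactly K lengths once the empty word is split
  off, matching the K summands of \<open>v\<close> in \<open>eval_solution\<close>.\<close>

lemma block_eval:
  assumes X: "X \<in> nilp s d Y (s * m)" and K: "0 < K"
    "\<forall>\<omega>\<in>words d. K \<le> length \<omega> \<longrightarrow> odot_power s m (centred m Y X) \<omega> = tensor_zero_mat m"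
    and ij: "i < m" "j < m"
  shows "fun_of_mat (block s (nc_series_eval s d Y f (s * m) X) (i, j))
    = (\<Sum>l<Suc K. \<Sum>\<omega>\<in>words_of_length d l. fun_of_mat (block s (nc_term s m Y f X \<omega>) (i, j)))"
proof -
  let ?o = "odot_power s m (centred m Y X)"
  let ?W = "{\<omega> \<in> words d. ?o \<omega> \<noteq> tensor_zero_mat m}"
  let ?V = "\<Union>l<Suc K. words_of_length d l"
  let ?t = "\<lambda>\<omega>. fun_of_mat (block s (nc_term s m Y f X \<omega>) (i, j))"
  have m: "s * m div s = m" using s_pos by simp
  have less: "i * s + a < s * m" "j * s + a < s * m" if "a < s" for a
    using ij that by (simp_all add: block_index_less)
  have "fun_of_mat (block s (nc_series_eval s d Y f (s * m) X) (i, j)) = (\<Sum>\<omega>\<in>?W. ?t \<omega>)"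
    using less by (intro ext) (auto simp: fun_of_mat_def block_def nc_series_eval_def Let_def m sum_apply)
  also have "\<dots> = (\<Sum>\<omega>\<in>?V. ?t \<omega>)"
  proof (rule sum.mono_neutral_left)
    show "finite ?V" by (simp add: finite_words_of_length)
    show "?W \<subseteq> ?V"
    proof
      fix \<omega> assume "\<omega> \<in> ?W"
      then have "\<omega> \<in> words d" "length \<omega> < K" using K(2) by (auto simp: not_le[symmetric])
      then show "\<omega> \<in> ?V" by (auto simp: words_of_length_def)
    qed
    show "\<forall>\<omega>\<in>?V - ?W. ?t \<omega> = 0"
    proof
      fix \<omega> assume "\<omega> \<in> ?V - ?W"
      then have "\<omega> \<in> words d" "?o \<omega> = tensor_zero_mat m" by (auto simp: words_of_length_def)
      then show "?t \<omega> = 0" using ij by (simp add: block_nc_term tensor_zero_mat_def)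
    qed
  qed
  also have "\<dots> = (\<Sum>l<Suc K. \<Sum>\<omega>\<in>words_of_length d l. ?t \<omega>)"
    by (rule sum.UNION_disjoint) (simp_all add: finite_words_of_length, auto simp: words_of_length_def)
  finally show ?thesis .
qed

text \<open>\<open>v\<close> is the Neumann sum of a^l b over l < K. It solves the state equation
  because a^K b = 0, and any x with x = a x equals a^K x = 0.\<close>

lemma eval_solution:
  assumes X: "X \<in> nilp s d Y (s * m)"
  obtains v where "v = blift d fB (cN m X) + bmul m L (blift d fA (cN m X)) v"
    "\<And>i j. i < m \<Longrightarrow> j < m \<Longrightarrow> fun_of_mat (block s (nc_series_eval s d Y f (s * m) X) (i, j))
      = (if i = j then fD else 0) + fmul L fC (v i j)"
    "\<And>x. x = bmul m L (blift d fA (cN m X)) x \<Longrightarrow> x = 0"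
proof -
  obtain K where K: "0 < K" and nil:
    "\<forall>\<omega>\<in>words d. K \<le> length \<omega> \<longrightarrow> odot_power s m (centred m Y X) \<omega> = tensor_zero_mat m"
    using nilp_imp_bound[OF X] by metis
  let ?a = "blift d fA (cN m X)" and ?b = "blift d fB (cN m X)"
  define U where "U l x = (\<Sum>\<omega>\<in>words_of_length d l. bchain m L fA (cN m X) \<omega> x)" for l x
  have U0: "U 0 x = x" for x by (simp add: U_def words_of_length_0)
  have USuc: "U (Suc l) x = bmul m L ?a (U l x)" for l x
    unfolding U_def by (rule sum_bchain_Suc)
  have UK: "U K x = 0" for x unfolding U_def using nil K by (intro sum_bchain_nilpotent) auto
  define v where "v = (\<Sum>l<K. U l ?b)"
  show ?thesis
  proof (rule that)
    have "?b + bmul m L ?a v = U 0 ?b + (\<Sum>l<K. U (Suc l) ?b)"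
      unfolding v_def bmul_sum_right USuc U0 ..
    also have "\<dots> = (\<Sum>l<Suc K. U l ?b)" by (simp only: sum.lessThan_Suc_shift)
    also have "\<dots> = v" by (simp only: v_def sum.lessThan_Suc UK add_0_right)
    finally show "v = ?b + bmul m L ?a v" by simp
  next
    fix i j assume ij: "i < m" "j < m"
    show "fun_of_mat (block s (nc_series_eval s d Y f (s * m) X) (i, j))
        = (if i = j then fD else 0) + fmul L fC (v i j)"
      unfolding block_eval[OF X K nil ij] sum.lessThan_Suc_shift sum_block_nc_term_Suc[OF ij]
      using ij by (simp add: words_of_length_0 block_nc_term_Nil v_def U_def sum_apply fmul_sum_right)
  next
    fix x assume x: "x = bmul m L ?a x"
    have "U l x = x" for l
    proof (induction l)
      case 0
      show ?case by (rule U0)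
    next
      case (Suc l)
      show ?case unfolding USuc Suc by (rule x[symmetric])
    qed
    then show "x = 0" using UK by metis
  qed
qed

end

section \<open>Direct sums and similarities\<close>

lemma block_carrier [simp]: "block s M ij \<in> carrier_mat s s"
  by (cases ij) (simp add: block_def)

lemma block_eqI:
  assumes "0 < s" and M: "M \<in> carrier_mat (s * m) (s * m)" and N: "N \<in> carrier_mat (s * m) (s * m)"
    and eq: "\<And>i j. i < m \<Longrightarrow> j < m \<Longrightarrow> block s M (i, j) = block s N (i, j)"
  shows "M = N"
proof (rule eq_matI)
  fix r c assume "r < dim_row N" "c < dim_col N"
  then have "r < m * s" "c < m * s" using N by (auto simp: mult.commute)
  then have "block s M (r div s, c div s) $$ (r mod s, c mod s)
      = block s N (r div s, c div s) $$ (r mod s, c mod s)"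
    by (simp add: eq less_mult_imp_div_less)
  then show "M $$ (r, c) = N $$ (r, c)" using \<open>0 < s\<close> by (simp add: block_def)
qed (use M N in auto)

lemma block_mult:
  assumes M: "M \<in> carrier_mat (s * m) (s * m)" and N: "N \<in> carrier_mat (s * m) (s * m)"
    and ij: "i < m" "j < m"
  shows "fun_of_mat (block s (M * N) (i, j))
    = (\<Sum>p<m. fmul s (fun_of_mat (block s M (i, p))) (fun_of_mat (block s N (p, j))))" (is "?l = ?r")
proof (intro ext)
  fix a b
  have sup: "fsupp s s ?l" "fsupp s s ?r"
    by (auto intro!: fsupp_sum fsupp_fmul fsupp_fun_of_mat)
  show "?l a b = ?r a b"
  proof (cases "a < s \<and> b < s")
    case True
    have "?l a b = (\<Sum>k<m * s. M $$ (i * s + a, k) * N $$ (k, j * s + b))"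
      using True M N ij block_index_less[of _ s]
      by (auto simp: fun_of_mat_def block_def scalar_prod_def atLeast0LessThan mult.commute)
    also have "\<dots> = (\<Sum>p<m. \<Sum>k\<in>{p * s..<p * s + s}. M $$ (i * s + a, k) * N $$ (k, j * s + b))"
      by (rule sum.nat_group[symmetric])
    also have "\<dots> = (\<Sum>p<m. \<Sum>c<s. M $$ (i * s + a, p * s + c) * N $$ (p * s + c, j * s + b))"
    proof (rule sum.cong)
      fix p assume "p \<in> {..<m}"
      show "(\<Sum>k\<in>{p * s..<p * s + s}. M $$ (i * s + a, k) * N $$ (k, j * s + b))
          = (\<Sum>c<s. M $$ (i * s + a, p * s + c) * N $$ (p * s + c, j * s + b))"
        by (rule sum.reindex_bij_witness[of _ "\<lambda>c. p * s + c" "\<lambda>k. k - p * s"]) auto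
    qed simp
    also have "\<dots> = ?r a b"
      using True by (simp add: sum_apply fmul_def fun_of_mat_def block_def)
    finally show ?thesis .
  next
    case False
    then show ?thesis using sup by (auto simp: fsupp_def not_less)
  qed
qed

lemma cblock_mult:
  assumes "M \<in> carrier_mat (s * m) (s * m)" "N \<in> carrier_mat (s * m) (s * m)"
  shows "cblock s m (M * N) = bmul m s (cblock s m M) (cblock s m N)"
  by (rule ext, rule ext) (auto simp: cblock_def bmul_def block_mult[OF assms])

section \<open>Direct sums in block form\<close>

lemma mat_dsum_carrier:
  "M \<in> carrier_mat n n \<Longrightarrow> N \<in> carrier_mat n' n' \<Longrightarrow> mat_dsum M N \<in> carrier_mat (n + n') (n + n')"
  by (simp add: mat_dsum_def)

lemma block_mat_dsum:
  assumes M: "M \<in> carrier_mat (s * m) (s * m)" and N: "N \<in> carrier_mat (s * m') (s * m')"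
    and ij: "i < m + m'" "j < m + m'"
  shows "block s (mat_dsum M N) (i, j) = (if i < m \<and> j < m then block s M (i, j)
    else if m \<le> i \<and> m \<le> j then block s N (i - m, j - m) else 0\<^sub>m s s)" (is "_ = ?r")
proof (rule eq_matI)
  fix a b assume "a < dim_row ?r" "b < dim_col ?r"
  then have ab: "a < s" "b < s" by (auto simp: block_def split: if_splits)
  have shift: "k * s + c - s * m = (k - m) * s + c" "s * m \<le> k * s + c" if "m \<le> k" for k c
  proof -
    have "s * m \<le> k * s" using that by (simp add: mult.commute)
    then show "k * s + c - s * m = (k - m) * s + c"
      by (simp add: diff_mult_distrib mult.commute[of s])
    show "s * m \<le> k * s + c" using \<open>s * m \<le> k * s\<close> by (rule trans_le_add1)
  qed
  have less: "i * s + a < s * m + s * m'" "j * s + b < s * m + s * m'"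
    using block_index_less[OF ab(1), of i "m + m'"] block_index_less[OF ab(2), of j "m + m'"] ij
    by (simp_all add: distrib_left)
  have less': "(k - m) * s + c < s * m'" if "m \<le> k" "k < m + m'" "c < s" for k c
    using block_index_less[OF that(3), of "k - m" m'] that by simp
  show "block s (mat_dsum M N) (i, j) $$ (a, b) = ?r $$ (a, b)"
    using M N ab ij less by (auto simp: block_def mat_dsum_def block_index_less shift less' not_less)
qed (auto simp: block_def)

text \<open>The induction adds one copy in front as a direct sum. Size and blocks are proved
  together because \<open>block_mat_dsum\<close> needs the size.\<close>

lemma diag_block_mat_replicate:
  fixes Z :: "'a::field mat"
  assumes "Z \<in> carrier_mat s s"
  shows "diag_block_mat (replicate m Z) \<in> carrier_mat (s * m) (s * m) \<and>
    (\<forall>i<m. \<forall>j<m. block s (diag_block_mat (replicate m Z)) (i, j) = (if i = j then Z else 0\<^sub>m s s))"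
proof (induction m)
  case (Suc m)
  let ?d = "diag_block_mat (replicate m Z)"
  have d: "?d \<in> carrier_mat (s * m) (s * m)" using Suc by simp
  have Z: "Z \<in> carrier_mat (s * 1) (s * 1)" using assms by simp
  have eq: "diag_block_mat (replicate (Suc m) Z) = mat_dsum Z ?d"
    by (simp add: mat_dsum_def Let_def)
  have "block s Z (0, 0) = Z" using assms by (auto simp: block_def intro!: eq_matI)
  moreover have "i < Suc m \<Longrightarrow> j < Suc m \<Longrightarrow> block s (mat_dsum Z ?d) (i, j)
      = (if i < 1 \<and> j < 1 then block s Z (i, j)
    else if 1 \<le> i \<and> 1 \<le> j then block s ?d (i - 1, j - 1) else 0\<^sub>m s s)" for i j
    using block_mat_dsum[OF Z d, of i j] by simp
  moreover have "mat_dsum Z ?d \<in> carrier_mat (s * Suc m) (s * Suc m)"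
    using mat_dsum_carrier[OF assms d] by simp
  ultimately show ?case unfolding eq using Suc by auto
qed simp

lemma block_minus:
  assumes "M \<in> carrier_mat (s * m) (s * m)" "N \<in> carrier_mat (s * m) (s * m)" "i < m" "j < m"
  shows "block s (M - N) (i, j) = block s M (i, j) - block s N (i, j)"
  using assms by (auto simp: block_def block_index_less intro!: eq_matI)

lemma block_centred:
  assumes X: "X \<in> mat_tuples d (s * m)" and Y: "Y \<in> mat_tuples d s" and k: "k < d"
    and ij: "i < m" "j < m"
  shows "block s (centred m Y X ! k) (i, j)
    = block s (X ! k) (i, j) - (if i = j then Y ! k else 0\<^sub>m s s)"
proof -
  have Xk: "X ! k \<in> carrier_mat (s * m) (s * m)" and Yk: "Y ! k \<in> carrier_mat s s"
    using X Y k by (auto simp: mat_tuples_def)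
  have "centred m Y X ! k = X ! k - diag_block_mat (replicate m (Y ! k))"
    using X Y k by (simp add: centred_def mat_tuples_def)
  then show ?thesis
    using block_minus[OF Xk _ ij, of "diag_block_mat (replicate m (Y ! k))"]
      diag_block_mat_replicate[OF Yk, of m] ij by simp
qed

lemma cblock_centred:
  assumes X: "X \<in> mat_tuples d (s * m)" and Y: "Y \<in> mat_tuples d s" and k: "k < d"
  shows "cblock s m (centred m Y X ! k)
    = cblock s m (X ! k) - (\<lambda>i j. if i = j \<and> i < m then fun_of_mat (Y ! k) else 0)"
proof (rule ext, rule ext)
  fix i j
  have Yk: "Y ! k \<in> carrier_mat s s" using Y k by (auto simp: mat_tuples_def)
  show "cblock s m (centred m Y X ! k) i j
      = (cblock s m (X ! k) - (\<lambda>i j. if i = j \<and> i < m then fun_of_mat (Y ! k) else 0)) i j"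
    using Yk by (auto simp: cblock_def block_centred[OF X Y k] fun_of_mat_minus[of _ s s] fun_of_mat_zero)
qed

lemma map2_mat_dsum_tuples:
  assumes X: "X \<in> mat_tuples d n" and X': "X' \<in> mat_tuples d n'"
  shows "map2 mat_dsum X X' \<in> mat_tuples d (n + n')"
  using assms by (auto simp: mat_tuples_def set_zip intro!: mat_dsum_carrier)

lemma block_centred_dsum:
  assumes X: "X \<in> mat_tuples d (s * m)" and X': "X' \<in> mat_tuples d (s * m')"
    and Y: "Y \<in> mat_tuples d s" and k: "k < d" and ij: "i < m + m'" "j < m + m'"
  shows "block s (centred (m + m') Y (map2 mat_dsum X X') ! k) (i, j)
    = (if i < m \<and> j < m then block s (centred m Y X ! k) (i, j)
      else if m \<le> i \<and> m \<le> j then block s (centred m' Y X' ! k) (i - m, j - m) else 0\<^sub>m s s)"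
proof -
  have Z: "map2 mat_dsum X X' \<in> mat_tuples d (s * (m + m'))"
    using map2_mat_dsum_tuples[OF X X'] by (simp add: distrib_left)
  have Xk: "X ! k \<in> carrier_mat (s * m) (s * m)" "X' ! k \<in> carrier_mat (s * m') (s * m')"
    using X X' k by (auto simp: mat_tuples_def)
  have zero: "0\<^sub>m s s - 0\<^sub>m s s = (0\<^sub>m s s :: 'a mat)" by (auto intro!: eq_matI)
  have "map2 mat_dsum X X' ! k = mat_dsum (X ! k) (X' ! k)"
    using X X' k by (simp add: mat_tuples_def)
  then show ?thesis
    using block_mat_dsum[OF Xk ij] ij block_centred[OF X Y k, of i j]
      block_centred[OF X' Y k, of "i - m" "j - m"] zero
    by (auto simp: block_centred[OF Z Y k ij])
qed

lemma odot_power_Cons_index: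
  assumes "i < m" "p < m"
  shows "odot_power s m X (k # \<omega>) $$ (i, p)
    = (\<lambda>w. \<Sum>q<m. tensor_mult (tensor_of_mat s (block s (X ! k) (i, q))) (odot_power s m X \<omega> $$ (q, p)) w)"
proof -
  have "dim_row (odot_power s m X \<omega>) = m" "dim_col (odot_power s m X \<omega>) = m"
    using odot_power_carrier[of s m X \<omega>] by auto
  then show ?thesis
    using assms by (auto simp: odot_power_def odot_def tensor_blocks_def fun_eq_iff intro!: sum.cong)
qed

lemma tensor_of_zero_mat: "tensor_of_mat s (0\<^sub>m s s) = (\<lambda>w. 0)"
  by (auto simp: tensor_of_mat_def fun_eq_iff split: list.splits)

lemma tensor_mult_zero: "tensor_mult (\<lambda>w. 0) v = (\<lambda>w. 0)" "tensor_mult u (\<lambda>w. 0) = (\<lambda>w. 0)"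
  by (auto simp: tensor_mult_def fun_eq_iff)

lemma sum_lessThan_add: "(\<Sum>q<m + m'. g q) = (\<Sum>q<m. g q) + (\<Sum>q<m'. g (m + q))"
  for g :: "nat \<Rightarrow> 'b::comm_monoid_add"
  by (induction m') (simp_all add: add.assoc)

text \<open>Block diagonal shape survives the odot product because every mixed product contains a
  zero tensor. Nilpotence of a direct sum and its evaluation both rest on this.\<close>

lemma odot_power_dsum:
  assumes X: "X \<in> mat_tuples d (s * m)" and X': "X' \<in> mat_tuples d (s * m')"
    and Y: "Y \<in> mat_tuples d s" and "\<omega> \<in> words d" "i < m + m'" "j < m + m'"
  shows "odot_power s (m + m') (centred (m + m') Y (map2 mat_dsum X X')) \<omega> $$ (i, j)
    = (if i < m \<and> j < m then odot_power s m (centred m Y X) \<omega> $$ (i, j)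
      else if m \<le> i \<and> m \<le> j then odot_power s m' (centred m' Y X') \<omega> $$ (i - m, j - m) else (\<lambda>w. 0))"
  using assms(4-)
proof (induction \<omega> arbitrary: i)
  case Nil
  then show ?case by (auto simp: odot_power_def tensor_one_mat_def)
next
  case (Cons k \<omega>)
  have k: "k < d" "\<omega> \<in> words d" using Cons.prems by (auto simp: words_def)
  note IH = Cons.IH[OF k(2) _ Cons.prems(3)] and blk = block_centred_dsum[OF X X' Y k(1)]
  show ?case
    using Cons.prems
    by (auto simp: odot_power_Cons_index IH blk sum_lessThan_add tensor_of_zero_mat tensor_mult_zero
        fun_eq_iff not_less)
qed

section \<open>Nc functions on Nilp\<close>

context realized_series
begin

lemma eval_carrier: "nc_series_eval s d Y f n X \<in> carrier_mat n n"
  by (simp add: nc_series_eval_def Let_def)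

lemma nilp_tuples: "X \<in> nilp s d Y n \<Longrightarrow> X \<in> mat_tuples d n"
  by (simp add: nilp_def)

lemma nilp_size: "X \<in> nilp s d Y n \<Longrightarrow> \<exists>m>0. n = s * m"
  by (auto simp: nilp_def)

lemma nilp_dsum:
  assumes X: "X \<in> nilp s d Y (s * m)" and X': "X' \<in> nilp s d Y (s * m')"
  shows "map2 mat_dsum X X' \<in> nilp s d Y (s * (m + m'))"
    and "nc_series_eval s d Y f (s * (m + m')) (map2 mat_dsum X X')
      = mat_dsum (nc_series_eval s d Y f (s * m) X) (nc_series_eval s d Y f (s * m') X')"
proof -
  let ?Z = "map2 mat_dsum X X'" and ?m = "m + m'"
  note t = nilp_tuples[OF X] nilp_tuples[OF X']
  have Zt: "?Z \<in> mat_tuples d (s * ?m)"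
    using map2_mat_dsum_tuples[OF t] by (simp add: distrib_left)
  obtain K1 where K1: "0 < K1" "0 < m"
    "\<forall>\<omega>\<in>words d. K1 \<le> length \<omega> \<longrightarrow> odot_power s m (centred m Y X) \<omega> = tensor_zero_mat m"
    by (rule nilp_imp_bound[OF X])
  obtain K2 where K2: "0 < K2" "0 < m'"
    "\<forall>\<omega>\<in>words d. K2 \<le> length \<omega> \<longrightarrow> odot_power s m' (centred m' Y X') \<omega> = tensor_zero_mat m'"
    by (rule nilp_imp_bound[OF X'])
  \<comment> \<open>A common bound lets \<open>block_eval\<close> truncate all three series at the
    same length, so that they can be compared word by word.\<close>
  define K where "K = max K1 K2"
  note pow = odot_power_dsum[OF t Y]
  have K: "0 < K"
    "\<forall>\<omega>\<in>words d. K \<le> length \<omega> \<longrightarrow> odot_power s m (centred m Y X) \<omega> = tensor_zero_mat m"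
    "\<forall>\<omega>\<in>words d. K \<le> length \<omega> \<longrightarrow> odot_power s m' (centred m' Y X') \<omega> = tensor_zero_mat m'"
    using K1 K2 by (auto simp: K_def)
  have KZ: "\<forall>\<omega>\<in>words d. K \<le> length \<omega> \<longrightarrow> odot_power s ?m (centred ?m Y ?Z) \<omega> = tensor_zero_mat ?m"
  proof (intro ballI impI)
    fix \<omega> assume \<omega>: "\<omega> \<in> words d" "K \<le> length \<omega>"
    then show "odot_power s ?m (centred ?m Y ?Z) \<omega> = tensor_zero_mat ?m"
      using K odot_power_carrier[of s ?m "centred ?m Y ?Z" \<omega>]
      by (intro eq_matI) (auto simp: pow tensor_zero_mat_def)
  qed
  then show Z: "?Z \<in> nilp s d Y (s * ?m)" using Zt K1 by (auto simp: nilp_def)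
  let ?F = "nc_series_eval s d Y f (s * m) X" and ?F' = "nc_series_eval s d Y f (s * m') X'"
  note blk = block_mat_dsum[OF eval_carrier[of "s * m" X] eval_carrier[of "s * m'" X']]
  show "nc_series_eval s d Y f (s * ?m) ?Z = mat_dsum ?F ?F'"
  proof (rule block_eqI[OF s_pos eval_carrier])
    show "mat_dsum ?F ?F' \<in> carrier_mat (s * ?m) (s * ?m)"
      using mat_dsum_carrier[OF eval_carrier eval_carrier, of "s * m" X "s * m'" X'] by (simp add: distrib_left)
    fix i j assume ij: "i < ?m" "j < ?m"
    have "fun_of_mat (block s (nc_term s ?m Y f ?Z \<omega>) (i, j))
      = (if i < m \<and> j < m then fun_of_mat (block s (nc_term s m Y f X \<omega>) (i, j))
        else if m \<le> i \<and> m \<le> j then fun_of_mat (block s (nc_term s m' Y f X' \<omega>) (i - m, j - m)) else 0)"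
      if "\<omega> \<in> words_of_length d l" for \<omega> l
      using that ij by (auto simp: block_nc_term pow words_of_length_def)
    then have "fun_of_mat (block s (nc_series_eval s d Y f (s * ?m) ?Z) (i, j))
      = (if i < m \<and> j < m then fun_of_mat (block s ?F (i, j))
        else if m \<le> i \<and> m \<le> j then fun_of_mat (block s ?F' (i - m, j - m)) else 0)"
      unfolding block_eval[OF Z K(1) KZ ij] using ij
        block_eval[OF X K(1,2), of i j] block_eval[OF X' K(1,3), of "i - m" "j - m"]
      by (cases "i < m"; cases "j < m") (simp_all del: sum.lessThan_Suc)
    also have "\<dots> = fun_of_mat (block s (mat_dsum ?F ?F') (i, j))"
      by (auto simp: blk[OF ij] fun_of_mat_def fun_eq_iff)
    finally show "block s (nc_series_eval s d Y f (s * ?m) ?Z) (i, j) = block s (mat_dsum ?F ?F') (i, j)"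
      by (subst (asm) fun_of_mat_inject[of _ s s]) auto
  qed
qed

lemma eval_similarity:
  assumes eqs: constant_eqs input_eqs "output_eqs fA" "output_eqs fB" "inner_eqs fA" "inner_eqs fB"
    and T: "T \<in> carrier_mat (s * m) (s * m)" and T': "T' \<in> carrier_mat (s * m) (s * m)"
    and inv: "T * T' = 1\<^sub>m (s * m)" "T' * T = 1\<^sub>m (s * m)"
    and X: "X \<in> nilp s d Y (s * m)" and X': "map (\<lambda>M. T * M * T') X \<in> nilp s d Y (s * m)"
  shows "nc_series_eval s d Y f (s * m) (map (\<lambda>M. T * M * T') X)
    = T * nc_series_eval s d Y f (s * m) X * T'"
proof -
  let ?n = "s * m" and ?X' = "map (\<lambda>M. T * M * T') X" and ?T = "cblock s m T"
  let ?F = "nc_series_eval s d Y f ?n X" and ?F' = "nc_series_eval s d Y f ?n ?X'"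
  note t = nilp_tuples[OF X] and t' = nilp_tuples[OF X']
  \<comment> \<open>I \<otimes> Y has no blocks beyond m; the formulas below for its products with T
    remain correct there because T vanishes as well.\<close>
  have Tsupp: "?T i j = 0" if "\<not> (i < m \<and> j < m)" for i j using that by (auto simp: cblock_def)
  \<comment> \<open>Writing X and X' as I \<otimes> Y plus the centred part, the relation X' T = T X
    leaves the commutator [T, I \<otimes> Y].\<close>
  have conj: "bmul m s (cN m ?X' k) ?T = bmul m s ?T (cN m X k) + bcomm s fY ?T k" if k: "k < d" for k
  proof -
    let ?I = "\<lambda>i j. if i = j \<and> i < m then fun_of_mat (Y ! k) else 0"
    have Xk: "X ! k \<in> carrier_mat ?n ?n" using t k by (auto simp: mat_tuples_def)
    have "T * X ! k * T' * T = T * X ! k * (T' * T)"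
      by (rule assoc_mult_mat[OF mult_carrier_mat[OF T Xk] T' T])
    then have "?X' ! k * T = T * X ! k"
      using Xk T t k by (simp add: inv(2) mat_tuples_def)
    moreover have "?X' ! k \<in> carrier_mat ?n ?n" using t' k by (auto simp: mat_tuples_def)
    ultimately have "bmul m s (cblock s m (?X' ! k)) ?T = bmul m s ?T (cblock s m (X ! k))"
      using cblock_mult[OF _ T] cblock_mult[OF T Xk] by metis
    moreover have "bmul m s ?I ?T = (\<lambda>i j. fmul s (fun_of_mat (Y ! k)) (?T i j))"
    proof (rule ext, rule ext)
      fix i j
      have "bmul m s ?I ?T i j = (\<Sum>p<m. if p = i then fmul s (fun_of_mat (Y ! k)) (?T i j) else 0)"
        unfolding bmul_def by (rule sum.cong) auto
      then show "bmul m s ?I ?T i j = fmul s (fun_of_mat (Y ! k)) (?T i j)"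
        by (simp add: Tsupp)
    qed
    moreover have "bmul m s ?T ?I = (\<lambda>i j. fmul s (?T i j) (fun_of_mat (Y ! k)))"
    proof (rule ext, rule ext)
      fix i j
      have "bmul m s ?T ?I i j = (\<Sum>p<m. if p = j then fmul s (?T i j) (fun_of_mat (Y ! k)) else 0)"
        unfolding bmul_def by (rule sum.cong) auto
      then show "bmul m s ?T ?I i j = fmul s (?T i j) (fun_of_mat (Y ! k))"
        by (simp add: Tsupp)
    qed
    moreover have "bcomm s fY ?T k = (\<lambda>i j. fmul s (?T i j) (fun_of_mat (Y ! k)))
        - (\<lambda>i j. fmul s (fun_of_mat (Y ! k)) (?T i j))"
      by (rule ext, rule ext) (simp add: bcomm_def fcomm_def)
    ultimately show ?thesis
      unfolding cblock_centred[OF t Y k] cblock_centred[OF t' Y k] bmul_diff_left bmul_diff_right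
      by simp
  qed
  obtain v where v: "v = blift d fB (cN m X) + bmul m L (blift d fA (cN m X)) v"
    and F: "\<And>i j. i < m \<Longrightarrow> j < m \<Longrightarrow> fun_of_mat (block s ?F (i, j))
      = (if i = j then fD else 0) + fmul L fC (v i j)"
    using eval_solution[OF X] by metis
  obtain v' where v': "v' = blift d fB (cN m ?X') + bmul m L (blift d fA (cN m ?X')) v'"
    and F': "\<And>i j. i < m \<Longrightarrow> j < m \<Longrightarrow> fun_of_mat (block s ?F' (i, j))
      = (if i = j then fD else 0) + fmul L fC (v' i j)"
    and uniq: "\<And>x. x = bmul m L (blift d fA (cN m ?X')) x \<Longrightarrow> x = 0"
    using eval_solution[OF X'] by metis
  have key: "rmul s ?T fD + bmul m s ?T (lmul L fC v) = lmul s fD ?T + lmul L fC (bmul m s v' ?T)"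
    by (rule conjugation[OF eqs _ _ _ conj v v' uniq]) (auto simp: bsupp_cblock)
  have TF: "T * ?F = ?F' * T"
  proof (rule block_eqI[OF s_pos mult_carrier_mat[OF T eval_carrier] mult_carrier_mat[OF eval_carrier T]])
    fix i j assume ij: "i < m" "j < m"
    have "fun_of_mat (block s (T * ?F) (i, j))
        = (\<Sum>p<m. fmul s (?T i p) ((if p = j then fD else 0) + fmul L fC (v p j)))"
      unfolding block_mult[OF T eval_carrier ij] using ij by (intro sum.cong) (auto simp: F cblock_def)
    also have "\<dots> = (\<Sum>p<m. (if p = j then fmul s (?T i j) fD else 0) + fmul s (?T i p) (fmul L fC (v p j)))"
      by (intro sum.cong) (auto simp: fmul_add_right)
    also have "\<dots> = (rmul s ?T fD + bmul m s ?T (lmul L fC v)) i j"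
      using ij by (simp add: sum.distrib rmul_def bmul_def lmul_def)
    also have "\<dots> = (\<Sum>p<m. (if p = i then fmul s fD (?T i j) else 0) + fmul s (fmul L fC (v' i p)) (?T p j))"
      using ij unfolding key by (simp add: sum.distrib lmul_bmul) (simp add: bmul_def lmul_def)
    also have "\<dots> = (\<Sum>p<m. fmul s ((if i = p then fD else 0) + fmul L fC (v' i p)) (?T p j))"
      by (intro sum.cong) (auto simp: fmul_add_left)
    also have "\<dots> = fun_of_mat (block s (?F' * T) (i, j))"
      unfolding block_mult[OF eval_carrier T ij] using ij by (intro sum.cong) (auto simp: F' cblock_def)
    finally show "block s (T * ?F) (i, j) = block s (?F' * T) (i, j)"
      by (subst (asm) fun_of_mat_inject[of _ s s]) auto
  qed
  have "T * ?F * T' = ?F' * (T * T')"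
    unfolding TF by (rule assoc_mult_mat[OF eval_carrier T T'])
  then show ?thesis using eval_carrier[of ?n ?X'] by (simp add: inv(1))
qed

lemma nc_set_nilp: "nc_set d (nilp s d Y)"
  unfolding nc_set_def
proof (intro conjI allI ballI)
  show "nilp s d Y 0 = {}" using s_pos by (auto simp: nilp_def)
  show "nilp s d Y n \<subseteq> mat_tuples d n" for n by (auto simp: nilp_def)
  fix n n' X X' assume X: "X \<in> nilp s d Y n" "X' \<in> nilp s d Y n'"
  then obtain m m' where "n = s * m" "n' = s * m'" using nilp_size by blast
  then show "map2 mat_dsum X X' \<in> nilp s d Y (n + n')"
    using nilp_dsum(1) X by (simp add: distrib_left)
qed

text \<open>Direct sums and sizes are settled, so only similarity is left to decide. Sizes occurring
  in \<open>nilp\<close> are multiples of s, which allows quantifying over the number of blocks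
  m.\<close>

lemma nc_function_iff:
  "nc_function d (nilp s d Y) (nc_series_eval s d Y f) \<longleftrightarrow>
    (\<forall>m X T T'. X \<in> nilp s d Y (s * m) \<longrightarrow> map (\<lambda>M. T * M * T') X \<in> nilp s d Y (s * m) \<longrightarrow>
      T \<in> carrier_mat (s * m) (s * m) \<longrightarrow> T' \<in> carrier_mat (s * m) (s * m) \<longrightarrow>
      T * T' = 1\<^sub>m (s * m) \<longrightarrow> T' * T = 1\<^sub>m (s * m) \<longrightarrow>
      nc_series_eval s d Y f (s * m) (map (\<lambda>M. T * M * T') X) = T * nc_series_eval s d Y f (s * m) X * T')"
  (is "?l \<longleftrightarrow> ?r")
proof
  assume l: ?l
  show ?r
  proof (intro allI impI)
    fix m X T T'
    assume *: "X \<in> nilp s d Y (s * m)" "map (\<lambda>M. T * M * T') X \<in> nilp s d Y (s * m)"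
      "T \<in> carrier_mat (s * m) (s * m)" "T' \<in> carrier_mat (s * m) (s * m)"
      "T * T' = 1\<^sub>m (s * m)" "T' * T = 1\<^sub>m (s * m)"
    have "inverts_mat T T'" "inverts_mat T' T"
      using *(5,6) carrier_matD(1)[OF *(3)] carrier_matD(1)[OF *(4)] by (simp_all only: inverts_mat_def)
    with * show "nc_series_eval s d Y f (s * m) (map (\<lambda>M. T * M * T') X)
        = T * nc_series_eval s d Y f (s * m) X * T'"
      using l * unfolding nc_function_def by blast
  qed
next
  assume r: ?r
  have dsum: "nc_series_eval s d Y f (n + n') (map2 mat_dsum X X')
      = mat_dsum (nc_series_eval s d Y f n X) (nc_series_eval s d Y f n' X')"
    if X: "X \<in> nilp s d Y n" "X' \<in> nilp s d Y n'" for n n' X X'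
  proof -
    obtain m m' where "n = s * m" "n' = s * m'" using X[THEN nilp_size] by blast
    then show ?thesis using nilp_dsum(2)[of X m X' m'] X by (simp add: distrib_left)
  qed
  have sim: "nc_series_eval s d Y f n (map (\<lambda>M. T * M * T') X) = T * nc_series_eval s d Y f n X * T'"
    if *: "T \<in> carrier_mat n n" "T' \<in> carrier_mat n n" "inverts_mat T T'" "inverts_mat T' T"
      "X \<in> nilp s d Y n" "map (\<lambda>M. T * M * T') X \<in> nilp s d Y n" for n T T' X
  proof -
    obtain m where m: "n = s * m" using nilp_size[OF *(5)] by blast
    have inv: "T * T' = 1\<^sub>m n" "T' * T = 1\<^sub>m n" 
      using *(3,4) carrier_matD(1)[OF *(1)] carrier_matD(1)[OF *(2)] by (simp_all only: inverts_mat_def)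
    show ?thesis
      using r[rule_format, OF *(5,6,1,2)[unfolded m] inv[unfolded m]] unfolding m .
  qed
  show ?l
    unfolding nc_function_def using nc_set_nilp eval_carrier dsum sim by blast
qed

end

section \<open>Unipotent conjugations\<close>

definition mat_of_blocks :: "nat \<Rightarrow> nat \<Rightarrow> 'a::field bmat \<Rightarrow> 'a mat" where
  "mat_of_blocks s m P = mat (s * m) (s * m) (\<lambda>(r, c). P (r div s) (c div s) (r mod s) (c mod s))"

lemma mat_of_blocks_carrier [simp]: "mat_of_blocks s m P \<in> carrier_mat (s * m) (s * m)"
  by (simp add: mat_of_blocks_def)

text \<open>\<open>btrunc\<close> bounds the block indices, \<open>bsupp\<close> the indices within
  a block; together they say that the blocks are those of an actual matrix.\<close>

definition btrunc :: "nat \<Rightarrow> 'a::field bmat \<Rightarrow> bool" where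
  "btrunc m P \<longleftrightarrow> (\<forall>i j. m \<le> i \<or> m \<le> j \<longrightarrow> P i j = 0)"

lemma btrunc_cblock: "btrunc m (cblock s m M)"
  by (auto simp: btrunc_def cblock_def)

lemma btrunc_add: "btrunc m P \<Longrightarrow> btrunc m Q \<Longrightarrow> btrunc m (P + Q)"
  by (auto simp: btrunc_def)

lemma btrunc_diff: "btrunc m P \<Longrightarrow> btrunc m Q \<Longrightarrow> btrunc m (P - Q)"
  by (auto simp: btrunc_def)

lemma bsupp_add: "bsupp s P \<Longrightarrow> bsupp s Q \<Longrightarrow> bsupp s (P + Q)"
  by (auto simp: bsupp_def intro: fsupp_add)

lemma bsupp_diff: "bsupp s P \<Longrightarrow> bsupp s Q \<Longrightarrow> bsupp s (P - Q)"
  by (auto simp: bsupp_def intro: fsupp_diff)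

lemma cblock_mat_of_blocks:
  assumes "btrunc m P" "bsupp s P"
  shows "cblock s m (mat_of_blocks s m P) = P"
proof (rule ext, rule ext)
  fix i j
  show "cblock s m (mat_of_blocks s m P) i j = P i j"
  proof (cases "i < m \<and> j < m")
    case True
    have "block s (mat_of_blocks s m P) (i, j) = mat_of_fun s s (P i j)"
      using True by (auto simp: block_def mat_of_blocks_def mat_of_fun_def block_index_less intro!: eq_matI)
    then show ?thesis using True assms(2) by (simp add: cblock_def bsupp_def fun_of_mat_of_fun)
  next
    case False
    then show ?thesis using assms(1) by (auto simp: cblock_def btrunc_def not_less)
  qed
qed

lemma cblock_inject:
  assumes "0 < s" "M \<in> carrier_mat (s * m) (s * m)" "N \<in> carrier_mat (s * m) (s * m)"
    and eq: "cblock s m M = cblock s m N"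
  shows "M = N"
proof (rule block_eqI[OF assms(1-3)])
  fix i j assume "i < m" "j < m"
  then have "fun_of_mat (block s M (i, j)) = fun_of_mat (block s N (i, j))"
    using fun_cong[OF fun_cong[OF eq, of i], of j] by (simp add: cblock_def)
  then show "block s M (i, j) = block s N (i, j)"
    by (subst (asm) fun_of_mat_inject[of _ s s]) auto
qed

section \<open>Block diagonal matrices and single blocks\<close>

definition bdiag :: "nat \<Rightarrow> 'a::field fmat \<Rightarrow> 'a bmat" where
  "bdiag m Z = (\<lambda>i j. if i = j \<and> i < m then Z else 0)"

text \<open>The matrix E_uw \<otimes> S; for u < w < m its \<open>bmul m\<close> square is
  zero.\<close>

definition bunit :: "nat \<Rightarrow> nat \<Rightarrow> 'a::field fmat \<Rightarrow> 'a bmat" where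
  "bunit u w S = (\<lambda>i j. if i = u \<and> j = w then S else 0)"

lemma btrunc_bdiag: "btrunc m (bdiag m Z)"
  by (auto simp: btrunc_def bdiag_def)

lemma btrunc_bunit: "u < m \<Longrightarrow> w < m \<Longrightarrow> btrunc m (bunit u w S)"
  by (auto simp: btrunc_def bunit_def)

lemma bsupp_bdiag: "fsupp s s Z \<Longrightarrow> bsupp s (bdiag m Z)"
  by (auto simp: bsupp_def bdiag_def)

lemma bsupp_bunit: "fsupp s s S \<Longrightarrow> bsupp s (bunit u w S)"
  by (auto simp: bsupp_def bunit_def)

lemma bmul_bunit_left: "w < m \<Longrightarrow> bmul m s (bunit u w S) P = (\<lambda>i j. if i = u then fmul s S (P w j) else 0)"
proof (rule ext, rule ext)
  fix i j assume "w < m"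
  have "bmul m s (bunit u w S) P i j = (\<Sum>p<m. if p = w then (if i = u then fmul s S (P w j) else 0) else 0)"
    unfolding bmul_def bunit_def by (intro sum.cong) auto
  then show "bmul m s (bunit u w S) P i j = (if i = u then fmul s S (P w j) else 0)"
    using \<open>w < m\<close> by simp
qed

lemma bmul_bunit_right: "u < m \<Longrightarrow> bmul m s P (bunit u w S) = (\<lambda>i j. if j = w then fmul s (P i u) S else 0)"
proof (rule ext, rule ext)
  fix i j assume "u < m"
  have "bmul m s P (bunit u w S) i j = (\<Sum>p<m. if p = u then (if j = w then fmul s (P i u) S else 0) else 0)"
    unfolding bmul_def bunit_def by (intro sum.cong) auto
  then show "bmul m s P (bunit u w S) i j = (if j = w then fmul s (P i u) S else 0)"
    using \<open>u < m\<close> by simp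
qed

text \<open>An identity matrix of bounded size, hence a unit for \<open>fmul s\<close> only on
  functions supported in that size.\<close>

definition fid :: "nat \<Rightarrow> 'a::field fmat" where
  "fid s = (\<lambda>i j. if i = j \<and> i < s then 1 else 0)"

lemma fsupp_fid: "fsupp s s (fid s)"
  by (auto simp: fsupp_def fid_def)

lemma fmul_fid_left: "fsupp s c P \<Longrightarrow> fmul s (fid s) P = P"
proof (intro ext)
  fix i j assume P: "fsupp s c P"
  have "fmul s (fid s) P i j = (\<Sum>k<s. if k = i then P i j else 0)"
    unfolding fmul_def fid_def by (intro sum.cong) auto
  then show "fmul s (fid s) P i j = P i j" using P by (auto simp: fsupp_def not_less)
qed

lemma fmul_fid_right: "fsupp r s P \<Longrightarrow> fmul s P (fid s) = P"
proof (intro ext)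
  fix i j assume P: "fsupp r s P"
  have "fmul s P (fid s) i j = (\<Sum>k<s. if k = j then P i j else 0)"
    unfolding fmul_def fid_def by (intro sum.cong) auto
  then show "fmul s P (fid s) i j = P i j" using P by (auto simp: fsupp_def not_less)
qed

lemma bmul_bdiag_left: "btrunc m P \<Longrightarrow> bsupp s P \<Longrightarrow> bmul m s (bdiag m (fid s)) P = P"
proof (rule ext, rule ext)
  fix i j assume P: "btrunc m P" "bsupp s P"
  have "bmul m s (bdiag m (fid s)) P i j = (\<Sum>p<m. if p = i then fmul s (fid s) (P i j) else 0)"
    unfolding bmul_def bdiag_def by (intro sum.cong) auto
  then show "bmul m s (bdiag m (fid s)) P i j = P i j"
    using P by (auto simp: btrunc_def bsupp_def not_less fmul_fid_left[of s s])
qed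

lemma bmul_bdiag_right: "btrunc m P \<Longrightarrow> bsupp s P \<Longrightarrow> bmul m s P (bdiag m (fid s)) = P"
proof (rule ext, rule ext)
  fix i j assume P: "btrunc m P" "bsupp s P"
  have "bmul m s P (bdiag m (fid s)) i j = (\<Sum>p<m. if p = j then fmul s (P i j) (fid s) else 0)"
    unfolding bmul_def bdiag_def by (intro sum.cong) auto
  then show "bmul m s P (bdiag m (fid s)) i j = P i j"
    using P by (auto simp: btrunc_def bsupp_def not_less fmul_fid_right[of s s])
qed

lemma cblock_one: "cblock s m (1\<^sub>m (s * m)) = bdiag m (fid s)"
proof (rule ext, rule ext)
  fix i j
  have "i * s + a = j * s + b \<longleftrightarrow> i = j \<and> a = b" if "a < s" "b < s" for a b
  proof
    assume eq: "i * s + a = j * s + b"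
    have "(i * s + a) div s = i" "(j * s + b) div s = j" using that by auto
    with eq show "i = j \<and> a = b" by auto
  qed simp
  then show "cblock s m (1\<^sub>m (s * m)) i j = bdiag m (fid s) i j"
    by (auto simp: cblock_def bdiag_def fid_def block_def fun_of_mat_def fun_eq_iff block_index_less)
qed

text \<open>Every letter moves at least one block to the right, so a nonzero entry (i, j) needs j at
  least i + length \<omega>. A word of length m leaves no room for one.\<close>

lemma odot_power_strict_upper:
  assumes "\<And>k i j. k < d \<Longrightarrow> i < m \<Longrightarrow> j < m \<Longrightarrow> j \<le> i \<Longrightarrow> block s (X ! k) (i, j) = 0\<^sub>m s s"
    and "\<omega> \<in> words d" "i < m" "j < m" "j < i + length \<omega>"
  shows "odot_power s m X \<omega> $$ (i, j) = (\<lambda>w. 0)"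
  using assms(2-)
proof (induction \<omega> arbitrary: i)
  case Nil
  then show ?case by (simp add: odot_power_def tensor_one_mat_def)
next
  case (Cons k \<omega>)
  have k: "k < d" "\<omega> \<in> words d" using Cons.prems by (auto simp: words_def)
  have "tensor_mult (tensor_of_mat s (block s (X ! k) (i, q))) (odot_power s m X \<omega> $$ (q, j)) = (\<lambda>w. 0)"
    if "q < m" for q
  proof (cases "q \<le> i")
    case True
    then show ?thesis
      using assms(1)[OF k(1) Cons.prems(2) that] by (simp add: tensor_of_zero_mat tensor_mult_zero)
  next
    case False
    then have "odot_power s m X \<omega> $$ (q, j) = (\<lambda>w. 0)"
      using Cons.IH[OF k(2) that] Cons.prems by simp
    then show ?thesis by (simp add: tensor_mult_zero)
  qed
  then show ?case using Cons.prems by (simp add: odot_power_Cons_index)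
qed

section \<open>Conjugation by 1 + S E\<close>

context realized_series
begin

lemma strict_upper_nilp:
  assumes X: "X \<in> mat_tuples d (s * m)" and "0 < m"
    and up: "\<And>k i j. k < d \<Longrightarrow> j \<le> i \<Longrightarrow> cN m X k i j = 0"
  shows "X \<in> nilp s d Y (s * m)"
proof -
  have *: "block s (centred m Y X ! k) (i, j) = 0\<^sub>m s s" if "k < d" "i < m" "j < m" "j \<le> i" for k i j
  proof -
    have "fun_of_mat (block s (centred m Y X ! k) (i, j)) = 0"
      using up[OF that(1,4)] that by (simp add: cblock_def)
    also have "0 = fun_of_mat (0\<^sub>m s s :: 'a mat)" by (simp add: fun_of_mat_zero)
    finally show ?thesis by (subst (asm) fun_of_mat_inject[of _ s s]) auto
  qed
  have "odot_power s m (centred m Y X) \<omega> = tensor_zero_mat m" if "\<omega> \<in> words d" "m \<le> length \<omega>" for \<omega>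
    using odot_power_carrier[of s m "centred m Y X" \<omega>] odot_power_strict_upper[OF * that(1)] that(2)
    by (intro eq_matI) (auto simp: tensor_zero_mat_def)
  then show ?thesis using X \<open>0 < m\<close> by (auto simp: nilp_def)
qed

text \<open>With U = E_uw \<otimes> S and P = I \<otimes> Y + N this is (1 + U) P (1 - U) - I
  \<otimes> Y without the term U P U. That term vanishes for strictly upper triangular N and u < w,
  since then the (w, u) block of P is zero.\<close>

definition nc_conj :: "nat \<Rightarrow> nat \<Rightarrow> 'a fmat \<Rightarrow> (nat \<Rightarrow> 'a bmat) \<Rightarrow> nat \<Rightarrow> 'a bmat" where
  "nc_conj u w S N k = N k + bunit u w (fcomm s S (fY k))
    + (\<lambda>i j. if i = u then fmul s S (N k w j) else 0) - (\<lambda>i j. if j = w then fmul s (N k i u) S else 0)"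

text \<open>Similarity invariance for T = 1 + U, written blockwise as F + U F = F' + F' U, with both
  values F and F' expressed through solutions of their state equations.\<close>

lemma nc_conj_solution:
  assumes nc: "nc_function d (nilp s d Y) (nc_series_eval s d Y f)"
    and supp': "\<forall>k<d. bsupp s (N k)" and trunc': "\<forall>k<d. btrunc m (N k)"
    and up': "\<forall>k<d. \<forall>i j. j \<le> i \<longrightarrow> N k i j = 0"
    and S: "fsupp s s S" and uw: "u < w" "w < m"
  obtains v v' where "v = blift d fB N + bmul m L (blift d fA N) v"
    "v' = blift d fB (nc_conj u w S N) + bmul m L (blift d fA (nc_conj u w S N)) v'"
    "\<forall>i<m. \<forall>e<m.
      ((if i = e then fD else 0) + fmul L fC (v i e))
        + (if i = u then fmul s S ((if w = e then fD else 0) + fmul L fC (v w e)) else 0)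
      = ((if i = e then fD else 0) + fmul L fC (v' i e))
        + (if e = w then fmul s ((if i = u then fD else 0) + fmul L fC (v' i u)) S else 0)"
proof -
  note supp = supp'[rule_format] and trunc = trunc'[rule_format] and up = up'[rule_format]
  let ?n = "s * m" and ?J = "bdiag m (fid s)" and ?U = "bunit u w S"
  let ?N' = "nc_conj u w S N"
  have u: "u < m" using uw by simp
  note triv = btrunc_add btrunc_diff btrunc_bdiag btrunc_bunit bsupp_add bsupp_diff bsupp_bdiag
    bsupp_bunit fsupp_fid S u uw(2)
  define T where "T = mat_of_blocks s m (?J + ?U)"
  define T' where "T' = mat_of_blocks s m (?J - ?U)"
  have T: "T \<in> carrier_mat ?n ?n" "T' \<in> carrier_mat ?n ?n" by (simp_all add: T_def T'_def)
  have cT: "cblock s m T = ?J + ?U" "cblock s m T' = ?J - ?U"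
    unfolding T_def T'_def by (rule cblock_mat_of_blocks; intro triv)+
  have UU: "bmul m s ?U ?U = 0"
    using uw by (simp add: bmul_bunit_left) (auto simp: bunit_def fun_eq_iff)
  have JU: "bmul m s ?J ?J = ?J" "bmul m s ?J ?U = ?U" "bmul m s ?U ?J = ?U"
    by (intro bmul_bdiag_left bmul_bdiag_right triv)+
  have inv: "T * T' = 1\<^sub>m ?n" "T' * T = 1\<^sub>m ?n"
    by (rule cblock_inject[OF s_pos mult_carrier_mat[OF T] one_carrier_mat],
        simp add: cblock_mult[OF T] cblock_one cT bmul_add_left bmul_diff_right UU JU,
        rule cblock_inject[OF s_pos mult_carrier_mat[OF T(2,1)] one_carrier_mat],
        simp add: cblock_mult[OF T(2,1)] cblock_one cT bmul_diff_left bmul_add_right UU JU)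
  \<comment> \<open>Chosen so that X - I \<otimes> Y is the prescribed N.\<close>
  define X where "X = map (\<lambda>k. mat_of_blocks s m (bdiag m (fY k) + N k)) [0..<d]"
  have X: "X \<in> mat_tuples d ?n" by (auto simp: X_def mat_tuples_def)
  have suppY: "fsupp s s (fY k)" if "k < d" for k
    using carrier_Y[OF that] by (rule fsupp_fun_of_mat)
  have cX: "cblock s m (X ! k) = bdiag m (fY k) + N k" if "k < d" for k
    using that by (simp add: X_def) (intro cblock_mat_of_blocks triv supp trunc suppY; assumption)
  have cNX: "cN m X k = N k" if "k < d" for k
    unfolding cblock_centred[OF X Y that] cX[OF that] by (simp add: bdiag_def)
  have Xn: "X \<in> nilp s d Y ?n"
    using strict_upper_nilp[OF X] uw up cNX by auto
  let ?X' = "map (\<lambda>M. T * M * T') X"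
  have X': "?X' \<in> mat_tuples d ?n"
    using X T by (auto simp: mat_tuples_def)
  have cX': "cblock s m (?X' ! k) = bdiag m (fY k) + ?N' k" if k: "k < d" for k
  proof -
    let ?P = "bdiag m (fY k) + N k"
    have Xk: "X ! k \<in> carrier_mat ?n ?n" "length X = d" using X k by (auto simp: mat_tuples_def)
    have P: "btrunc m ?P" "bsupp s ?P"
      by (intro triv supp trunc suppY k)+
    have "cblock s m (?X' ! k) = bmul m s (bmul m s (?J + ?U) ?P) (?J - ?U)"
      using k Xk by (simp add: cblock_mult[OF mult_carrier_mat[OF T(1) Xk(1)] T(2)]
          cblock_mult[OF T(1) Xk(1)] cT cX)
    also have "\<dots> = bmul m s ?P ?J + bmul m s (bmul m s ?U ?P) ?J - bmul m s ?P ?U - bmul m s (bmul m s ?U ?P) ?U"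
      by (simp add: bmul_add_left[of _ _ ?J ?U] bmul_bdiag_left P bmul_diff_right
          bmul_add_left[of _ _ ?P "bmul m s ?U ?P"])
    also have "\<dots> = ?P + bmul m s ?U ?P - bmul m s ?P ?U - bmul m s (bmul m s ?U ?P) ?U"
      by (simp add: bmul_assoc bmul_bdiag_right P)
    finally have 1: "cblock s m (?X' ! k) = \<dots>" .
    have 2: "bmul m s (bmul m s ?U ?P) ?U = 0"
    proof -
      have "?P w u = 0" using uw up[OF k, of u w] by (simp add: bdiag_def)
      then show ?thesis using uw
        by (intro ext) (simp only: bmul_bunit_left bmul_bunit_right u, simp)
    qed
    have 3: "bmul m s ?U ?P = bunit u w (fmul s S (fY k)) + (\<lambda>i j. if i = u then fmul s S (N k w j) else 0)"
      using uw by (simp add: bmul_bunit_left) (rule ext, rule ext, auto simp: bdiag_def bunit_def fmul_add_right)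
    have 4: "bmul m s ?P ?U = bunit u w (fmul s (fY k) S) + (\<lambda>i j. if j = w then fmul s (N k i u) S else 0)"
      using u by (simp add: bmul_bunit_right) (rule ext, rule ext, auto simp: bdiag_def bunit_def fmul_add_left)
    show ?thesis
      unfolding 1 2 unfolding 3 4
      by (rule ext, rule ext) (auto simp: nc_conj_def bunit_def fcomm_def)
  qed
  have cNX': "cN m ?X' k = ?N' k" if "k < d" for k
    unfolding cblock_centred[OF X' Y that] cX'[OF that] by (simp add: bdiag_def)
  \<comment> \<open>The new entries lie at (u, w), in row u to the right of w, and in column w above
    u: all of them above the diagonal.\<close>
  have "?N' k i j = 0" if "k < d" "j \<le> i" for k i j
    using that uw up[OF that] up[OF that(1), of j w] up[OF that(1), of u i]
    by (auto simp: nc_conj_def bunit_def)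
  then have X'n: "?X' \<in> nilp s d Y ?n"
    using strict_upper_nilp[OF X'] uw cNX' by auto
  have lift: "blift d G (cN m X) = blift d G N" "blift d G (cN m ?X') = blift d G ?N'" for G
    by (simp_all add: blift_def cNX cNX')
  let ?F = "nc_series_eval s d Y f ?n X" and ?F' = "nc_series_eval s d Y f ?n ?X'"
  obtain v where v: "v = blift d fB N + bmul m L (blift d fA N) v"
    and F: "\<And>i j. i < m \<Longrightarrow> j < m \<Longrightarrow> fun_of_mat (block s ?F (i, j))
      = (if i = j then fD else 0) + fmul L fC (v i j)"
    using eval_solution[OF Xn, unfolded lift] by metis
  obtain v' where v': "v' = blift d fB ?N' + bmul m L (blift d fA ?N') v'"
    and F': "\<And>i j. i < m \<Longrightarrow> j < m \<Longrightarrow> fun_of_mat (block s ?F' (i, j))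
      = (if i = j then fD else 0) + fmul L fC (v' i j)"
    using eval_solution[OF X'n, unfolded lift] by metis
  have "?F' = T * ?F * T'"
    using nc Xn X'n T inv unfolding nc_function_iff by blast
  then have "?F' * T = T * ?F * (T' * T)"
    using assoc_mult_mat[OF mult_carrier_mat[OF T(1) eval_carrier] T(2,1)] by simp
  then have "?F' * T = T * ?F" using T eval_carrier[of ?n X] by (simp add: inv)
  then have "cblock s m (?F' * T) = cblock s m (T * ?F)" by simp
  then have "cblock s m ?F' + bmul m s (cblock s m ?F') ?U = cblock s m ?F + bmul m s ?U (cblock s m ?F)"
    unfolding cblock_mult[OF T(1) eval_carrier] cblock_mult[OF eval_carrier T(1)] cT
    by (simp add: bmul_add_left bmul_add_right bmul_bdiag_left bmul_bdiag_right btrunc_cblock bsupp_cblock)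
  then have *: "cblock s m ?F' i e + bmul m s (cblock s m ?F') ?U i e
      = cblock s m ?F i e + bmul m s ?U (cblock s m ?F) i e" for i e
    unfolding plus_fun_apply[symmetric] by simp
  show ?thesis
  proof (rule that[OF v v'], intro allI impI)
    fix i e assume "i < m" "e < m"
    then show "((if i = e then fD else 0) + fmul L fC (v i e))
        + (if i = u then fmul s S ((if w = e then fD else 0) + fmul L fC (v w e)) else 0)
      = ((if i = e then fD else 0) + fmul L fC (v' i e))
        + (if e = w then fmul s ((if i = u then fD else 0) + fmul L fC (v' i u)) S else 0)"
      using *[of i e, symmetric] uw u
      by (simp add: bmul_bunit_left bmul_bunit_right cblock_def F F' cong: if_cong)
  qed
qed

end

section \<open>Chains of links\<close>

lemma wchain_seq:
  assumes "a \<le> b" "\<And>i. a \<le> i \<Longrightarrow> i < b \<Longrightarrow> y i = fmul L (A (\<kappa> i) (Z i)) (y (Suc i))"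
  shows "y a = wchain L A (map \<kappa> [a..<b]) (map Z [a..<b]) (y b)"
  using assms(1)
proof (induction rule: inc_induct)
  case (step n)
  then show ?case using assms(2)[of n] by (simp add: upt_conv_Cons)
qed simp

lemma map_nth_segment: "map ((!) (as @ xs @ bs)) [length as..<length as + length xs] = xs"
  by (intro nth_equalityI) (auto simp: nth_append)

text \<open>Each piece of a row has at most one entry, so the block product collapses to one link;
  \<open>t \<le> e\<close> records that its target is among the e + 1 block indices.\<close>

lemma sum_fmul_link:
  "(\<Sum>q<Suc e. fmul L (if q = t \<and> P then M else 0) (y q)) = (if P \<and> t \<le> e then fmul L M (y t) else 0)"
proof (cases P)
  case True
  then have "(\<Sum>q<Suc e. fmul L (if q = t \<and> P then M else 0) (y q))
      = (\<Sum>q<Suc e. if q = t then fmul L M (y t) else 0)"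
    by (intro sum.cong) auto
  then show ?thesis using True by simp
qed simp

text \<open>
  The superdiagonal carries the two words \<open>\<kappa>\<^sub>0 \<dots> \<kappa>\<^bsub>p-1\<^esub>\<close> and \<open>\<kappa>\<^bsub>p+1\<^esub> \<dots> \<kappa>\<^bsub>e-1\<^esub>\<close> with their matrix
  arguments; the link at \<open>p\<close> is left open and is closed by the conjugation.
\<close>

definition chain_blocks ::
    "(nat \<Rightarrow> nat) \<Rightarrow> (nat \<Rightarrow> 'a::field fmat) \<Rightarrow> nat \<Rightarrow> nat \<Rightarrow> nat \<Rightarrow> 'a bmat" where
  "chain_blocks \<kappa> Z p e k = (\<lambda>i j. if j = Suc i \<and> i < e \<and> i \<noteq> p \<and> \<kappa> i = k then Z i else 0)"

context realized_series
begin

lemma blift_chain_blocks: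
  assumes G: "\<forall>k<d. flinear s L c (G k)" and \<kappa>: "\<forall>i<e. i \<noteq> p \<longrightarrow> \<kappa> i < d"
  shows "blift d G (chain_blocks \<kappa> Z p e) i j = (if j = Suc i \<and> i < e \<and> i \<noteq> p then G (\<kappa> i) (Z i) else 0)"
proof -
  have zero: "G k 0 = 0" if "k < d" for k
    by (rule flinear_zero[OF G[rule_format, OF that]])
  have "blift d G (chain_blocks \<kappa> Z p e) i j
      = (\<Sum>k<d. if k = \<kappa> i then (if j = Suc i \<and> i < e \<and> i \<noteq> p then G (\<kappa> i) (Z i) else 0) else 0)"
    unfolding blift_def chain_blocks_def by (intro sum.cong) (auto simp: zero)
  then show ?thesis using \<kappa> by simp
qed

text \<open>Besides the old links there are three kinds of entries: the closed link (p, p + 1), a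
  shortcut (p, p + 2) with S before the next argument, and a shortcut (p - 1, p + 1) with S behind
  the previous one. They become the commutator term, the term with S Z and the term with Z
  S.\<close>

lemma blift_nc_conj_chain_blocks:
  assumes G: "\<forall>k<d. flinear s L c (G k)" and \<kappa>: "\<forall>i<e. i \<noteq> p \<longrightarrow> \<kappa> i < d" and "p < e"
  shows "blift d G (nc_conj p (Suc p) S (chain_blocks \<kappa> Z p e)) i j
    = (if j = Suc i \<and> i < e \<and> i \<noteq> p then G (\<kappa> i) (Z i) else 0)
    + (if j = Suc p \<and> i = p then comm_sum s d fY G S else 0)
    + (if j = Suc (Suc p) \<and> i = p \<and> Suc p < e then G (\<kappa> (Suc p)) (fmul s S (Z (Suc p))) else 0)
    - (if j = Suc p \<and> Suc i = p then G (\<kappa> i) (fmul s (Z i) S) else 0)"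
proof -
  have zero: "G k 0 = 0" if "k < d" for k
    by (rule flinear_zero[OF G[rule_format, OF that]])
  let ?N = "chain_blocks \<kappa> Z p e"
  let ?b = "if j = Suc p \<and> i = p then comm_sum s d fY G S else 0"
  let ?c = "if j = Suc (Suc p) \<and> i = p \<and> Suc p < e then G (\<kappa> (Suc p)) (fmul s S (Z (Suc p))) else 0"
  let ?d = "if j = Suc p \<and> Suc i = p then G (\<kappa> i) (fmul s (Z i) S) else 0"
  have lin: "G k (nc_conj p (Suc p) S ?N k i j) = G k (?N k i j)
      + G k (if j = Suc p \<and> i = p then fcomm s S (fY k) else 0)
      + G k (if i = p then fmul s S (?N k (Suc p) j) else 0)
      - G k (if j = Suc p then fmul s (?N k i p) S else 0)" if "k < d" for k
  proof -
    have "nc_conj p (Suc p) S ?N k i j = ?N k i j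
        + (if j = Suc p \<and> i = p then fcomm s S (fY k) else 0)
        + (if i = p then fmul s S (?N k (Suc p) j) else 0)
        - (if j = Suc p then fmul s (?N k i p) S else 0)"
      by (simp add: nc_conj_def bunit_def conj_commute)
    then show ?thesis
      by (simp only: flinear_add[OF G[rule_format, OF that]] flinear_diff[OF G[rule_format, OF that]])
  qed
  have b: "(\<Sum>k<d. G k (if j = Suc p \<and> i = p then fcomm s S (fY k) else 0)) = ?b"
    unfolding comm_sum_def by (cases "j = Suc p \<and> i = p") (auto simp: zero)
  have "(\<Sum>k<d. G k (if i = p then fmul s S (?N k (Suc p) j) else 0))
      = (\<Sum>k<d. if k = \<kappa> (Suc p) then ?c else 0)"
    by (intro sum.cong) (auto simp: chain_blocks_def zero)
  then have c: "(\<Sum>k<d. G k (if i = p then fmul s S (?N k (Suc p) j) else 0)) = ?c"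
    using \<kappa> by simp
  have "(\<Sum>k<d. G k (if j = Suc p then fmul s (?N k i p) S else 0)) = (\<Sum>k<d. if k = \<kappa> i then ?d else 0)"
    using \<open>p < e\<close> by (intro sum.cong) (auto simp: chain_blocks_def zero)
  then have d: "(\<Sum>k<d. G k (if j = Suc p then fmul s (?N k i p) S else 0)) = ?d"
    using \<kappa> \<open>p < e\<close> by auto
  have "blift d G (nc_conj p (Suc p) S ?N) i j = blift d G ?N i j
      + (\<Sum>k<d. G k (if j = Suc p \<and> i = p then fcomm s S (fY k) else 0))
      + (\<Sum>k<d. G k (if i = p then fmul s S (?N k (Suc p) j) else 0))
      - (\<Sum>k<d. G k (if j = Suc p then fmul s (?N k i p) S else 0))"
    by (simp only: blift_def sum.distrib[symmetric] sum_subtractf[symmetric])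
      (intro sum.cong refl lin, simp)
  then show ?thesis unfolding b c d blift_chain_blocks[OF G \<kappa>] .
qed

text \<open>
  \<open>r\<close> is the last column of the solution before the conjugation, \<open>x\<close> the last column and \<open>l\<close> the column
  \<open>p\<close> of the solution after it.
\<close>

definition chain_solution ::
    "'a fmat \<Rightarrow> (nat \<Rightarrow> nat) \<Rightarrow> (nat \<Rightarrow> 'a fmat) \<Rightarrow> nat \<Rightarrow> nat
      \<Rightarrow> (nat \<Rightarrow> 'a fmat) \<Rightarrow> (nat \<Rightarrow> 'a fmat) \<Rightarrow> (nat \<Rightarrow> 'a fmat) \<Rightarrow> bool" where
  "chain_solution S \<kappa> Z p e r x l \<longleftrightarrow>
    (\<forall>i. p < i \<longrightarrow> i < e \<longrightarrow>
      r i = (if Suc i = e then fB (\<kappa> i) (Z i) else 0) + fmul L (fA (\<kappa> i) (Z i)) (r (Suc i))) \<and>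
    r e = 0 \<and>
    x p = (if Suc p = e then comm_sum s d fY fB S else 0) + fmul L (comm_sum s d fY fA S) (r (Suc p))
      + (if Suc p < e then (if Suc (Suc p) = e then fB (\<kappa> (Suc p)) (fmul s S (Z (Suc p))) else 0)
        + fmul L (fA (\<kappa> (Suc p)) (fmul s S (Z (Suc p)))) (r (Suc (Suc p))) else 0) \<and>
    (\<forall>i<p. x i = fmul L (fA (\<kappa> i) (Z i)) (x (Suc i))
      - (if Suc i = p then (if Suc p = e then fB (\<kappa> i) (fmul s (Z i) S) else 0)
        + fmul L (fA (\<kappa> i) (fmul s (Z i) S)) (r (Suc p)) else 0)) \<and>
    l p = 0 \<and>
    (\<forall>i<p. l i = (if Suc i = p then fB (\<kappa> i) (Z i) else 0) + fmul L (fA (\<kappa> i) (Z i)) (l (Suc i))) \<and>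
    (if p = 0 then fmul s S ((if Suc p = e then fD else 0) + fmul L fC (r (Suc p))) else 0)
      = fmul L fC (x 0) + (if Suc p = e then fmul s ((if p = 0 then fD else 0) + fmul L fC (l 0)) S else 0)"

lemma chain_solutionD:
  assumes "chain_solution S \<kappa> Z p e r x l"
  shows "p < i \<Longrightarrow> i < e \<Longrightarrow>
      r i = (if Suc i = e then fB (\<kappa> i) (Z i) else 0) + fmul L (fA (\<kappa> i) (Z i)) (r (Suc i))"
    and "r e = 0"
    and "x p = (if Suc p = e then comm_sum s d fY fB S else 0) + fmul L (comm_sum s d fY fA S) (r (Suc p))
      + (if Suc p < e then (if Suc (Suc p) = e then fB (\<kappa> (Suc p)) (fmul s S (Z (Suc p))) else 0)
        + fmul L (fA (\<kappa> (Suc p)) (fmul s S (Z (Suc p)))) (r (Suc (Suc p))) else 0)"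
    and "i < p \<Longrightarrow> x i = fmul L (fA (\<kappa> i) (Z i)) (x (Suc i))
      - (if Suc i = p then (if Suc p = e then fB (\<kappa> i) (fmul s (Z i) S) else 0)
        + fmul L (fA (\<kappa> i) (fmul s (Z i) S)) (r (Suc p)) else 0)"
    and "l p = 0"
    and "i < p \<Longrightarrow>
      l i = (if Suc i = p then fB (\<kappa> i) (Z i) else 0) + fmul L (fA (\<kappa> i) (Z i)) (l (Suc i))"
    and "(if p = 0 then fmul s S ((if Suc p = e then fD else 0) + fmul L fC (r (Suc p))) else 0)
      = fmul L fC (x 0) + (if Suc p = e then fmul s ((if p = 0 then fD else 0) + fmul L fC (l 0)) S else 0)"
  using assms unfolding chain_solution_def by blast+

text \<open>The chain has nodes 0, ..., e, and link i joins node i to node i + 1. The families are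
  columns of \<open>v\<close> and \<open>v'\<close>, their recursions are rows of the state
  equations, and the last clause of \<open>chain_solution\<close> is the (0, e) block of T f(X) =
  f(X') T.\<close>

lemma chain_identity:
  assumes nc: "nc_function d (nilp s d Y) (nc_series_eval s d Y f)" and "p < e"
    and \<kappa>: "\<forall>i<e. i \<noteq> p \<longrightarrow> \<kappa> i < d" and Z: "\<forall>i<e. i \<noteq> p \<longrightarrow> fsupp s s (Z i)"
    and S: "fsupp s s S"
  shows "\<exists>r x l. chain_solution S \<kappa> Z p e r x l"
proof -
  let ?N = "chain_blocks \<kappa> Z p e" and ?w = "Suc p"
  let ?N' = "nc_conj p ?w S ?N"
  have hyps: "\<forall>k<d. bsupp s (?N k)" "\<forall>k<d. btrunc (Suc e) (?N k)"
    "\<forall>k<d. \<forall>i j. j \<le> i \<longrightarrow> ?N k i j = 0"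
    using Z by (auto simp: chain_blocks_def bsupp_def btrunc_def)
  have pe: "p < ?w" "?w < Suc e" using \<open>p < e\<close> by auto
  obtain v v' where v: "v = blift d fB ?N + bmul (Suc e) L (blift d fA ?N) v"
    and v': "v' = blift d fB ?N' + bmul (Suc e) L (blift d fA ?N') v'"
    and id: "\<forall>i<Suc e. \<forall>j<Suc e.
      ((if i = j then fD else 0) + fmul L fC (v i j))
        + (if i = p then fmul s S ((if ?w = j then fD else 0) + fmul L fC (v ?w j)) else 0)
      = ((if i = j then fD else 0) + fmul L fC (v' i j))
        + (if j = ?w then fmul s ((if i = p then fD else 0) + fmul L fC (v' i p)) S else 0)"
    by (rule nc_conj_solution[OF nc hyps S pe])
  have rec: "v i j = (if j = Suc i \<and> i < e \<and> i \<noteq> p then fB (\<kappa> i) (Z i) else 0)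
      + (if i < e \<and> i \<noteq> p then fmul L (fA (\<kappa> i) (Z i)) (v (Suc i) j) else 0)" for i j
  proof -
    have "v i j = blift d fB ?N i j + bmul (Suc e) L (blift d fA ?N) v i j"
      using fun_cong[OF fun_cong[OF v, of i], of j] by simp
    then show ?thesis
      unfolding blift_chain_blocks[OF linB \<kappa>] bmul_def blift_chain_blocks[OF linA \<kappa>] sum_fmul_link
      by simp
  qed
  have rec': "v' i j = ((if j = Suc i \<and> i < e \<and> i \<noteq> p then fB (\<kappa> i) (Z i) else 0)
      + (if j = ?w \<and> i = p then comm_sum s d fY fB S else 0)
      + (if j = Suc ?w \<and> i = p \<and> ?w < e then fB (\<kappa> ?w) (fmul s S (Z ?w)) else 0)
      - (if j = ?w \<and> Suc i = p then fB (\<kappa> i) (fmul s (Z i) S) else 0))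
    + ((if i < e \<and> i \<noteq> p then fmul L (fA (\<kappa> i) (Z i)) (v' (Suc i) j) else 0)
      + (if i = p then fmul L (comm_sum s d fY fA S) (v' ?w j) else 0)
      + (if i = p \<and> ?w < e then fmul L (fA (\<kappa> ?w) (fmul s S (Z ?w))) (v' (Suc ?w) j) else 0)
      - (if Suc i = p then fmul L (fA (\<kappa> i) (fmul s (Z i) S)) (v' ?w j) else 0))" for i j
  proof -
    have "v' i j = blift d fB ?N' i j + bmul (Suc e) L (blift d fA ?N') v' i j"
      using fun_cong[OF fun_cong[OF v', of i], of j] by simp
    then show ?thesis
      unfolding blift_nc_conj_chain_blocks[OF linB \<kappa> \<open>p < e\<close>] bmul_def
        blift_nc_conj_chain_blocks[OF linA \<kappa> \<open>p < e\<close>]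
        fmul_add_left fmul_diff_left sum.distrib sum_subtractf sum_fmul_link
      using \<open>p < e\<close> by (simp add: Suc_le_eq)
  qed
  have v0: "v i e = 0" if "i \<le> p" for i
    using that
  proof (induction rule: inc_induct)
    case base
    show ?case using rec[of p e] \<open>p < e\<close> by simp
  next
    case (step n)
    then show ?case using rec[of n e] \<open>p < e\<close> by simp
  qed
  have ve: "v e e = 0" using rec[of e e] by simp
  have v'e: "v' e j = 0" if "j \<le> e" for j using rec'[of e j] \<open>p < e\<close> that by auto
  \<comment> \<open>Rows beyond p are untouched by the conjugation, hence the two solutions agree
    there.\<close>
  have right: "v' i e = v i e" if "p < i" "i \<le> e" for i
    using that(2,1)
  proof (induction rule: inc_induct)
    case base
    show ?case using ve v'e by simp
  next
    case (step n)
    then show ?case using rec[of n e] rec'[of n e] by simp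
  qed
  \<comment> \<open>All links lead forward, so nothing beyond node p returns to it.\<close>
  have left: "v' i p = 0" if "p < i" "i \<le> e" for i
    using that(2,1)
  proof (induction rule: inc_induct)
    case base
    show ?case using v'e \<open>p < e\<close> by simp
  next
    case (step n)
    then show ?case using rec'[of n p] by simp
  qed
  have "chain_solution S \<kappa> Z p e (\<lambda>i. v i e) (\<lambda>i. v' i e) (\<lambda>i. v' i p)"
    unfolding chain_solution_def
  proof (intro conjI allI impI)
    show "v i e = (if Suc i = e then fB (\<kappa> i) (Z i) else 0) + fmul L (fA (\<kappa> i) (Z i)) (v (Suc i) e)"
      if "p < i" "i < e" for i using rec[of i e] that by auto
    show "v e e = 0" by (rule ve)
    show "v' p e = (if Suc p = e then comm_sum s d fY fB S else 0) + fmul L (comm_sum s d fY fA S) (v ?w e)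
      + (if ?w < e then (if Suc ?w = e then fB (\<kappa> ?w) (fmul s S (Z ?w)) else 0)
        + fmul L (fA (\<kappa> ?w) (fmul s S (Z ?w))) (v (Suc ?w) e) else 0)"
      using rec'[of p e] right[of ?w] right[of "Suc ?w"] \<open>p < e\<close> by auto
    show "v' i e = fmul L (fA (\<kappa> i) (Z i)) (v' (Suc i) e)
      - (if Suc i = p then (if Suc p = e then fB (\<kappa> i) (fmul s (Z i) S) else 0)
        + fmul L (fA (\<kappa> i) (fmul s (Z i) S)) (v ?w e) else 0)" if "i < p" for i
      using rec'[of i e] right[of ?w] \<open>p < e\<close> that by auto
    show "v' p p = 0" using rec'[of p p] left[of ?w] left[of "Suc ?w"] \<open>p < e\<close> by auto
    show "v' i p = (if Suc i = p then fB (\<kappa> i) (Z i) else 0) + fmul L (fA (\<kappa> i) (Z i)) (v' (Suc i) p)"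
      if "i < p" for i
      using rec'[of i p] left[of ?w] \<open>p < e\<close> that by auto
    \<comment> \<open>U F has a row 0 only for p = 0, and F' U a column e only for p + 1 = e; this
      is the origin of the two case distinctions.\<close>
    show "(if p = 0 then fmul s S ((if ?w = e then fD else 0) + fmul L fC (v ?w e)) else 0)
      = fmul L fC (v' 0 e) + (if ?w = e then fmul s ((if p = 0 then fD else 0) + fmul L fC (v' 0 p)) S else 0)"
      using id[rule_format, of 0 e] v0[of 0] \<open>p < e\<close> by (auto split: if_splits)
  qed
  then show ?thesis by blast
qed

end

section \<open>Cancelling words\<close>

lemma wchain_add: "wchain L A \<omega> Ps (x + y) = wchain L A \<omega> Ps x + wchain L A \<omega> Ps y"
  by (induction L A \<omega> Ps x rule: wchain.induct) (simp_all only: wchain.simps fmul_add_right)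

lemma wchain_fmul: "fmul n (wchain L A \<omega> Ps y) S = wchain L A \<omega> Ps (fmul n y S)"
  by (induction L A \<omega> Ps y rule: wchain.induct) (simp_all add: fmul_assoc)

text \<open>Needed to pass from reachable columns to their span.\<close>

lemma mat_kernel_submodule:
  assumes M: "(M :: 'a::field mat) \<in> carrier_mat r n"
  shows "LinearCombinations.submodule class_ring (mat_kernel M) (module_vec TYPE('a) n)"
proof -
  interpret vec_space "TYPE('a)" n .
  show ?thesis
  proof (unfold_locales)
    show "mat_kernel M \<subseteq> carrier V" using mat_kernel_carrier[OF M] by simp
    show "\<zero>\<^bsub>V\<^esub> \<in> mat_kernel M" using M by (intro mat_kernelI[OF M]) auto
    fix v w assume vw: "v \<in> mat_kernel M" "w \<in> mat_kernel M"
    have "M *\<^sub>v (v + w) = M *\<^sub>v v + M *\<^sub>v w"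
      using mult_add_distrib_mat_vec[OF M] mat_kernelD(1)[OF M] vw by blast
    then show "v \<oplus>\<^bsub>V\<^esub> w \<in> mat_kernel M"
      using mat_kernelD[OF M vw(1)] mat_kernelD[OF M vw(2)] by (intro mat_kernelI[OF M]) auto
  next
    fix c :: 'a and v assume "c \<in> carrier class_ring" "v \<in> mat_kernel M"
    then show "c \<odot>\<^bsub>V\<^esub> v \<in> mat_kernel M" using mat_kernel_smult[OF M] by simp
  qed
qed

lemma mat_zero_if_mult_vec_zero:
  assumes M: "(M :: 'a::field mat) \<in> carrier_mat r n"
    and zero: "\<And>v. v \<in> carrier_vec n \<Longrightarrow> M *\<^sub>v v = 0\<^sub>v r"
  shows "M = 0\<^sub>m r n"
proof (rule eq_matI)
  fix i j assume ij: "i < dim_row (0\<^sub>m r n :: 'a mat)" "j < dim_col (0\<^sub>m r n :: 'a mat)"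
  have "(M *\<^sub>v unit_vec n j) $ i = 0" using ij by (simp add: zero)
  then show "M $$ (i, j) = 0\<^sub>m r n $$ (i, j)" using M ij by auto
qed (use M in auto)

context realized_series
begin

definition word_data :: "nat list \<Rightarrow> 'a fmat list \<Rightarrow> bool" where
  "word_data \<omega> Ps \<longleftrightarrow> \<omega> \<in> words d \<and> length Ps = length \<omega> \<and> (\<forall>P\<in>set Ps. fsupp s s P)"

lemma word_data_tuples:
  "\<omega> \<in> words d \<Longrightarrow> Zs \<in> mat_tuples (length \<omega>) s \<Longrightarrow> word_data \<omega> (map fun_of_mat Zs)"
  by (auto simp: word_data_def mat_tuples_def intro: fsupp_fun_of_mat)

text \<open>By hypothesis every column of \<open>y\<close> lies in the kernel of C times any product
  of the A_k; observability leaves only the zero column.\<close>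

lemma observable_cancel:
  assumes obs: "observable s d L C A" and y: "fsupp L c y"
    and zero: "\<And>\<omega> Ps. word_data \<omega> Ps \<Longrightarrow> fmul L fC (wchain L fA \<omega> Ps y) = 0"
  shows "y = 0"
proof -
  define M where "M = mat_of_fun L c y"
  have M: "M \<in> carrier_mat L c" and yM: "fun_of_mat M = y"
    using y by (simp_all add: M_def fun_of_mat_of_fun)
  have col0: "col M j = 0\<^sub>v L" if "j < c" for j
  proof -
    have "col M j \<in> mat_kernel (C * word_prod L A \<omega> Zs)"
      if w: "\<omega> \<in> words d" "Zs \<in> mat_tuples (length \<omega>) s" for \<omega> Zs
    proof -
      note W = word_prod_carrier[OF w]
      have "fun_of_mat (C * word_prod L A \<omega> Zs * M) = fmul L fC (wchain L fA \<omega> (map fun_of_mat Zs) y)"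
        unfolding yM[symmetric] fun_of_mat_word_prod[OF w M, symmetric] assoc_mult_mat[OF carrier_C W M]
        by (rule fun_of_mat_mult[OF carrier_C mult_carrier_mat[OF W M]])
      also have "\<dots> = fun_of_mat (0\<^sub>m s c)"
        using zero[OF word_data_tuples[OF w]] by (simp add: fun_of_mat_zero)
      finally have "C * word_prod L A \<omega> Zs * M = 0\<^sub>m s c"
        using mult_carrier_mat[OF mult_carrier_mat[OF carrier_C W] M]
        by (subst (asm) fun_of_mat_inject[of _ s c]) auto
      then have "(C * word_prod L A \<omega> Zs) *\<^sub>v col M j = 0\<^sub>v s"
        using col_mult2[OF mult_carrier_mat[OF carrier_C W] M \<open>j < c\<close>] \<open>j < c\<close> by simp
      then show ?thesis
        using M \<open>j < c\<close> by (intro mat_kernelI[OF mult_carrier_mat[OF carrier_C W]]) auto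
    qed
    then have "col M j \<in> \<Inter> {mat_kernel (C * word_prod L A \<omega> Xs) | \<omega> Xs.
          \<omega> \<in> words d \<and> Xs \<in> mat_tuples (length \<omega>) s}" by blast
    then show ?thesis using obs unfolding observable_def by blast
  qed
  have "M = 0\<^sub>m L c"
  proof (rule eq_matI)
    fix i j assume "i < dim_row (0\<^sub>m L c :: 'a mat)" "j < dim_col (0\<^sub>m L c :: 'a mat)"
    then have ij: "i < L" "j < c" by auto
    have "col M j $ i = 0" using col0[OF ij(2)] ij by simp
    then show "M $$ (i, j) = 0\<^sub>m L c $$ (i, j)" using M ij by auto
  qed (use M in auto)
  then show ?thesis using yM by (simp add: fun_of_mat_zero)
qed

text \<open>The kernel of \<open>y\<close> is a subspace containing the column spaces of all
  reachable matrices. Controllability makes it the whole space, so \<open>y\<close> kills every unit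
  vector.\<close>

lemma controllable_cancel:
  assumes con: "controllable s d L A B" and y: "fsupp r L y"
    and zero: "\<And>\<omega> Ps k P. word_data \<omega> Ps \<Longrightarrow> k < d \<Longrightarrow> fsupp s s P \<Longrightarrow>
      fmul L y (wchain L fA \<omega> Ps (fB k P)) = 0"
  shows "y = 0"
proof -
  define M where "M = mat_of_fun r L y"
  have M: "M \<in> carrier_mat r L" and yM: "fun_of_mat M = y"
    using y by (simp_all add: M_def fun_of_mat_of_fun)
  interpret vec_space "TYPE('a)" L .
  have sub: "col_space (word_prod L A \<omega> Xs * B k Z) \<subseteq> mat_kernel M"
    if w: "\<omega> \<in> words d" "Xs \<in> mat_tuples (length \<omega>) s" and k: "k < d" "Z \<in> carrier_mat s s" for \<omega> Xs k Z
  proof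
    fix v assume v: "v \<in> col_space (word_prod L A \<omega> Xs * B k Z)"
    note W = word_prod_carrier[OF w] and Bk = carrier_B[OF k]
    note G = mult_carrier_mat[OF W Bk]
    obtain x where x: "x \<in> carrier_vec s" "v = (word_prod L A \<omega> Xs * B k Z) *\<^sub>v x"
      using v G unfolding col_space_eq[OF G] by auto
    have "fun_of_mat (M * (word_prod L A \<omega> Xs * B k Z))
        = fmul L y (wchain L fA \<omega> (map fun_of_mat Xs) (fB k (fun_of_mat Z)))"
      unfolding yM[symmetric] fmap_fun_of_mat[OF k(2)] fun_of_mat_word_prod[OF w Bk, symmetric]
      by (rule fun_of_mat_mult[OF M G])
    also have "\<dots> = fun_of_mat (0\<^sub>m r s)"
      using zero[OF word_data_tuples[OF w] k(1) fsupp_fun_of_mat[OF k(2)]] by (simp add: fun_of_mat_zero)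
    finally have MG: "M * (word_prod L A \<omega> Xs * B k Z) = 0\<^sub>m r s"
      using mult_carrier_mat[OF M G] by (subst (asm) fun_of_mat_inject[of _ r s]) auto
    have "M *\<^sub>v v = (M * (word_prod L A \<omega> Xs * B k Z)) *\<^sub>v x"
      unfolding x(2) by (rule assoc_mult_mat_vec[OF M G x(1), symmetric])
    then have "M *\<^sub>v v = 0\<^sub>v r" using x(1) by (auto simp: MG intro!: eq_vecI)
    then show "v \<in> mat_kernel M"
      using x G by (intro mat_kernelI[OF M]) (auto intro: mult_mat_vec_carrier)
  qed
  have "span (\<Union> {col_space (word_prod L A \<omega> Xs * B k Z) | \<omega> Xs k Z.
             \<omega> \<in> words d \<and> Xs \<in> mat_tuples (length \<omega>) s \<and> k < d \<and> Z \<in> carrier_mat s s}) \<subseteq> mat_kernel M"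
    by (rule span_is_subset[OF _ mat_kernel_submodule[OF M]]) (use sub in blast)
  then have "carrier_vec L \<subseteq> mat_kernel M" using con by (simp only: controllable_def)
  then have "M = 0\<^sub>m r L"
    by (intro mat_zero_if_mult_vec_zero[OF M]) (auto dest: mat_kernelD(2)[OF M])
  then show ?thesis using yM by (simp add: fun_of_mat_zero)
qed

text \<open>
  The maps \<open>Z \<mapsto> B\<^sub>j(Z)\<close> and \<open>Z \<mapsto> A\<^sub>j(Z) y\<close> with \<open>y\<close> reachable: the two ways in which a nonempty
  right word depends on its first argument.
\<close>

definition right_map :: "(nat \<Rightarrow> 'a fmat \<Rightarrow> 'a fmat) \<Rightarrow> bool" where
  "right_map H \<longleftrightarrow> H = fB \<or> (\<exists>\<omega> Ps k P. word_data \<omega> Ps \<and> k < d \<and> fsupp s s P \<and>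
     H = (\<lambda>j Z. fmul L (fA j Z) (wchain L fA \<omega> Ps (fB k P))))"

lemma fsupp_fA: "k < d \<Longrightarrow> fsupp L L (fA k P)"
  using linA flinear_supp by blast

lemma fsupp_fB: "k < d \<Longrightarrow> fsupp L s (fB k P)"
  using linB flinear_supp by blast

lemma fsupp_wchain:
  "word_data \<omega> Ps \<Longrightarrow> fsupp L c y \<Longrightarrow> fsupp L c (wchain L fA \<omega> Ps y)"
proof (induction \<omega> arbitrary: Ps)
  case (Cons k \<omega>)
  then obtain P Ps' where "Ps = P # Ps'" by (cases Ps) (auto simp: word_data_def)
  with Cons show ?case by (auto simp: word_data_def words_def intro!: fsupp_fmul fsupp_fA)
qed simp

lemma fsupp_right_map: "right_map H \<Longrightarrow> j < d \<Longrightarrow> fsupp L s (H j Z)"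
  unfolding right_map_def by (auto intro!: fsupp_fB fsupp_fA fsupp_fmul fsupp_wchain)

text \<open>\<omega> is the word left of the open link, and \<open>H j Z\<close> is the evaluated
  word to its right. \<open>x\<close> starts at the link with the commutator term and the term with
  S Z, and picks up the term with Z S one step earlier in the chain.\<close>

lemma right_identity:
  assumes nc: "nc_function d (nilp s d Y) (nc_series_eval s d Y f)"
    and H: "right_map H" and w: "word_data \<omega> Ps" and j: "j < d" and Z: "fsupp s s Z" and S: "fsupp s s S"
  obtains x where
    "x (length \<omega>) = fmul L (comm_sum s d fY fA S) (H j Z) + H j (fmul s S Z)"
    "\<forall>i<length \<omega>. x i = fmul L (fA (\<omega> ! i) (Ps ! i)) (x (Suc i))
      - (if Suc i = length \<omega> then fmul L (fA (\<omega> ! i) (fmul s (Ps ! i) S)) (H j Z) else 0)"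
    "(if length \<omega> = 0 then fmul s S (fmul L fC (H j Z)) else 0) = fmul L fC (x 0)"
  using H unfolding right_map_def
proof (elim disjE exE conjE)
  assume H: "H = fB"
  let ?p = "length \<omega>"
  \<comment> \<open>Position p belongs to the open link: the letter and the argument 0 stored there
    are placeholders that \<open>chain_blocks\<close> masks out.\<close>
  let ?\<kappa> = "(!) (\<omega> @ [0, j])" and ?Z = "(!) (Ps @ [0, Z])"
  have len: "length Ps = ?p" using w by (simp add: word_data_def)
  have \<kappa>: "\<forall>i<?p + 2. i \<noteq> ?p \<longrightarrow> ?\<kappa> i < d"
    using w j by (auto simp: word_data_def words_def nth_append nth_Cons' subset_iff)
  have Zs: "\<forall>i<?p + 2. i \<noteq> ?p \<longrightarrow> fsupp s s (?Z i)"
    using w Z by (auto simp: word_data_def nth_append nth_Cons')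
  obtain r x l where sol: "chain_solution S ?\<kappa> ?Z ?p (?p + 2) r x l"
    using chain_identity[OF nc _ \<kappa> Zs S] by auto
  note r = chain_solutionD(1,2)[OF sol] and x = chain_solutionD(3,4)[OF sol] and id = chain_solutionD(7)[OF sol]
  have 1: "?\<kappa> (Suc ?p) = j" "?Z (Suc ?p) = Z" using len by (simp_all add: nth_append)
  have 2: "r (Suc ?p) = fB j Z" using r(1)[of "Suc ?p"] r(2) 1 by simp
  show ?thesis
  proof (rule that[of x])
    show "x ?p = fmul L (comm_sum s d fY fA S) (H j Z) + H j (fmul s S Z)"
      using x(1) 1 2 r(2) by (simp add: H)
    show "\<forall>i<?p. x i = fmul L (fA (\<omega> ! i) (Ps ! i)) (x (Suc i))
      - (if Suc i = ?p then fmul L (fA (\<omega> ! i) (fmul s (Ps ! i) S)) (H j Z) else 0)"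
      using x(2) 2 len by (auto simp: H nth_append)
    show "(if ?p = 0 then fmul s S (fmul L fC (H j Z)) else 0) = fmul L fC (x 0)"
      using id 2 by (cases "?p = 0") (simp_all add: H)
  qed
next
  fix \<omega>' Ps' k P
  assume w': "word_data \<omega>' Ps'" and k: "k < d" and P: "fsupp s s P"
    and H: "H = (\<lambda>j Z. fmul L (fA j Z) (wchain L fA \<omega>' Ps' (fB k P)))"
  let ?p = "length \<omega>"
  \<comment> \<open>Beyond the p links of \<omega> come the open link, the one for (j, Z), those of
    \<omega>' and the final one for (k, P).\<close>
  let ?e = "?p + length \<omega>' + 3"
  let ?\<kappa> = "(!) (\<omega> @ 0 # j # \<omega>' @ [k])" and ?Z = "(!) (Ps @ 0 # Z # Ps' @ [P])"
  have len: "length Ps = ?p" "length Ps' = length \<omega>'" using w w' by (simp_all add: word_data_def)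
  have "?\<kappa> i < d \<and> fsupp s s (?Z i)" if i: "i < ?e" "i \<noteq> ?p" for i
  proof -
    consider "i < ?p" | "i = Suc ?p" | t where "i = ?p + 2 + t" "t < length \<omega>'" | "i = ?p + 2 + length \<omega>'"
    proof -
      have "i < ?p \<or> i = Suc ?p \<or> (\<exists>t<length \<omega>'. i = ?p + 2 + t) \<or> i = ?p + 2 + length \<omega>'"
        using i by presburger
      then show ?thesis using that by blast
    qed
    then show ?thesis
      using w w' j Z k P len by cases (auto simp: word_data_def words_def nth_append subset_iff)
  qed
  then have \<kappa>: "\<forall>i<?e. i \<noteq> ?p \<longrightarrow> ?\<kappa> i < d" and Zs: "\<forall>i<?e. i \<noteq> ?p \<longrightarrow> fsupp s s (?Z i)" by blast+
  obtain r x l where sol: "chain_solution S ?\<kappa> ?Z ?p ?e r x l"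
    using chain_identity[OF nc _ \<kappa> Zs S] by auto
  note r = chain_solutionD(1,2)[OF sol] and x = chain_solutionD(3,4)[OF sol] and id = chain_solutionD(7)[OF sol]
  let ?a = "?p + 2" and ?b = "?p + 2 + length \<omega>'"
  have "?\<kappa> ?b = k" "?Z ?b = P" using len by (simp_all add: nth_append)
  then have rb: "r ?b = fB k P" using r(1)[of ?b] r(2) by (simp add: numeral_3_eq_3)
  \<comment> \<open>From node p + 2 on, the recursion of \<open>r\<close> spells out the right word
    up to its final B.\<close>
  have "r ?a = wchain L fA (map ?\<kappa> [?a..<?b]) (map ?Z [?a..<?b]) (r ?b)"
  proof (rule wchain_seq)
    fix i assume "?a \<le> i" "i < ?b"
    then show "r i = fmul L (fA (?\<kappa> i) (?Z i)) (r (Suc i))" using r(1)[of i] by simp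
  qed simp
  moreover have "map ?\<kappa> [?a..<?b] = \<omega>'"
    using map_nth_segment[of "\<omega> @ [0, j]" \<omega>' "[k]"] by (simp add: add.commute add.left_commute)
  moreover have "map ?Z [?a..<?b] = Ps'"
    using map_nth_segment[of "Ps @ [0, Z]" Ps' "[P]"] len by (simp add: add.commute add.left_commute)
  ultimately have "r ?a = wchain L fA \<omega>' Ps' (fB k P)" by (simp only: rb)
  then have ra: "r (Suc (Suc ?p)) = wchain L fA \<omega>' Ps' (fB k P)" by (simp add: numeral_2_eq_2)
  have 1: "?\<kappa> (Suc ?p) = j" "?Z (Suc ?p) = Z" using len by (simp_all add: nth_append)
  have 2: "r (Suc ?p) = H j Z" using r(1)[of "Suc ?p"] 1 ra by (simp add: H)
  show ?thesis
  proof (rule that[of x])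
    show "x ?p = fmul L (comm_sum s d fY fA S) (H j Z) + H j (fmul s S Z)"
      using x(1) 1 2 ra by (simp add: H)
    show "\<forall>i<?p. x i = fmul L (fA (\<omega> ! i) (Ps ! i)) (x (Suc i))
      - (if Suc i = ?p then fmul L (fA (\<omega> ! i) (fmul s (Ps ! i) S)) (H j Z) else 0)"
      using x(2) 2 len by (auto simp: nth_append)
    show "(if ?p = 0 then fmul s S (fmul L fC (H j Z)) else 0) = fmul L fC (x 0)"
      using id 2 by (cases "?p = 0") simp_all
  qed
qed

text \<open>Here the open link is the last one, e = p + 1. Closing it produces the sum of the
  B_k([S, Y_k]), and f(X') T also contributes the (0, p) block of f(X') times S, which the family
  \<open>l\<close> describes.\<close>

lemma end_identity:
  assumes nc: "nc_function d (nilp s d Y) (nc_series_eval s d Y f)"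
    and w: "word_data \<omega> Ps" and S: "fsupp s s S"
  obtains x l where
    "x (length \<omega>) = comm_sum s d fY fB S" "l (length \<omega>) = 0"
    "\<forall>i<length \<omega>. x i = fmul L (fA (\<omega> ! i) (Ps ! i)) (x (Suc i))
      - (if Suc i = length \<omega> then fB (\<omega> ! i) (fmul s (Ps ! i) S) else 0)"
    "\<forall>i<length \<omega>. l i = (if Suc i = length \<omega> then fB (\<omega> ! i) (Ps ! i) else 0)
      + fmul L (fA (\<omega> ! i) (Ps ! i)) (l (Suc i))"
    "(if length \<omega> = 0 then fmul s S fD else 0)
      = fmul L fC (x 0) + fmul s ((if length \<omega> = 0 then fD else 0) + fmul L fC (l 0)) S"
proof -
  let ?p = "length \<omega>"
  let ?\<kappa> = "(!) \<omega>" and ?Z = "(!) Ps"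
  have \<kappa>: "\<forall>i<Suc ?p. i \<noteq> ?p \<longrightarrow> ?\<kappa> i < d" and Zs: "\<forall>i<Suc ?p. i \<noteq> ?p \<longrightarrow> fsupp s s (?Z i)"
    using w by (auto simp: word_data_def words_def less_Suc_eq subset_iff)
  obtain r x l where sol: "chain_solution S ?\<kappa> ?Z ?p (Suc ?p) r x l"
    using chain_identity[OF nc _ \<kappa> Zs S] by auto
  note r = chain_solutionD(2)[OF sol] and x = chain_solutionD(3,4)[OF sol]
    and l = chain_solutionD(5,6)[OF sol] and id = chain_solutionD(7)[OF sol]
  show ?thesis
  proof (rule that[of x l])
    show "x ?p = comm_sum s d fY fB S" using x(1) r by simp
    show "\<forall>i<?p. x i = fmul L (fA (\<omega> ! i) (Ps ! i)) (x (Suc i))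
      - (if Suc i = ?p then fB (\<omega> ! i) (fmul s (Ps ! i) S) else 0)"
      using x(2) r by simp
    show "\<forall>i<?p. l i = (if Suc i = ?p then fB (\<omega> ! i) (Ps ! i) else 0)
      + fmul L (fA (\<omega> ! i) (Ps ! i)) (l (Suc i))"
      using l(2) by blast
    show "(if ?p = 0 then fmul s S fD else 0)
      = fmul L fC (x 0) + fmul s ((if ?p = 0 then fD else 0) + fmul L fC (l 0)) S"
      using id r by (cases "?p = 0") simp_all
  qed (rule l(1))
qed

end

section \<open>The equations\<close>

lemma fsupp_iff_fun_of_mat: "fsupp r c S \<longleftrightarrow> (\<exists>M\<in>carrier_mat r c. S = fun_of_mat M)"
  by (metis fsupp_fun_of_mat fun_of_mat_of_fun mat_of_fun_carrier)

lemma mat_eq_iff_fun_of_mat: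
  "M \<in> carrier_mat r c \<Longrightarrow> N \<in> carrier_mat r c \<Longrightarrow> M = N \<longleftrightarrow> fun_of_mat M = fun_of_mat N"
  using fun_of_mat_inject by blast

context realized_series
begin

text \<open>The correction \<open>e\<close> may occur at the last step only; all steps before it
  unroll to the word \<omega>.\<close>

lemma wchain_snoc_step:
  assumes w: "word_data \<omega> Ps"
    and x: "\<forall>i<length (\<omega> @ [k]). x i = fmul L (fA ((\<omega> @ [k]) ! i) ((Ps @ [P]) ! i)) (x (Suc i)) + e i"
    and e: "\<And>i. i < length \<omega> \<Longrightarrow> e i = 0"
  shows "x 0 = wchain L fA \<omega> Ps (x (length \<omega>))"
    and "x (length \<omega>) = fmul L (fA k P) (x (Suc (length \<omega>))) + e (length \<omega>)"
proof -
  have len: "length Ps = length \<omega>" using w by (simp add: word_data_def)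
  have "x 0 = wchain L fA (map ((!) \<omega>) [0..<length \<omega>]) (map ((!) Ps) [0..<length \<omega>]) (x (length \<omega>))"
  proof (rule wchain_seq)
    fix i assume "i < length \<omega>"
    then show "x i = fmul L (fA (\<omega> ! i) (Ps ! i)) (x (Suc i))"
      using x[rule_format, of i] e[of i] len by (simp add: nth_append)
  qed simp
  moreover have "map ((!) Ps) [0..<length \<omega>] = Ps" using len map_nth[of Ps] by simp
  ultimately show "x 0 = wchain L fA \<omega> Ps (x (length \<omega>))" by (simp only: map_nth)
  show "x (length \<omega>) = fmul L (fA k P) (x (Suc (length \<omega>))) + e (length \<omega>)"
    using x[rule_format, of "length \<omega>"] len by (simp add: nth_append)
qed

lemma word_data_snoc:
  "word_data \<omega> Ps \<Longrightarrow> k < d \<Longrightarrow> fsupp s s P \<Longrightarrow> word_data (\<omega> @ [k]) (Ps @ [P])"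
  by (auto simp: word_data_def words_def)

lemma fsupp_comm_sum:
  "(\<And>k P. k < d \<Longrightarrow> fsupp L c (G k P)) \<Longrightarrow> fsupp L c (comm_sum s d fY G S)"
  unfolding comm_sum_def by (rule fsupp_sum) simp

text \<open>The shortest chain: the open link is the only one.\<close>

lemma nc_imp_constant_eqs:
  assumes nc: "nc_function d (nilp s d Y) (nc_series_eval s d Y f)"
  shows constant_eqs
  unfolding constant_eqs_def
proof (intro allI impI)
  fix S :: "'a fmat" assume S: "fsupp s s S"
  have "word_data [] []" by (simp add: word_data_def words_def)
  from end_identity[OF nc this S] show "fmul s S fD - fmul s fD S = fmul L fC (comm_sum s d fY fB S)"
    by (auto simp: algebra_simps)
qed

text \<open>With the word \<omega> @ [k] before an open last link, \<open>x\<close> and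
  \<open>l\<close> unroll to the same word \<omega> standing between C and \<open>?y\<close>.
  Observability removes it.\<close>

lemma nc_imp_input_eqs:
  assumes nc: "nc_function d (nilp s d Y) (nc_series_eval s d Y f)" and obs: "observable s d L C A"
  shows input_eqs
  unfolding input_eqs_def
proof (intro allI impI)
  fix S Z :: "'a fmat" and k assume k: "k < d" and S: "fsupp s s S" and Z: "fsupp s s Z"
  let ?\<beta> = "comm_sum s d fY fB S"
  let ?y = "fmul L (fA k Z) ?\<beta> - fB k (fmul s Z S) + fmul s (fB k Z) S"
  have "?y = 0"
  proof (rule observable_cancel[OF obs])
    show "fsupp L s ?y"
      by (intro fsupp_add fsupp_diff fsupp_fmul fsupp_fA fsupp_fB fsupp_comm_sum k S)
    fix \<omega> Ps assume w: "word_data \<omega> Ps"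
    let ?\<omega> = "\<omega> @ [k]" and ?Ps = "Ps @ [Z]" and ?n = "length \<omega>"
    obtain x l where xl: "x (length ?\<omega>) = ?\<beta>" "l (length ?\<omega>) = 0"
      and x: "\<forall>i<length ?\<omega>. x i = fmul L (fA (?\<omega> ! i) (?Ps ! i)) (x (Suc i))
        - (if Suc i = length ?\<omega> then fB (?\<omega> ! i) (fmul s (?Ps ! i) S) else 0)"
      and l: "\<forall>i<length ?\<omega>. l i = (if Suc i = length ?\<omega> then fB (?\<omega> ! i) (?Ps ! i) else 0)
        + fmul L (fA (?\<omega> ! i) (?Ps ! i)) (l (Suc i))"
      and id: "(if length ?\<omega> = 0 then fmul s S fD else 0)
        = fmul L fC (x 0) + fmul s ((if length ?\<omega> = 0 then fD else 0) + fmul L fC (l 0)) S"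
      by (rule end_identity[OF nc word_data_snoc[OF w k Z] S])
    have len: "length Ps = ?n" using w by (simp add: word_data_def)
    have x': "\<forall>i<length ?\<omega>. x i = fmul L (fA (?\<omega> ! i) (?Ps ! i)) (x (Suc i))
        + (- (if Suc i = length ?\<omega> then fB (?\<omega> ! i) (fmul s (?Ps ! i) S) else 0))"
      using x by simp
    have l': "\<forall>i<length ?\<omega>. l i = fmul L (fA (?\<omega> ! i) (?Ps ! i)) (l (Suc i))
        + (if Suc i = length ?\<omega> then fB (?\<omega> ! i) (?Ps ! i) else 0)"
      using l by (simp add: add.commute)
    have xs: "x 0 = wchain L fA \<omega> Ps (x ?n)" "x ?n = fmul L (fA k Z) ?\<beta> - fB k (fmul s Z S)"
      using wchain_snoc_step[OF w x'] xl len by (simp_all add: nth_append)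
    have ls: "l 0 = wchain L fA \<omega> Ps (l ?n)" "l ?n = fB k Z"
      using wchain_snoc_step[OF w l'] xl len by (simp_all add: nth_append)
    have "0 = fmul L fC (x 0) + fmul s (fmul L fC (l 0)) S" using id by simp
    then show "fmul L fC (wchain L fA \<omega> Ps ?y) = 0"
      unfolding xs(1) ls(1) by (simp add: xs(2) ls(2) wchain_add fmul_add_right fmul_assoc wchain_fmul)
  qed
  then show "fB k (fmul s Z S) - fmul s (fB k Z) S = fmul L (fA k Z) ?\<beta>"
    by (simp add: algebra_simps)
qed

text \<open>With no letter on the left, C stands directly before the open link, and S C arises
  because U acts on row 0.\<close>

lemma nc_imp_output_right:
  assumes nc: "nc_function d (nilp s d Y) (nc_series_eval s d Y f)"
    and H: "right_map H" and j: "j < d" and Z: "fsupp s s Z" and S: "fsupp s s S"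
  shows "fmul s S (fmul L fC (H j Z)) - fmul L fC (H j (fmul s S Z))
    = fmul L fC (fmul L (comm_sum s d fY fA S) (H j Z))"
proof -
  have "word_data [] []" by (simp add: word_data_def words_def)
  from right_identity[OF nc H this j Z S] obtain x :: "nat \<Rightarrow> 'a fmat" where
    "x 0 = fmul L (comm_sum s d fY fA S) (H j Z) + H j (fmul s S Z)"
    "fmul s S (fmul L fC (H j Z)) = fmul L fC (x 0)" by auto
  then show ?thesis by (simp add: fmul_add_right)
qed

text \<open>A letter i precedes the open link, and the arbitrary word between C and this letter is
  cancelled by observability.\<close>

lemma nc_imp_inner_right:
  assumes nc: "nc_function d (nilp s d Y) (nc_series_eval s d Y f)" and obs: "observable s d L C A"
    and H: "right_map H" and i: "i < d" and j: "j < d"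
    and S: "fsupp s s S" and Z1: "fsupp s s Z1" and Z2: "fsupp s s Z2"
  shows "fmul L (fA i (fmul s Z1 S)) (H j Z2) - fmul L (fA i Z1) (H j (fmul s S Z2))
    = fmul L (fA i Z1) (fmul L (comm_sum s d fY fA S) (H j Z2))"
proof -
  let ?x = "fmul L (comm_sum s d fY fA S) (H j Z2) + H j (fmul s S Z2)"
  let ?y = "fmul L (fA i Z1) ?x - fmul L (fA i (fmul s Z1 S)) (H j Z2)"
  have "?y = 0"
  proof (rule observable_cancel[OF obs])
    show "fsupp L s ?y"
      by (intro fsupp_add fsupp_diff fsupp_fmul[of L L] fsupp_fA fsupp_comm_sum fsupp_right_map[OF H] i j)
    fix \<omega> Ps assume w: "word_data \<omega> Ps"
    let ?\<omega> = "\<omega> @ [i]" and ?Ps = "Ps @ [Z1]" and ?n = "length \<omega>"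
    obtain x where xl: "x (length ?\<omega>) = ?x"
      and x: "\<forall>i<length ?\<omega>. x i = fmul L (fA (?\<omega> ! i) (?Ps ! i)) (x (Suc i))
        - (if Suc i = length ?\<omega> then fmul L (fA (?\<omega> ! i) (fmul s (?Ps ! i) S)) (H j Z2) else 0)"
      and id: "(if length ?\<omega> = 0 then fmul s S (fmul L fC (H j Z2)) else 0) = fmul L fC (x 0)"
      by (rule right_identity[OF nc H word_data_snoc[OF w i Z1] j Z2 S])
    have len: "length Ps = ?n" using w by (simp add: word_data_def)
    have x': "\<forall>i<length ?\<omega>. x i = fmul L (fA (?\<omega> ! i) (?Ps ! i)) (x (Suc i))
        + (- (if Suc i = length ?\<omega> then fmul L (fA (?\<omega> ! i) (fmul s (?Ps ! i) S)) (H j Z2) else 0))"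
      using x by simp
    have "x 0 = wchain L fA \<omega> Ps (x ?n)" "x ?n = ?y"
      using wchain_snoc_step[OF w x'] xl len by (simp_all add: nth_append)
    then show "fmul L fC (wchain L fA \<omega> Ps ?y) = 0" using id by simp
  qed
  then show ?thesis by (simp add: fmul_add_right algebra_simps)
qed

text \<open>The right map B yields the equations ending in B at once. The other right maps yield
  those ending in A, multiplied by a word in the A_k that ends in some B_k; controllability cancels
  this factor.\<close>

lemma nc_imp_equations:
  assumes nc: "nc_function d (nilp s d Y) (nc_series_eval s d Y f)"
    and con: "controllable s d L A B" and obs: "observable s d L C A"
  shows "output_eqs fA" "output_eqs fB" "inner_eqs fA" "inner_eqs fB"
proof -
  let ?H = "\<lambda>\<omega> Ps k P j Z. fmul L (fA j Z) (wchain L fA \<omega> Ps (fB k P))"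
  have B: "right_map fB" by (simp add: right_map_def)
  have A: "right_map (?H \<omega> Ps k P)" if "word_data \<omega> Ps" "k < d" "fsupp s s P" for \<omega> Ps k P
    using that unfolding right_map_def by blast
  show "output_eqs fB" unfolding output_eqs_def
    using nc_imp_output_right[OF nc B] by (simp add: fmul_assoc)
  show "inner_eqs fB" unfolding inner_eqs_def
    using nc_imp_inner_right[OF nc obs B] by blast
  show "output_eqs fA" unfolding output_eqs_def
  proof (intro allI impI)
    fix S Z :: "'a fmat" and j assume j: "j < d" and S: "fsupp s s S" and Z: "fsupp s s Z"
    let ?y = "fmul L (fmul s S fC) (fA j Z) - fmul L fC (fA j (fmul s S Z))
      - fmul L fC (fmul L (comm_sum s d fY fA S) (fA j Z))"
    have "?y = 0"
    proof (rule controllable_cancel[OF con])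
      show "fsupp s L ?y"
        by (intro fsupp_diff fsupp_fmul[of s L] fsupp_fmul[of L L] fsupp_fmul[of s s] suppC fsupp_fA fsupp_comm_sum j S)
      show "fmul L ?y (wchain L fA \<omega> Ps (fB k P)) = 0"
        if "word_data \<omega> Ps" "k < d" "fsupp s s P" for \<omega> Ps k P
        using nc_imp_output_right[OF nc A[OF that] j Z S]
        by (simp add: fmul_diff_left fmul_assoc)
    qed
    then show "fmul L (fmul s S fC) (fA j Z) - fmul L fC (fA j (fmul s S Z))
        = fmul L fC (fmul L (comm_sum s d fY fA S) (fA j Z))" by simp
  qed
  show "inner_eqs fA" unfolding inner_eqs_def
  proof (intro allI impI)
    fix S Z1 Z2 :: "'a fmat" and i j
    assume i: "i < d" and j: "j < d" and S: "fsupp s s S" and Z: "fsupp s s Z1" "fsupp s s Z2"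
    let ?y = "fmul L (fA i (fmul s Z1 S)) (fA j Z2) - fmul L (fA i Z1) (fA j (fmul s S Z2))
      - fmul L (fA i Z1) (fmul L (comm_sum s d fY fA S) (fA j Z2))"
    have "?y = 0"
    proof (rule controllable_cancel[OF con])
      show "fsupp L L ?y"
        by (intro fsupp_diff fsupp_fmul[of L L] fsupp_fA fsupp_comm_sum i j)
      show "fmul L ?y (wchain L fA \<omega> Ps (fB k P)) = 0"
        if "word_data \<omega> Ps" "k < d" "fsupp s s P" for \<omega> Ps k P
        using nc_imp_inner_right[OF nc obs A[OF that] i j S Z]
        by (simp add: fmul_diff_left fmul_assoc)
    qed
    then show "fmul L (fA i (fmul s Z1 S)) (fA j Z2) - fmul L (fA i Z1) (fA j (fmul s S Z2))
        = fmul L (fA i Z1) (fmul L (comm_sum s d fY fA S) (fA j Z2))" by simp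
  qed
qed

section \<open>Translation back to matrices\<close>

abbreviation "comm_A S \<equiv> matrix_sum L L d (\<lambda>k. A k (commutator S (Y ! k)))"
abbreviation "comm_B S \<equiv> matrix_sum L s d (\<lambda>k. B k (commutator S (Y ! k)))"

lemma commutator_fun:
  assumes "S \<in> carrier_mat s s" "k < d"
  shows "commutator S (Y ! k) \<in> carrier_mat s s"
    and "fun_of_mat (commutator S (Y ! k)) = fcomm s (fun_of_mat S) (fY k)"
  using assms carrier_Y[OF assms(2)]
  by (auto simp: commutator_def fcomm_def fun_of_mat_minus[of _ s s] fun_of_mat_mult[of _ s s _ s]
      mult_carrier_mat[of _ s s _ s])

lemma comm_carrier: "comm_A S \<in> carrier_mat L L" "comm_B S \<in> carrier_mat L s"
  by (simp_all add: matrix_sum_def)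

lemma fun_of_mat_comm:
  assumes "S \<in> carrier_mat s s"
  shows "fun_of_mat (comm_A S) = comm_sum s d fY fA (fun_of_mat S)"
    and "fun_of_mat (comm_B S) = comm_sum s d fY fB (fun_of_mat S)"
  using commutator_fun(1)[OF assms]
  by (simp_all add: comm_sum_def fun_of_mat_matrix_sum carrier_A carrier_B fmap_fun_of_mat
      commutator_fun(2)[OF assms, symmetric])

lemma equations_fun_of_mat:
  assumes S: "S \<in> carrier_mat s s" and Z1: "Z1 \<in> carrier_mat s s" and Z2: "Z2 \<in> carrier_mat s s"
  shows "S * D - D * S = C * comm_B S \<longleftrightarrow>
      fmul s (fun_of_mat S) fD - fmul s fD (fun_of_mat S) = fmul L fC (comm_sum s d fY fB (fun_of_mat S))"
    and "i < d \<Longrightarrow> S * C * B i Z1 - C * B i (S * Z1) = C * comm_A S * B i Z1 \<longleftrightarrow>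
      fmul L (fmul s (fun_of_mat S) fC) (fB i (fun_of_mat Z1)) - fmul L fC (fB i (fmul s (fun_of_mat S) (fun_of_mat Z1)))
        = fmul L fC (fmul L (comm_sum s d fY fA (fun_of_mat S)) (fB i (fun_of_mat Z1)))"
    and "i < d \<Longrightarrow> S * C * A i Z1 - C * A i (S * Z1) = C * comm_A S * A i Z1 \<longleftrightarrow>
      fmul L (fmul s (fun_of_mat S) fC) (fA i (fun_of_mat Z1)) - fmul L fC (fA i (fmul s (fun_of_mat S) (fun_of_mat Z1)))
        = fmul L fC (fmul L (comm_sum s d fY fA (fun_of_mat S)) (fA i (fun_of_mat Z1)))"
    and "i < d \<Longrightarrow> B i (Z1 * S) - B i Z1 * S = A i Z1 * comm_B S \<longleftrightarrow>
      fB i (fmul s (fun_of_mat Z1) (fun_of_mat S)) - fmul s (fB i (fun_of_mat Z1)) (fun_of_mat S)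
        = fmul L (fA i (fun_of_mat Z1)) (comm_sum s d fY fB (fun_of_mat S))"
    and "i < d \<Longrightarrow> j < d \<Longrightarrow>
      A i (Z1 * S) * B j Z2 - A i Z1 * B j (S * Z2) = A i Z1 * comm_A S * B j Z2 \<longleftrightarrow>
      fmul L (fA i (fmul s (fun_of_mat Z1) (fun_of_mat S))) (fB j (fun_of_mat Z2))
          - fmul L (fA i (fun_of_mat Z1)) (fB j (fmul s (fun_of_mat S) (fun_of_mat Z2)))
        = fmul L (fA i (fun_of_mat Z1)) (fmul L (comm_sum s d fY fA (fun_of_mat S)) (fB j (fun_of_mat Z2)))"
    and "i < d \<Longrightarrow> j < d \<Longrightarrow>
      A i (Z1 * S) * A j Z2 - A i Z1 * A j (S * Z2) = A i Z1 * comm_A S * A j Z2 \<longleftrightarrow>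
      fmul L (fA i (fmul s (fun_of_mat Z1) (fun_of_mat S))) (fA j (fun_of_mat Z2))
          - fmul L (fA i (fun_of_mat Z1)) (fA j (fmul s (fun_of_mat S) (fun_of_mat Z2)))
        = fmul L (fA i (fun_of_mat Z1)) (fmul L (comm_sum s d fY fA (fun_of_mat S)) (fA j (fun_of_mat Z2)))"
proof -
  \<comment> \<open>The carrier of a product does not determine its inner dimension, so the product
    rules are instantiated for each shape that occurs.\<close>
  note car = S Z1 Z2 carrier_C carrier_D comm_carrier carrier_A carrier_B
    mult_carrier_mat[of _ s s _ s] mult_carrier_mat[of _ s s _ L] mult_carrier_mat[of _ s L _ L]
    mult_carrier_mat[of _ s L _ s] mult_carrier_mat[of _ L L _ L] mult_carrier_mat[of _ L L _ s]
    mult_carrier_mat[of _ L s _ s]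
  note fm = fun_of_mat_comm[OF S] fun_of_mat_mult[of _ s s _ s] fun_of_mat_mult[of _ s s _ L]
    fun_of_mat_mult[of _ s L _ L] fun_of_mat_mult[of _ s L _ s] fun_of_mat_mult[of _ L L _ L]
    fun_of_mat_mult[of _ L L _ s] fun_of_mat_mult[of _ L s _ s]
    fmap_fun_of_mat[OF S] fmap_fun_of_mat[OF Z1] fmap_fun_of_mat[OF Z2]
  have prods: "fmul s (fun_of_mat S) (fun_of_mat Z1) = fun_of_mat (S * Z1)"
    "fmul s (fun_of_mat Z1) (fun_of_mat S) = fun_of_mat (Z1 * S)"
    "fmul s (fun_of_mat S) (fun_of_mat Z2) = fun_of_mat (S * Z2)"
    by (simp_all add: fm car)
  have lift: "fmap s F (fun_of_mat (S * Z1)) = fun_of_mat (F (S * Z1))"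
    "fmap s F (fun_of_mat (Z1 * S)) = fun_of_mat (F (Z1 * S))"
    "fmap s F (fun_of_mat (S * Z2)) = fun_of_mat (F (S * Z2))" for F :: "'a mat \<Rightarrow> 'a mat"
    by (rule fmap_fun_of_mat, simp add: car)+
  show "S * D - D * S = C * comm_B S \<longleftrightarrow>
      fmul s (fun_of_mat S) fD - fmul s fD (fun_of_mat S) = fmul L fC (comm_sum s d fY fB (fun_of_mat S))"
    by (subst mat_eq_iff_fun_of_mat[of _ s s])
      (simp_all add: car fm fun_of_mat_minus[of _ s s] minus_carrier_mat)
  show "S * C * B i Z1 - C * B i (S * Z1) = C * comm_A S * B i Z1 \<longleftrightarrow>
      fmul L (fmul s (fun_of_mat S) fC) (fB i (fun_of_mat Z1)) - fmul L fC (fB i (fmul s (fun_of_mat S) (fun_of_mat Z1)))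
        = fmul L fC (fmul L (comm_sum s d fY fA (fun_of_mat S)) (fB i (fun_of_mat Z1)))" if "i < d"
    unfolding prods lift using that
    by (subst mat_eq_iff_fun_of_mat[of _ s s])
      (simp_all add: car fm fun_of_mat_minus[of _ s s] minus_carrier_mat fmul_assoc)
  show "S * C * A i Z1 - C * A i (S * Z1) = C * comm_A S * A i Z1 \<longleftrightarrow>
      fmul L (fmul s (fun_of_mat S) fC) (fA i (fun_of_mat Z1)) - fmul L fC (fA i (fmul s (fun_of_mat S) (fun_of_mat Z1)))
        = fmul L fC (fmul L (comm_sum s d fY fA (fun_of_mat S)) (fA i (fun_of_mat Z1)))" if "i < d"
    unfolding prods lift using that
    by (subst mat_eq_iff_fun_of_mat[of _ s L])
      (simp_all add: car fm fun_of_mat_minus[of _ s L] minus_carrier_mat fmul_assoc)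
  show "B i (Z1 * S) - B i Z1 * S = A i Z1 * comm_B S \<longleftrightarrow>
      fB i (fmul s (fun_of_mat Z1) (fun_of_mat S)) - fmul s (fB i (fun_of_mat Z1)) (fun_of_mat S)
        = fmul L (fA i (fun_of_mat Z1)) (comm_sum s d fY fB (fun_of_mat S))" if "i < d"
    unfolding prods lift using that
    by (subst mat_eq_iff_fun_of_mat[of _ L s])
      (simp_all add: car fm fun_of_mat_minus[of _ L s] minus_carrier_mat fmul_assoc)
  show "A i (Z1 * S) * B j Z2 - A i Z1 * B j (S * Z2) = A i Z1 * comm_A S * B j Z2 \<longleftrightarrow>
      fmul L (fA i (fmul s (fun_of_mat Z1) (fun_of_mat S))) (fB j (fun_of_mat Z2))
          - fmul L (fA i (fun_of_mat Z1)) (fB j (fmul s (fun_of_mat S) (fun_of_mat Z2)))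
        = fmul L (fA i (fun_of_mat Z1)) (fmul L (comm_sum s d fY fA (fun_of_mat S)) (fB j (fun_of_mat Z2)))"
    if "i < d" "j < d"
    unfolding prods lift using that
    by (subst mat_eq_iff_fun_of_mat[of _ L s])
      (simp_all add: car fm fun_of_mat_minus[of _ L s] minus_carrier_mat fmul_assoc)
  show "A i (Z1 * S) * A j Z2 - A i Z1 * A j (S * Z2) = A i Z1 * comm_A S * A j Z2 \<longleftrightarrow>
      fmul L (fA i (fmul s (fun_of_mat Z1) (fun_of_mat S))) (fA j (fun_of_mat Z2))
          - fmul L (fA i (fun_of_mat Z1)) (fA j (fmul s (fun_of_mat S) (fun_of_mat Z2)))
        = fmul L (fA i (fun_of_mat Z1)) (fmul L (comm_sum s d fY fA (fun_of_mat S)) (fA j (fun_of_mat Z2)))"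
    if "i < d" "j < d"
    unfolding prods lift using that
    by (subst mat_eq_iff_fun_of_mat[of _ L L])
      (simp_all add: car fm fun_of_mat_minus[of _ L L] minus_carrier_mat fmul_assoc)
qed

lemma equations_iff:
  "constant_eqs \<longleftrightarrow> (\<forall>S\<in>carrier_mat s s. S * D - D * S = C * comm_B S)"
  "output_eqs fB \<longleftrightarrow> (\<forall>S\<in>carrier_mat s s. \<forall>Z\<in>carrier_mat s s. \<forall>i<d.
    S * C * B i Z - C * B i (S * Z) = C * comm_A S * B i Z)"
  "output_eqs fA \<longleftrightarrow> (\<forall>S\<in>carrier_mat s s. \<forall>Z\<in>carrier_mat s s. \<forall>i<d.
    S * C * A i Z - C * A i (S * Z) = C * comm_A S * A i Z)"
  "input_eqs \<longleftrightarrow> (\<forall>S\<in>carrier_mat s s. \<forall>Z\<in>carrier_mat s s. \<forall>i<d.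
    B i (Z * S) - B i Z * S = A i Z * comm_B S)"
  "inner_eqs fB \<longleftrightarrow> (\<forall>S\<in>carrier_mat s s. \<forall>Z1\<in>carrier_mat s s. \<forall>Z2\<in>carrier_mat s s. \<forall>i<d. \<forall>j<d.
    A i (Z1 * S) * B j Z2 - A i Z1 * B j (S * Z2) = A i Z1 * comm_A S * B j Z2)"
  "inner_eqs fA \<longleftrightarrow> (\<forall>S\<in>carrier_mat s s. \<forall>Z1\<in>carrier_mat s s. \<forall>Z2\<in>carrier_mat s s. \<forall>i<d. \<forall>j<d.
    A i (Z1 * S) * A j Z2 - A i Z1 * A j (S * Z2) = A i Z1 * comm_A S * A j Z2)"
  unfolding constant_eqs_def output_eqs_def input_eqs_def inner_eqs_def
    fsupp_iff_fun_of_mat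
  by (simp_all add: equations_fun_of_mat cong: ball_cong) blast+

end

theorem lemma2p2:
  fixes s d L :: nat
    and Y :: "'a::field mat list"
    and f :: "nat list \<Rightarrow> 'a mat list \<Rightarrow> 'a mat"
    and D C :: "'a mat"
    and A B :: "nat \<Rightarrow> 'a mat \<Rightarrow> 'a mat"
  assumes "0 < s"
    and "Y \<in> mat_tuples d s"
    and "generalized_nc_series s d f"
    and "fm_realization s d L D C A B"
    and "admits s d f L D C A B"
    and "controllable s d L A B"
    and "observable s d L C A"
  shows "nc_function d (nilp s d Y) (nc_series_eval s d Y f) \<longleftrightarrow>
    (\<forall>S \<in> carrier_mat s s. \<forall>Z1 \<in> carrier_mat s s. \<forall>Z2 \<in> carrier_mat s s.
       S * D - D * S = C * matrix_sum L s d (\<lambda>k. B k (commutator S (Y ! k))) \<and>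
       (\<forall>i1<d. \<forall>i2<d.
         S * C * B i1 Z1 - C * B i1 (S * Z1)
           = C * matrix_sum L L d (\<lambda>k. A k (commutator S (Y ! k))) * B i1 Z1 \<and>
         S * C * A i1 Z1 - C * A i1 (S * Z1)
           = C * matrix_sum L L d (\<lambda>k. A k (commutator S (Y ! k))) * A i1 Z1 \<and>
         B i1 (Z1 * S) - B i1 Z1 * S
           = A i1 Z1 * matrix_sum L s d (\<lambda>k. B k (commutator S (Y ! k))) \<and>
         A i1 (Z1 * S) * B i2 Z2 - A i1 Z1 * B i2 (S * Z2)
           = A i1 Z1 * matrix_sum L L d (\<lambda>k. A k (commutator S (Y ! k))) * B i2 Z2 \<and>
         A i1 (Z1 * S) * A i2 Z2 - A i1 Z1 * A i2 (S * Z2)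
           = A i1 Z1 * matrix_sum L L d (\<lambda>k. A k (commutator S (Y ! k))) * A i2 Z2))"
    (is "?nc \<longleftrightarrow> ?eqs")
proof -
  interpret realized_series s d L Y f D C A B
    using assms by unfold_locales
  \<comment> \<open>The statement repeats the equations in fewer arguments for all
    \<open>Z1\<close>, \<open>Z2\<close> and \<open>i2\<close>; specializing these to values at hand
    separates the six families.\<close>
  have "?eqs \<longleftrightarrow> constant_eqs \<and> input_eqs \<and> output_eqs fA \<and> output_eqs fB \<and> inner_eqs fA \<and> inner_eqs fB"
    unfolding equations_iff by blast
  moreover have ?nc
    if eqs: "constant_eqs" "input_eqs" "output_eqs fA" "output_eqs fB" "inner_eqs fA" "inner_eqs fB"
    unfolding nc_function_iff using eval_similarity[OF eqs] by blast
  ultimately show ?thesis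
    using nc_imp_constant_eqs nc_imp_input_eqs nc_imp_equations assms(6,7) by blast
qed

end
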